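(* Let $G$ be a cactus graph with cycles $C_1,\ldots,C_c$ and let $S$ be a biactive branch-resolving set in $G$. Then $S$ is a vertex metric generator of $G$ if and only if no cycle $C_i$ contains any of the configurations $\mathcal{A}$, $\mathcal{B}$, $\mathcal{C}$ with respect to $S$ and there are no vertex-critically incident cycles in $G$ with respect to $S$. Likewise, $S$ is an edge metric generator of $G$ if and only if no cycle $C_i$ contains any of the configurations $\mathcal{A}$, $\mathcal{D}$, $\mathcal{E}$ with respect to $S$ and there are no edge-critically incident cycles in $G$ with respect to $S$.
   Context: All graphs are finite, simple and connected; for a vertex $u$ and edge $vw$, $d(u,vw)=\min\{d(u,v),d(u,w)\}$. A vertex $s$ distinguishes vertices (resp. edges) $x,x'$ if $d(s,x)\ne d(s,x')$; $S$ is a vertex (resp. edge) metric generator if every pair of distinct vertices (resp. edges) is distinguished by some vertex of $S$. A cactus graph is a connected graph whose cycles are pairwise edge-disjoint; $g_i$ is the length of $C_i$. For $v\in V(C)$, $T_v(C)$ is the component of $G-E(C)$ containing $v$; $v$ is $S$-active if $T_v(C)$ contains a vertex of $S$; $a_S(C)$ is the number of $S$-active vertices on $C$. A thread hanging at a vertex $v$ of degree $\ge3$ is a path $u_1\cdots u_k$ ($k\ge1$) with $u_1$ a leaf, $u_2,\dots,u_k$ of degree 2 and $u_k$ adjacent to $v$; its length is $k$; it is $S$-free if it contains no vertex of $S$. $S$ is branch-resolving if at every vertex of degree $\ge3$ at most one $S$-free thread hangs, and biactive if every cycle has at least two $S$-active vertices. A cycle $C=v_0\cdots v_{g-1}$ is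 canonically labeled w.r.t. $S$ if $v_0$ is $S$-active and $k=\max\{i:v_i\ S\text{-active}\}$ is as small as possible. With $C$ canonically labeled, $C$ contains: $\mathcal{A}$ if $a_S(C)=2$, $g$ even, $k=g/2$; $\mathcal{B}$ if $k\le\lfloor g/2\rfloor-1$ and an $S$-free thread hangs at some $v_i$, $i\in[k,\lfloor g/2\rfloor-1]\cup[\lceil g/2\rceil+k+1,g-1]\cup\{0\}$; $\mathcal{C}$ if $a_S(C)=2$, $g$ even, $k\le g/2$ and an $S$-free thread of length $\ge g/2-k$ hangs at some $v_i$, $i\in[0,k]$; $\mathcal{D}$ if $k\le\lceil g/2\rceil-1$ and an $S$-free thread hangs at some $v_i$, $i\in[k,\lceil g/2\rceil-1]\cup[\lfloor g/2\rfloor+k+1,g-1]\cup\{0\}$; $\mathcal{E}$ if $a_S(C)=2$ and an $S$-free thread of length $\ge\lfloor g/2\rfloor-k+1$ hangs at some $v_i$, $i\in[0,k]$, and moreover if $g$ is even an $S$-free thread also hangs at $v_j$, $j=g/2+k-i$. An $S$-path $P_i$ of $C_i$ is a minimum-length subpath of $C_i$ containing all $S$-active vertices of $C_i$; $|P_i|$ is its number of edges. $v\in V(C_i)$ is vertex-critical (resp. edge-critical) on $C_i$ if $v$ is an end-vertex of an $S$-path $P_i$ with $|P_i|\le\lfloor g_i/2\rfloor-1$ (resp. $|P_i|\le\lceil g_i/2\rceil-1$). Distinct cycles are vertex-critically (resp. edge-critically) incident w.r.t. $S$ if they share a vertex that is vertex-critical (resp. edge-critical) on both.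
   Formalization: The theorem is proved for cactus graphs that are not paths; for a path every set S, even the empty one, is vacuously biactive and branch-resolving with no configurations, so the literal claim fails (e.g. the path on 3 vertices with S empty). *)

theory Defs
  imports Main
begin

text \<open>
  A graph is given by its vertex set \<open>V\<close> and its set \<open>E\<close> of edges, which are two-element
  subsets of \<open>V\<close>.
\<close>

definition finite_simple_graph :: "'a set \<Rightarrow> 'a set set \<Rightarrow> bool" where
  "finite_simple_graph V E \<longleftrightarrow> finite V \<and> (\<forall>e\<in>E. e \<subseteq> V \<and> card e = 2)"

definition degree :: "'a set set \<Rightarrow> 'a \<Rightarrow> nat" where
  "degree E v = card {e \<in> E. v \<in> e}"

definition walk :: "'a set set \<Rightarrow> 'a list \<Rightarrow> bool" where
  "walk E p \<longleftrightarrow> p \<noteq> [] \<and> (\<forall>i. Suc i < length p \<longrightarrow> {p ! i, p ! Suc i} \<in> E)"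

definition component :: "'a set set \<Rightarrow> 'a \<Rightarrow> 'a set" where
  "component E v = {w. \<exists>p. walk E p \<and> hd p = v \<and> last p = w}"

definition connected_graph :: "'a set \<Rightarrow> 'a set set \<Rightarrow> bool" where
  "connected_graph V E \<longleftrightarrow> V \<noteq> {} \<and> (\<forall>u\<in>V. \<forall>v\<in>V. v \<in> component E u)"

definition gdist :: "'a set set \<Rightarrow> 'a \<Rightarrow> 'a \<Rightarrow> nat" where
  "gdist E u v = (LEAST n. \<exists>p. walk E p \<and> hd p = u \<and> last p = v \<and> length p = Suc n)"

definition edge_dist :: "'a set set \<Rightarrow> 'a \<Rightarrow> 'a set \<Rightarrow> nat" where
  "edge_dist E u e = Min (gdist E u ` e)"

text \<open>
  Paths (the only acyclic connected graphs without a vertex of degree at least 3) have to be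
  excluded from the theorem: on them every set is vacuously biactive and branch-resolving, even
  the empty one.
\<close>

definition path_graph :: "'a set \<Rightarrow> 'a set set \<Rightarrow> bool" where
  "path_graph V E \<longleftrightarrow>
     (\<exists>p. p \<noteq> [] \<and> distinct p \<and> V = set p \<and> E = {{p ! i, p ! Suc i} | i. Suc i < length p})"


definition vertex_metric_generator :: "'a set \<Rightarrow> 'a set set \<Rightarrow> 'a set \<Rightarrow> bool" where
  "vertex_metric_generator V E S \<longleftrightarrow>
     (\<forall>x\<in>V. \<forall>y\<in>V. x \<noteq> y \<longrightarrow> (\<exists>s\<in>S. gdist E s x \<noteq> gdist E s y))"

definition edge_metric_generator :: "'a set set \<Rightarrow> 'a set \<Rightarrow> bool" where
  "edge_metric_generator E S \<longleftrightarrow>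
     (\<forall>e\<in>E. \<forall>f\<in>E. e \<noteq> f \<longrightarrow> (\<exists>s\<in>S. edge_dist E s e \<noteq> edge_dist E s f))"


text \<open>
  A cycle \<open>C\<close> is identified with its edge set, so that it has vertex set \<open>\<Union>C\<close> and length
  \<open>card C\<close>. A labeling \<open>v\<^sub>0, \<dots>, v\<^sub>g\<^sub>-\<^sub>1\<close> of \<open>C\<close> is a list; each cycle has \<open>2 g\<close> labelings.
\<close>

definition closed_edges :: "'a list \<Rightarrow> 'a set set" where
  "closed_edges vs = {{vs ! i, vs ! (Suc i mod length vs)} | i. i < length vs}"

definition labeling :: "'a set set \<Rightarrow> 'a list \<Rightarrow> bool" where
  "labeling C vs \<longleftrightarrow> 3 \<le> length vs \<and> distinct vs \<and> closed_edges vs = C"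

definition cycles :: "'a set set \<Rightarrow> 'a set set set" where
  "cycles E = {C. C \<subseteq> E \<and> (\<exists>vs. labeling C vs)}"

definition cactus :: "'a set \<Rightarrow> 'a set set \<Rightarrow> bool" where
  "cactus V E \<longleftrightarrow> finite_simple_graph V E \<and> connected_graph V E \<and>
     (\<forall>C\<in>cycles E. \<forall>D\<in>cycles E. C \<noteq> D \<longrightarrow> C \<inter> D = {})"


text \<open>\<open>component (E - C) v\<close> is the vertex set of \<open>T\<^sub>v(C)\<close>.\<close>

definition active :: "'a set set \<Rightarrow> 'a set \<Rightarrow> 'a set set \<Rightarrow> 'a \<Rightarrow> bool" where
  "active E S C v \<longleftrightarrow> v \<in> \<Union>C \<and> component (E - C) v \<inter> S \<noteq> {}"

definition num_active :: "'a set set \<Rightarrow> 'a set \<Rightarrow> 'a set set \<Rightarrow> nat" where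
  "num_active E S C = card {v \<in> \<Union>C. active E S C v}"

definition biactive :: "'a set set \<Rightarrow> 'a set \<Rightarrow> bool" where
  "biactive E S \<longleftrightarrow> (\<forall>C\<in>cycles E. 2 \<le> num_active E S C)"

definition thread :: "'a set set \<Rightarrow> 'a \<Rightarrow> 'a list \<Rightarrow> bool" where
  "thread E v us \<longleftrightarrow> 3 \<le> degree E v \<and> walk E us \<and> distinct us \<and> degree E (hd us) = 1 \<and>
     (\<forall>u\<in>set (tl us). degree E u = 2) \<and> {last us, v} \<in> E"

definition free_thread :: "'a set set \<Rightarrow> 'a set \<Rightarrow> 'a \<Rightarrow> 'a list \<Rightarrow> bool" where
  "free_thread E S v us \<longleftrightarrow> thread E v us \<and> set us \<inter> S = {}"

text \<open>A thread is listed starting from its leaf, so distinct lists are distinct threads.\<close>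

definition branch_resolving :: "'a set \<Rightarrow> 'a set set \<Rightarrow> 'a set \<Rightarrow> bool" where
  "branch_resolving V E S \<longleftrightarrow>
     (\<forall>v\<in>V. 3 \<le> degree E v \<longrightarrow>
        (\<forall>us us'. free_thread E S v us \<and> free_thread E S v us' \<longrightarrow> us = us'))"


definition last_active :: "'a set set \<Rightarrow> 'a set \<Rightarrow> 'a set set \<Rightarrow> 'a list \<Rightarrow> nat" where
  "last_active E S C vs = Max {i. i < length vs \<and> active E S C (vs ! i)}"

definition canonical_labeling :: "'a set set \<Rightarrow> 'a set \<Rightarrow> 'a set set \<Rightarrow> 'a list \<Rightarrow> bool" where
  "canonical_labeling E S C vs \<longleftrightarrow> labeling C vs \<and> active E S C (vs ! 0) \<and>
     (\<forall>ws. labeling C ws \<and> active E S C (ws ! 0) \<longrightarrow>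
        last_active E S C vs \<le> last_active E S C ws)"

text \<open>
  In the configurations, \<open>g div 2\<close> and \<open>(g + 1) div 2\<close> are the floor and the ceiling of \<open>g/2\<close>.
  Lower bounds on the length of a thread have \<open>k\<close> moved to the other side, so that
  no truncated subtraction occurs.
\<close>

definition config_A :: "'a set set \<Rightarrow> 'a set \<Rightarrow> 'a set set \<Rightarrow> bool" where
  "config_A E S C \<longleftrightarrow>
     (\<exists>vs. canonical_labeling E S C vs \<and>
        (let g = card C; k = last_active E S C vs in
           num_active E S C = 2 \<and> even g \<and> k = g div 2))"

definition config_B :: "'a set set \<Rightarrow> 'a set \<Rightarrow> 'a set set \<Rightarrow> bool" where
  "config_B E S C \<longleftrightarrow>
     (\<exists>vs. canonical_labeling E S C vs \<and>
        (let g = card C; k = last_active E S C vs in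
           k \<le> g div 2 - 1 \<and>
           (\<exists>i \<in> {k..g div 2 - 1} \<union> {(g + 1) div 2 + k + 1..g - 1} \<union> {0}.
              \<exists>us. free_thread E S (vs ! i) us)))"

definition config_C :: "'a set set \<Rightarrow> 'a set \<Rightarrow> 'a set set \<Rightarrow> bool" where
  "config_C E S C \<longleftrightarrow>
     (\<exists>vs. canonical_labeling E S C vs \<and>
        (let g = card C; k = last_active E S C vs in
           num_active E S C = 2 \<and> even g \<and> k \<le> g div 2 \<and>
           (\<exists>i \<in> {0..k}. \<exists>us. free_thread E S (vs ! i) us \<and> g div 2 \<le> length us + k)))"

definition config_D :: "'a set set \<Rightarrow> 'a set \<Rightarrow> 'a set set \<Rightarrow> bool" where
  "config_D E S C \<longleftrightarrow>
     (\<exists>vs. canonical_labeling E S C vs \<and>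
        (let g = card C; k = last_active E S C vs in
           k \<le> (g + 1) div 2 - 1 \<and>
           (\<exists>i \<in> {k..(g + 1) div 2 - 1} \<union> {g div 2 + k + 1..g - 1} \<union> {0}.
              \<exists>us. free_thread E S (vs ! i) us)))"

text \<open>
  The index \<open>g/2 + k - i\<close> is read cyclically; it exceeds \<open>g - 1\<close> only for \<open>i = 0\<close>,
  \<open>k = g/2\<close>, in which case the cycle contains configuration A anyway.
\<close>

definition config_E :: "'a set set \<Rightarrow> 'a set \<Rightarrow> 'a set set \<Rightarrow> bool" where
  "config_E E S C \<longleftrightarrow>
     (\<exists>vs. canonical_labeling E S C vs \<and>
        (let g = card C; k = last_active E S C vs in
           num_active E S C = 2 \<and>
           (\<exists>i \<in> {0..k}.
              (\<exists>us. free_thread E S (vs ! i) us \<and> g div 2 + 1 \<le> length us + k) \<and>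
              (even g \<longrightarrow> (\<exists>us. free_thread E S (vs ! ((g div 2 + k - i) mod g)) us)))))"


text \<open>
  The subpaths of a cycle are the nonempty initial segments of its labelings; the number of
  edges of \<open>p\<close> is \<open>length p - 1\<close>.
\<close>

definition subpath :: "'a set set \<Rightarrow> 'a list \<Rightarrow> bool" where
  "subpath C p \<longleftrightarrow> p \<noteq> [] \<and> (\<exists>vs n. labeling C vs \<and> p = take n vs)"

definition S_path :: "'a set set \<Rightarrow> 'a set \<Rightarrow> 'a set set \<Rightarrow> 'a list \<Rightarrow> bool" where
  "S_path E S C p \<longleftrightarrow> subpath C p \<and> {v \<in> \<Union>C. active E S C v} \<subseteq> set p \<and>
     (\<forall>q. subpath C q \<and> {v \<in> \<Union>C. active E S C v} \<subseteq> set q \<longrightarrow> length p \<le> length q)"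

definition vertex_critical :: "'a set set \<Rightarrow> 'a set \<Rightarrow> 'a set set \<Rightarrow> 'a \<Rightarrow> bool" where
  "vertex_critical E S C v \<longleftrightarrow>
     (\<exists>p. S_path E S C p \<and> length p - 1 \<le> card C div 2 - 1 \<and> v \<in> {hd p, last p})"

definition edge_critical :: "'a set set \<Rightarrow> 'a set \<Rightarrow> 'a set set \<Rightarrow> 'a \<Rightarrow> bool" where
  "edge_critical E S C v \<longleftrightarrow>
     (\<exists>p. S_path E S C p \<and> length p - 1 \<le> (card C + 1) div 2 - 1 \<and> v \<in> {hd p, last p})"

definition vertex_critically_incident ::
  "'a set set \<Rightarrow> 'a set \<Rightarrow> 'a set set \<Rightarrow> 'a set set \<Rightarrow> bool" where
  "vertex_critically_incident E S C D \<longleftrightarrow>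
     C \<noteq> D \<and> (\<exists>v \<in> \<Union>C \<inter> \<Union>D. vertex_critical E S C v \<and> vertex_critical E S D v)"

definition edge_critically_incident ::
  "'a set set \<Rightarrow> 'a set \<Rightarrow> 'a set set \<Rightarrow> 'a set set \<Rightarrow> bool" where
  "edge_critically_incident E S C D \<longleftrightarrow>
     C \<noteq> D \<and> (\<exists>v \<in> \<Union>C \<inter> \<Union>D. edge_critical E S C v \<and> edge_critical E S D v)"

end

theory Submission
  imports Defs
begin

text \<open>
  Call a neighbour \<open>n\<close> of \<open>m\<close> outward if every vertex of \<open>S\<close> is farther from \<open>n\<close> than from \<open>m\<close>
  (in the edge version: not closer to \<open>n\<close>). Two outward neighbours of one vertex give two
  undistinguished vertices (edges). An outward neighbour across a bridge starts an \<open>S\<close>-free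
  thread, and one along a cycle \<open>C\<close> means that the active vertices of \<open>C\<close> lie on a short arc on the
  other side of \<open>m\<close>. Hence, as \<open>S\<close> is biactive and branch-resolving, two outward neighbours of one
  vertex exist iff some cycle contains configuration \<open>\<B>\<close> (\<open>\<D>\<close> for edges) or two cycles are
  critically incident.

  Conversely, let \<open>x\<close>, \<open>x'\<close> be undistinguished. If no cycle separates them, then the midpoint of a
  geodesic has two outward neighbours. If \<open>C\<close> separates them, so that \<open>x\<close> hangs at \<open>p\<close> and \<open>x'\<close> at
  \<open>q\<close>, compare their heights \<open>a\<close>, \<open>b\<close> over \<open>C\<close>: if \<open>\<bar>a - b\<bar> = d(p, q)\<close> then \<open>p\<close> or \<open>q\<close> has two
  outward neighbours, and otherwise \<open>p\<close> and \<open>q\<close> are inactive and the equations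
  \<open>d(u, p) + a = d(u, q) + b\<close> leave room for only two active vertices \<open>u\<close>, which gives \<open>\<A>\<close>, \<open>\<C>\<close> or
  \<open>\<E>\<close>.
\<close>

section \<open>Walks and distances\<close>

text \<open>Distances are computed through gates: a component hanging at a cycle vertex, or the side
  behind a bridge, can be entered at one vertex only, so distances add up there. For fixed
  \<open>p\<close>, \<open>q\<close> and heights \<open>a \<ge> b\<close>, each of the two arcs
  between \<open>p\<close> and \<open>q\<close> holds at most one vertex \<open>u\<close> with
  \<open>d(u, p) + a = d(u, q) + b\<close>; biactivity forces both to be active. Solving for them
  gives \<open>k = g/2 - (a - b)\<close>, and a thread of length at least \<open>a\<close> at
  \<open>p\<close> then has the length at least \<open>g/2 - k\<close> demanded by the
  configurations. Canonical labelings are awkward to produce because of their minimality. They are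
  traded for arbitrary labelings with a bound on the last active index: a span of at most half the
  cycle is automatically minimal. The obstacle is a vertex of degree 2, where branch resolution says
  nothing. Two outward neighbours across bridges at such a vertex force the whole graph to be a
  path. The exclusion of paths is used a second time to see that \<open>S\<close> is
  nonempty.\<close>

definition adj :: "'a set set \<Rightarrow> ('a \<times> 'a) set" where
  "adj E = {(x, y). {x, y} \<in> E}"

lemma adj_commute: "(x, y) \<in> adj E \<longleftrightarrow> (y, x) \<in> adj E"
  by (simp add: adj_def insert_commute)

lemma walk_single [simp]: "walk E [v]"
  by (simp add: walk_def)

lemma walk_Cons: "walk E (x # p) \<longleftrightarrow> p = [] \<or> ({x, hd p} \<in> E \<and> walk E p)"
proof (cases p)
  case Nil
  then show ?thesis by (simp add: walk_def)
next
  case (Cons y q)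
  have split: "(\<forall>i. P i) \<longleftrightarrow> P 0 \<and> (\<forall>i. P (Suc i))" for P :: "nat \<Rightarrow> bool"
    by (metis not0_implies_Suc)
  have "(\<forall>i. Suc i < length (x # p) \<longrightarrow> {(x # p) ! i, (x # p) ! Suc i} \<in> E) \<longleftrightarrow>
    {x, hd p} \<in> E \<and> (\<forall>i. Suc i < length p \<longrightarrow> {p ! i, p ! Suc i} \<in> E)"
    by (subst split) (simp add: Cons)
  then show ?thesis using Cons by (simp add: walk_def)
qed

lemma walk_append:
  assumes "p \<noteq> []" "q \<noteq> []"
  shows "walk E (p @ q) \<longleftrightarrow> walk E p \<and> walk E q \<and> {last p, hd q} \<in> E"
  using assms
proof (induction p)
  case (Cons x p)
  then show ?case by (cases "p = []") (auto simp: walk_Cons)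
qed simp

lemma walk_rev: "walk E (rev p) \<longleftrightarrow> walk E p"
proof (induction p)
  case (Cons x p)
  then show ?case
    by (cases "p = []") (auto simp: walk_Cons walk_append last_rev insert_commute)
qed (simp add: walk_def)

lemma walk_take: "walk E p \<Longrightarrow> 0 < n \<Longrightarrow> walk E (take n p)"
  by (auto simp: walk_def)

lemma walk_drop: "walk E p \<Longrightarrow> n < length p \<Longrightarrow> walk E (drop n p)"
  by (auto simp: walk_def)

lemma walk_mono: "walk F p \<Longrightarrow> F \<subseteq> E \<Longrightarrow> walk E p"
  by (auto simp: walk_def)

text \<open>Handing walks over to \<open>relpow\<close> makes concatenation and the splitting off of
  a step available from the library; a walk with \<open>n\<close> edges is a list of
  \<open>Suc n\<close> vertices.\<close>

lemma walk_relpow: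
  "(\<exists>p. walk E p \<and> hd p = u \<and> last p = v \<and> length p = Suc n) \<longleftrightarrow> (u, v) \<in> adj E ^^ n"
proof (induction n arbitrary: u)
  case 0
  have "\<exists>p. walk E p \<and> hd p = v \<and> last p = v \<and> length p = Suc 0"
    by (rule exI[of _ "[v]"]) simp
  then show ?case by (auto simp: length_Suc_conv)
next
  case (Suc n)
  show ?case
  proof
    assume "\<exists>p. walk E p \<and> hd p = u \<and> last p = v \<and> length p = Suc (Suc n)"
    then obtain q where q: "walk E (u # q)" "last q = v" "length q = Suc n"
      by (auto simp: length_Suc_conv split: if_splits)
    then have "(u, hd q) \<in> adj E" "walk E q"
      by (auto simp: walk_Cons adj_def)
    moreover have "(hd q, v) \<in> adj E ^^ n"
      using Suc.IH[of "hd q"] q \<open>walk E q\<close> by blast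
    ultimately show "(u, v) \<in> adj E ^^ Suc n"
      using relpow_Suc_I2 by fast
  next
    assume "(u, v) \<in> adj E ^^ Suc n"
    then obtain w where "(u, w) \<in> adj E" "(w, v) \<in> adj E ^^ n"
      by (meson relpow_Suc_D2)
    then obtain p where "walk E p" "hd p = w" "last p = v" "length p = Suc n" "{u, w} \<in> E"
      using Suc.IH[of w] by (auto simp: adj_def)
    then have "walk E (u # p) \<and> hd (u # p) = u \<and> last (u # p) = v \<and> length (u # p) = Suc (Suc n)"
      by (auto simp: walk_Cons)
    then show "\<exists>p. walk E p \<and> hd p = u \<and> last p = v \<and> length p = Suc (Suc n)" by blast
  qed
qed

lemma component_rtrancl: "w \<in> component E v \<longleftrightarrow> (v, w) \<in> (adj E)\<^sup>*"
proof -
  have "w \<in> component E v \<longleftrightarrow> (\<exists>n p. walk E p \<and> hd p = v \<and> last p = w \<and> length p = Suc n)"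
    unfolding component_def by (auto simp: walk_def) (metis length_Suc_conv neq_Nil_conv)
  then show ?thesis
    by (simp add: walk_relpow rtrancl_is_UN_relpow)
qed

lemma component_self [simp]: "v \<in> component E v"
  by (simp add: component_rtrancl)

lemma component_sym: "w \<in> component E v \<Longrightarrow> v \<in> component E w"
  unfolding component_rtrancl
  by (rule symD[OF sym_rtrancl]) (auto simp: sym_def adj_commute)

lemma component_trans: "w \<in> component E v \<Longrightarrow> x \<in> component E w \<Longrightarrow> x \<in> component E v"
  unfolding component_rtrancl by (rule rtrancl_trans)

lemma component_step: "w \<in> component E v \<Longrightarrow> {w, x} \<in> E \<Longrightarrow> x \<in> component E v"
  unfolding component_rtrancl by (auto simp: adj_def intro: rtrancl_into_rtrancl)

lemma component_mono: "w \<in> component F v \<Longrightarrow> F \<subseteq> E \<Longrightarrow> w \<in> component E v"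
  unfolding component_def using walk_mono by (smt (verit) mem_Collect_eq)

text \<open>The induction principle behind most later inclusions of a component in a set: only
  closure under edges has to be checked.\<close>

lemma component_closed:
  assumes "w \<in> component E v" "v \<in> A" "\<And>x y. x \<in> A \<Longrightarrow> {x, y} \<in> E \<Longrightarrow> y \<in> A"
  shows "w \<in> A"
  using assms(1) unfolding component_rtrancl
proof (induction rule: rtrancl_induct)
  case base
  show ?case by (rule assms(2))
next
  case (step y z)
  then show ?case using assms(3) by (simp add: adj_def)
qed

text \<open>Serves to delete edges: if no deleted edge touches the smaller component, that component
  is closed under all edges of the larger graph.\<close>

lemma component_restrict:
  assumes "w \<in> component E v" "\<And>x y. x \<in> component F v \<Longrightarrow> {x, y} \<in> E \<Longrightarrow> {x, y} \<in> F"
  shows "w \<in> component F v"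
proof (rule component_closed[OF assms(1)])
  fix x y assume "x \<in> component F v" "{x, y} \<in> E"
  then show "y \<in> component F v" using assms(2) component_step by fast
qed simp

lemma component_distinct_walk:
  assumes "w \<in> component E v"
  obtains p where "walk E p" "distinct p" "hd p = v" "last p = w"
proof -
  have "\<exists>p. walk E p \<and> distinct p \<and> hd p = v \<and> last p = w"
    using assms unfolding component_rtrancl
  proof (induction rule: rtrancl_induct)
    case base
    show ?case by (rule exI[of _ "[v]"]) simp
  next
    case (step y z)
    then obtain p where p: "walk E p" "distinct p" "hd p = v" "last p = y"
      using step.IH by blast
    have ne: "p \<noteq> []" using p(1) by (simp add: walk_def)
    show ?case
    proof (cases "z \<in> set p")
      \<comment> \<open>The walk has been at \<open>z\<close> before; its part up to that visit
        already ends there.\<close>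
      case True
      then obtain i where i: "i < length p" "p ! i = z" by (auto simp: in_set_conv_nth)
      have "walk E (take (Suc i) p)"
        using p(1) by (rule walk_take) simp
      moreover have "last (take (Suc i) p) = z"
        using i by (simp add: take_Suc_conv_app_nth)
      moreover have "distinct (take (Suc i) p)" "hd (take (Suc i) p) = v"
        using p by simp_all
      ultimately show ?thesis by blast
    next
      case False
      have "walk E (p @ [z])"
        using p(1,4) step(2) ne by (simp add: walk_append adj_def)
      moreover have "distinct (p @ [z])" "hd (p @ [z]) = v" "last (p @ [z]) = z"
        using p False ne by simp_all
      ultimately show ?thesis by blast
    qed
  qed
  then obtain p where "walk E p" "distinct p" "hd p = v" "last p = w" by blast
  then show ?thesis by (rule that)
qed

lemma gdist_relpow: "gdist E u v = (LEAST n. (u, v) \<in> adj E ^^ n)"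
  by (simp add: gdist_def walk_relpow)

lemma gdist_le: "(u, v) \<in> adj E ^^ n \<Longrightarrow> gdist E u v \<le> n"
  unfolding gdist_relpow by (rule Least_le)

lemma gdist_attained: "v \<in> component E u \<Longrightarrow> (u, v) \<in> adj E ^^ gdist E u v"
proof -
  assume "v \<in> component E u"
  then obtain n where "(u, v) \<in> adj E ^^ n"
    unfolding component_rtrancl by (metis rtrancl_imp_relpow)
  then show ?thesis unfolding gdist_relpow by (rule LeastI)
qed

lemma gdist_self [simp]: "gdist E v v = 0"
  using gdist_le[of v v 0 E] by simp

lemma relpow_adj_sym: "(u, v) \<in> adj E ^^ n \<Longrightarrow> (v, u) \<in> adj E ^^ n"
proof (induction n arbitrary: v)
  case (Suc n)
  then obtain w where "(u, w) \<in> adj E ^^ n" "(w, v) \<in> adj E" by auto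
  then show ?case using Suc.IH[of w] relpow_Suc_I2[of v w "adj E" u n] by (simp add: adj_commute)
qed auto

lemma gdist_commute: "gdist E u v = gdist E v u"
  unfolding gdist_relpow by (metis relpow_adj_sym)

text \<open>A lower bound on a distance concerns all walks at once; a function that grows by at most
  1 along edges provides it. It is applied to the projection of the graph onto a cycle.\<close>

lemma gdist_lipschitz:
  assumes "\<And>x y. {x, y} \<in> E \<Longrightarrow> (f y :: nat) \<le> f x + 1" "v \<in> component E u"
  shows "f v \<le> f u + gdist E u v"
proof -
  have "f v \<le> f u + n" if "(u, v) \<in> adj E ^^ n" for n
    using that
  proof (induction n arbitrary: v)
    case (Suc n)
    then obtain w where "(u, w) \<in> adj E ^^ n" "(w, v) \<in> adj E" by auto
    then show ?case using Suc.IH[of w] assms(1)[of w v] by (auto simp: adj_def)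
  qed auto
  then show ?thesis using gdist_attained assms(2) by fast
qed

section \<open>Cycles and their labelings\<close>

lemma closed_edges_eq:
  "closed_edges vs = (\<lambda>i. {vs ! i, vs ! (Suc i mod length vs)}) ` {..<length vs}"
  by (auto simp: closed_edges_def)

text \<open>Also applied with \<open>E\<close> replaced by \<open>closed_edges vs\<close> itself, to
  read off that the steps of \<open>vs\<close> and its closing edge lie in that set.\<close>

lemma closed_edges_subset_iff:
  assumes "vs \<noteq> []"
  shows "closed_edges vs \<subseteq> E \<longleftrightarrow> walk E vs \<and> {last vs, hd vs} \<in> E"
proof -
  let ?n = "length vs"
  have n: "?n > 0" using assms by simp
  have "closed_edges vs \<subseteq> E \<longleftrightarrow> (\<forall>i<?n. {vs ! i, vs ! (Suc i mod ?n)} \<in> E)"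
    by (auto simp: closed_edges_eq)
  also have "\<dots> \<longleftrightarrow> (\<forall>i. Suc i < ?n \<longrightarrow> {vs ! i, vs ! (Suc i mod ?n)} \<in> E) \<and>
      {vs ! (?n - 1), vs ! (Suc (?n - 1) mod ?n)} \<in> E"
    using n by (metis Suc_lessI Suc_lessD diff_Suc_1 diff_less less_one)
  also have "\<dots> \<longleftrightarrow> walk E vs \<and> {last vs, hd vs} \<in> E"
    using assms by (auto simp: walk_def last_conv_nth hd_conv_nth)
  finally show ?thesis .
qed

lemma card_closed_edges:
  assumes "distinct vs" "3 \<le> length vs"
  shows "card (closed_edges vs) = length vs"
proof -
  let ?n = "length vs"
  have "inj_on (\<lambda>i. {vs ! i, vs ! (Suc i mod ?n)}) {..<?n}"
  proof (rule inj_onI)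
    fix i j assume ij: "i \<in> {..<?n}" "j \<in> {..<?n}"
      and eq: "{vs ! i, vs ! (Suc i mod ?n)} = {vs ! j, vs ! (Suc j mod ?n)}"
    have *: "vs ! a = vs ! b \<longleftrightarrow> a = b" if "a < ?n" "b < ?n" for a b
      using assms(1) that by (simp add: nth_eq_iff_index_eq)
    have "?n > 0" using assms(2) by linarith
    then have lt: "Suc i mod ?n < ?n" "Suc j mod ?n < ?n" by simp_all
    \<comment> \<open>Equal edges at different indices would make each index the cyclic successor of
      the other, which needs length 2.\<close>
    from eq have "i = j \<or> (i = Suc j mod ?n \<and> Suc i mod ?n = j)"
      using ij lt by (auto simp: doubleton_eq_iff *)
    then show "i = j" using assms(2) ij by (auto simp: mod_Suc split: if_splits)
  qed
  then show ?thesis by (simp add: closed_edges_eq card_image)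
qed

lemma labeling_length: "labeling C vs \<Longrightarrow> length vs = card C"
  unfolding labeling_def by (metis card_closed_edges)

lemma labeling_set:
  assumes "labeling C vs" shows "\<Union>C = set vs"
proof -
  have n: "length vs > 0" using assms by (auto simp: labeling_def)
  have C: "C = (\<lambda>i. {vs ! i, vs ! (Suc i mod length vs)}) ` {..<length vs}"
    using assms by (simp add: labeling_def closed_edges_eq)
  show ?thesis
  proof
    show "\<Union>C \<subseteq> set vs" using n by (auto simp: C)
    show "set vs \<subseteq> \<Union>C" by (auto simp: C in_set_conv_nth)
  qed
qed

lemma labeling_edge: "labeling C vs \<Longrightarrow> Suc i < length vs \<Longrightarrow> {vs ! i, vs ! Suc i} \<in> C"
  by (auto simp: labeling_def closed_edges_def intro!: exI[of _ i])

lemma labeling_closing_edge: "labeling C vs \<Longrightarrow> {vs ! (length vs - 1), vs ! 0} \<in> C"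
proof -
  assume lab: "labeling C vs"
  then have n: "length vs > 0" by (auto simp: labeling_def)
  then have "Suc (length vs - 1) mod length vs = 0" by simp
  then have "{vs ! (length vs - 1), vs ! 0} \<in> closed_edges vs"
    unfolding closed_edges_def using n by (auto intro!: exI[of _ "length vs - 1"])
  then show ?thesis using lab by (simp add: labeling_def)
qed

lemma labeling_edgeE:
  assumes "labeling C vs" "e \<in> C"
  obtains i where "Suc i < length vs" "e = {vs ! i, vs ! Suc i}"
    | "e = {vs ! (length vs - 1), vs ! 0}"
proof -
  obtain i where i: "i < length vs" "e = {vs ! i, vs ! (Suc i mod length vs)}"
    using assms by (auto simp: labeling_def closed_edges_def)
  show ?thesis
  proof (cases "Suc i = length vs")
    case True
    then have "i = length vs - 1" by simp
    then show ?thesis using i True that(2) by simp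
  next
    case False
    then show ?thesis using i that(1)[of i] by simp
  qed
qed

text \<open>A step of \<open>f\<close> may go forward or backward, so that rotations and reflections
  are both instances. Only one inclusion of the edge sets is checked; equal cardinalities give the
  other.\<close>

lemma labeling_transform:
  assumes lab: "labeling C vs" and g: "g = length vs"
    and inj: "inj_on f {..<g}" and into: "\<And>i. i < g \<Longrightarrow> f i < g"
    and next_f: "\<And>i. i < g \<Longrightarrow>
      f (Suc i mod g) = Suc (f i) mod g \<or> f i = Suc (f (Suc i mod g)) mod g"
  shows "labeling C (map (\<lambda>i. vs ! f i) [0..<g])"
proof -
  let ?ws = "map (\<lambda>i. vs ! f i) [0..<g]"
  have g3: "3 \<le> g" and dist: "distinct vs" and C: "closed_edges vs = C"
    using lab g by (auto simp: labeling_def)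
  have "distinct ?ws"
    using inj into dist by (auto simp: distinct_map g nth_eq_iff_index_eq inj_on_def)
  moreover have "closed_edges ?ws \<subseteq> closed_edges vs"
  proof
    fix e assume "e \<in> closed_edges ?ws"
    then obtain i where i: "i < g" "e = {?ws ! i, ?ws ! (Suc i mod g)}"
      by (auto simp: closed_edges_def)
    moreover have lt: "Suc i mod g < g" using g3 by simp
    ultimately have e: "e = {vs ! f i, vs ! f (Suc i mod g)}" by simp
    from next_f[OF i(1)] show "e \<in> closed_edges vs"
    proof
      assume "f (Suc i mod g) = Suc (f i) mod g"
      then show ?thesis using into[OF i(1)] e g by (auto simp: closed_edges_def)
    next
      assume *: "f i = Suc (f (Suc i mod g)) mod g"
      have "e = {vs ! f (Suc i mod g), vs ! (Suc (f (Suc i mod g)) mod g)}"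
        unfolding e * [symmetric] by (rule insert_commute)
      then show ?thesis using into[OF lt] g unfolding closed_edges_def by blast
    qed
  qed
  ultimately have "closed_edges ?ws = closed_edges vs"
    using card_closed_edges[of ?ws] card_closed_edges[of vs] g3 g dist
    by (intro card_subset_eq) (auto simp: closed_edges_eq)
  then show ?thesis using \<open>distinct ?ws\<close> g3 C by (simp add: labeling_def)
qed

text \<open>This is \<open>i + j\<close> modulo \<open>g\<close>, and the next one is
  \<open>i - j\<close> modulo \<open>g\<close>. Case distinctions replace \<open>mod\<close>, so
  that linear arithmetic can decide goals about relabeled indices.\<close>

abbreviation rotated :: "nat \<Rightarrow> nat \<Rightarrow> nat \<Rightarrow> nat" where
  "rotated g i j \<equiv> if i + j < g then i + j else i + j - g"

abbreviation reflected :: "nat \<Rightarrow> nat \<Rightarrow> nat \<Rightarrow> nat" where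
  "reflected g i j \<equiv> if j \<le> i then i - j else i + g - j"

lemma labeling_rotate:
  assumes lab: "labeling C vs" and i: "i < length vs"
  obtains ws where "labeling C ws" "length ws = length vs"
    "\<And>j. j < length vs \<Longrightarrow> ws ! j = vs ! (rotated (length vs) i j)"
proof -
  let ?g = "length vs"
  let ?f = "\<lambda>j. rotated ?g i j"
  have "labeling C (map (\<lambda>j. vs ! ?f j) [0..<?g])"
    using i by (intro labeling_transform[OF lab refl]) (auto simp: inj_on_def mod_Suc)
  then show ?thesis using that[of "map (\<lambda>j. vs ! ?f j) [0..<?g]"] by simp
qed

lemma labeling_reflect:
  assumes lab: "labeling C vs" and i: "i < length vs"
  obtains ws where "labeling C ws" "length ws = length vs"
    "\<And>j. j < length vs \<Longrightarrow> ws ! j = vs ! (reflected (length vs) i j)"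
proof -
  let ?g = "length vs"
  let ?f = "\<lambda>j. reflected ?g i j"
  have "labeling C (map (\<lambda>j. vs ! ?f j) [0..<?g])"
    using i by (intro labeling_transform[OF lab refl]) (auto simp: inj_on_def mod_Suc)
  then show ?thesis using that[of "map (\<lambda>j. vs ! ?f j) [0..<?g]"] by simp
qed

lemma cyclesI:
  assumes "3 \<le> length vs" "distinct vs" "walk E vs" "{last vs, hd vs} \<in> E"
  shows "closed_edges vs \<in> cycles E"
proof -
  have "vs \<noteq> []" using assms(1) by auto
  then show ?thesis
    using assms closed_edges_subset_iff[of vs E] unfolding cycles_def labeling_def by blast
qed

text \<open>The distance of the vertices numbered \<open>i\<close> and \<open>j\<close> on a cycle
  of length \<open>g\<close>. Distinguishing the order of \<open>i\<close> and \<open>j\<close>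
  keeps the subtractions exact.\<close>

definition cdist :: "nat \<Rightarrow> nat \<Rightarrow> nat \<Rightarrow> nat" where
  "cdist g i j = (if i \<le> j then min (j - i) (g - (j - i)) else min (i - j) (g - (i - j)))"

lemma cdist_commute: "cdist g i j = cdist g j i"
  by (simp add: cdist_def)

lemma cyclesE:
  assumes "C \<in> cycles E"
  obtains vs where "labeling C vs" "C \<subseteq> E"
  using assms by (auto simp: cycles_def)

lemma labeling_from:
  assumes "C \<in> cycles E" "u \<in> \<Union>C"
  obtains vs where "labeling C vs" "vs ! 0 = u"
proof -
  obtain vs where vs: "labeling C vs" using assms(1) by (rule cyclesE)
  then obtain i where i: "i < length vs" "vs ! i = u"
    using assms(2) labeling_set[OF vs] by (auto simp: in_set_conv_nth)
  obtain ws where "labeling C ws" "ws ! 0 = vs ! i"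
    using labeling_rotate[OF vs i(1)] i by (metis add.right_neutral not_gr_zero not_less_zero)
  then show ?thesis using that i by simp
qed

locale cactus_graph =
  fixes V :: "'a set" and E :: "'a set set"
  assumes cactus: "cactus V E"
begin

lemma edge_in_V: "{x, y} \<in> E \<Longrightarrow> x \<in> V \<and> y \<in> V"
  using cactus by (auto simp: cactus_def finite_simple_graph_def)

lemma edge_neq: "{x, y} \<in> E \<Longrightarrow> x \<noteq> y"
  using cactus by (auto simp: cactus_def finite_simple_graph_def)

lemma edgeE:
  assumes "e \<in> E" obtains x y where "e = {x, y}" "x \<noteq> y"
proof -
  have "card e = 2" using assms cactus by (auto simp: cactus_def finite_simple_graph_def)
  then show ?thesis using that by (auto simp: card_2_iff)
qed

lemma finite_V: "finite V"
  using cactus by (auto simp: cactus_def finite_simple_graph_def)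

lemma connected: "u \<in> V \<Longrightarrow> v \<in> V \<Longrightarrow> v \<in> component E u"
  using cactus by (auto simp: cactus_def connected_graph_def)

lemma component_in_V: "v \<in> component E u \<Longrightarrow> u \<in> V \<Longrightarrow> v \<in> V"
  by (rule component_closed) (auto dest: edge_in_V)

lemma component_sub_V: "v \<in> component F u \<Longrightarrow> F \<subseteq> E \<Longrightarrow> u \<in> V \<Longrightarrow> v \<in> V"
  by (meson component_in_V component_mono)

lemma cycles_disjoint:
  "C \<in> cycles E \<Longrightarrow> D \<in> cycles E \<Longrightarrow> e \<in> C \<Longrightarrow> e \<in> D \<Longrightarrow> C = D"
  using cactus unfolding cactus_def by blast

lemma cycle_in_V: "C \<in> cycles E \<Longrightarrow> u \<in> \<Union>C \<Longrightarrow> u \<in> V"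
  using cactus unfolding cactus_def cycles_def finite_simple_graph_def by auto

text \<open>A path avoiding the edges of a cycle but joining two of its vertices could be closed up
  along the cycle to a second cycle sharing an edge with the first one.\<close>

lemma component_cycle_vertex:
  assumes C: "C \<in> cycles E" and u: "u \<in> \<Union>C" and v: "v \<in> \<Union>C" and conn: "v \<in> component (E - C) u"
  shows "v = u"
proof (rule ccontr)
  assume "v \<noteq> u"
  \<comment> \<open>Paths off \<open>C\<close> joining two of its vertices; one of minimal length
    meets \<open>C\<close> only in its ends.\<close>
  define P where "P p \<longleftrightarrow> walk (E - C) p \<and> distinct p \<and> hd p \<in> \<Union>C \<and> last p \<in> \<Union>C \<and> 2 \<le> length p"
    for p
  obtain p0 where p0: "walk (E - C) p0" "distinct p0" "hd p0 = u" "last p0 = v"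
    using component_distinct_walk[OF conn] .
  have "2 \<le> length p0"
  proof (rule ccontr)
    assume "\<not> 2 \<le> length p0"
    then have "length p0 = 1 \<or> p0 = []" by (cases p0) (auto simp: Suc_le_eq)
    then have "hd p0 = last p0" using p0(1) by (auto simp: walk_def length_Suc_conv)
    then show False using p0 \<open>v \<noteq> u\<close> by simp
  qed
  then have "P p0" using p0 u v by (simp add: P_def)
  then obtain p where "P p" and min: "\<And>q. P q \<Longrightarrow> length p \<le> length q"
    using ex_has_least_nat[of P p0 length] by blast
  then have p: "walk (E - C) p" "distinct p" "hd p \<in> \<Union>C" "last p \<in> \<Union>C" "2 \<le> length p"
    by (simp_all add: P_def)
  have interior: "p ! k \<notin> \<Union>C" if "0 < k" "k < length p - 1" for k
  proof
    assume k: "p ! k \<in> \<Union>C"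
    have "P (take (Suc k) p)" unfolding P_def
    proof (intro conjI)
      show "walk (E - C) (take (Suc k) p)" using p(1) by (rule walk_take) simp
      show "last (take (Suc k) p) \<in> \<Union>C" using k that by (simp add: take_Suc_conv_app_nth)
    qed (use p that in auto)
    then show False using min that by fastforce
  qed
  obtain vs where vs: "labeling C vs" "vs ! 0 = hd p" using labeling_from[OF C p(3)] .
  have CE: "C \<subseteq> E" using C by (simp add: cycles_def)
  have vs3: "3 \<le> length vs" "distinct vs" "closed_edges vs = C" using vs by (auto simp: labeling_def)
  obtain j where j: "j < length vs" "vs ! j = last p"
    using p(4) labeling_set[OF vs(1)] by (auto simp: in_set_conv_nth)
  have pne: "p \<noteq> []" using p(5) by auto
  have p0h: "p ! 0 = hd p" "p ! (length p - 1) = last p" using pne by (simp_all add: hd_conv_nth last_conv_nth)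
  have "hd p \<noteq> last p"
    using p(2,5) pne by (metis p0h nth_eq_iff_index_eq diff_less length_greater_0_conv less_numeral_extra(1)
        One_nat_def Suc_1 diff_is_0_eq not_less_eq_eq)
  then have j0: "j \<noteq> 0" using j vs(2) by metis
  \<comment> \<open>Along \<open>p\<close> from \<open>vs ! 0\<close> to \<open>vs ! j\<close>, then
    onward along \<open>C\<close> back to \<open>vs ! 0\<close>.\<close>
  define ws where "ws = p @ drop (Suc j) vs"
  have disj: "set p \<inter> set (drop (Suc j) vs) = {}"
  proof -
    have False if x: "x \<in> set p" "x \<in> set (drop (Suc j) vs)" for x
    proof -
      obtain k where k: "k < length p" "p ! k = x" using x(1) by (auto simp: in_set_conv_nth)
      obtain l where l: "Suc j + l < length vs" "vs ! (Suc j + l) = x"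
        using x(2) j(1) by (metis in_set_conv_nth length_drop less_diff_conv nth_drop
            add.commute Suc_leI)
      have "x \<in> \<Union>C" using l labeling_set[OF vs(1)] by (metis nth_mem)
      then have "k = 0 \<or> k = length p - 1" using interior[of k] k by force
      then have "x = vs ! 0 \<or> x = vs ! j" using k p0h vs(2) j by auto
      then have "Suc j + l = 0 \<or> Suc j + l = j"
        using l j(1) vs3 by (metis nth_eq_iff_index_eq length_pos_if_in_set nth_mem)
      then show False by simp
    qed
    then show ?thesis by blast
  qed
  have walk_vs: "walk E vs" using closed_edges_subset_iff[of vs E] vs3 CE by force
  have walk_p: "walk E p" using p(1) by (rule walk_mono) auto
  have closing: "{vs ! (length vs - 1), vs ! 0} \<in> C" using labeling_closing_edge[OF vs(1)] .
  have first: "{p ! 0, p ! 1} \<in> E - C" using p(1,5) by (simp add: walk_def)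
  have ws: "walk E ws \<and> last ws = vs ! (length vs - 1) \<and> hd ws = vs ! 0 \<and> 3 \<le> length ws"
  proof (cases "Suc j = length vs")
    case True
    \<comment> \<open>Nothing of \<open>C\<close> is appended here, so \<open>ws = p\<close>; if
      \<open>p\<close> were a single edge, this would be the closing edge of \<open>C\<close>, which
      \<open>p\<close> avoids.\<close>
    have "length p \<noteq> 2"
    proof
      assume "length p = 2"
      then have "{p ! 0, p ! 1} = {vs ! (length vs - 1), vs ! 0}"
        using p0h vs(2) j True by (metis diff_Suc_1 insert_commute one_add_one plus_1_eq_Suc)
      then show False using first closing by simp
    qed
    moreover have "last p = vs ! (length vs - 1)" using True j by (metis diff_Suc_1)
    ultimately show ?thesis using walk_p p(5) True vs(2) unfolding ws_def by auto
  next
    case False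
    then have lt: "Suc j < length vs" using j by simp
    have "hd (drop (Suc j) vs) = vs ! Suc j" using lt by (simp add: hd_drop_conv_nth)
    moreover have "{vs ! j, vs ! Suc j} \<in> E" using labeling_edge[OF vs(1) lt] CE by blast
    moreover have "walk E (drop (Suc j) vs)" using walk_vs lt by (rule walk_drop)
    moreover have "last (drop (Suc j) vs) = vs ! (length vs - 1)"
      using lt last_conv_nth[of vs] by fastforce
    ultimately show ?thesis
      unfolding ws_def using walk_p pne lt j vs(2) p(5) by (simp add: walk_append)
  qed
  have "distinct ws" using disj p(2) vs3(2) by (simp add: ws_def)
  then have D: "closed_edges ws \<in> cycles E"
    using ws closing CE by (intro cyclesI) auto
  have wsne: "ws \<noteq> []" using pne by (simp add: ws_def)
  have "closed_edges ws \<subseteq> closed_edges ws" ..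
  then have ends: "{last ws, hd ws} \<in> closed_edges ws" "walk (closed_edges ws) ws"
    using closed_edges_subset_iff[OF wsne] by blast+
  \<comment> \<open>Both cycles contain the closing edge of \<open>vs\<close>, so they coincide; but
    the first edge of \<open>p\<close> is on the new cycle and not on \<open>C\<close>.\<close>
  have "closed_edges ws = C"
    using cycles_disjoint[OF D C ends(1)] ws closing by simp
  moreover have "{p ! 0, p ! 1} \<in> closed_edges ws"
  proof -
    have "ws ! 0 = p ! 0" "ws ! 1 = p ! 1" "Suc 0 < length ws"
      using p(5) pne by (simp_all add: ws_def nth_append)
    then show ?thesis using ends(2) by (metis walk_def One_nat_def)
  qed
  ultimately show False using first by simp
qed

section \<open>Distances in a cactus\<close>

abbreviation d :: "'a \<Rightarrow> 'a \<Rightarrow> nat" where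
  "d \<equiv> gdist E"

lemma d_attained: "u \<in> V \<Longrightarrow> v \<in> V \<Longrightarrow> (u, v) \<in> adj E ^^ d u v"
  by (rule gdist_attained[OF connected])

lemma d_triangle:
  assumes "u \<in> V" "v \<in> V" "w \<in> V" shows "d u w \<le> d u v + d v w"
proof (rule gdist_le)
  show "(u, w) \<in> adj E ^^ (d u v + d v w)"
    unfolding relpow_add by (rule relcompI[OF d_attained[OF assms(1,2)] d_attained[OF assms(2,3)]])
qed

lemma d_eq_0_iff: "u \<in> V \<Longrightarrow> v \<in> V \<Longrightarrow> d u v = 0 \<longleftrightarrow> u = v"
  using d_attained[of u v] by auto

lemma d_edge:
  assumes "{x, y} \<in> E" shows "d x y = 1"
proof -
  have "(x, y) \<in> adj E ^^ 1" using assms by (simp add: adj_def)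
  then have "d x y \<le> 1" by (rule gdist_le)
  moreover have "d x y \<noteq> 0" using d_eq_0_iff[of x y] edge_in_V[OF assms] edge_neq[OF assms] by auto
  ultimately show ?thesis by simp
qed

lemma d_edge_le:
  assumes "{x, y} \<in> E" "u \<in> V" shows "d u y \<le> d u x + 1"
  using d_triangle[of u x y] edge_in_V[OF assms(1)] d_edge[OF assms(1)] assms(2) by simp

lemma d_next:
  assumes "u \<in> V" "v \<in> V" "u \<noteq> v"
  obtains w where "{u, w} \<in> E" "d u v = d w v + 1"
proof -
  have "(u, v) \<in> adj E ^^ d u v" using assms(1,2) by (rule d_attained)
  moreover have "d u v \<noteq> 0" using d_eq_0_iff assms by simp
  ultimately obtain n where n: "d u v = Suc n" "(u, v) \<in> adj E ^^ Suc n"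
    by (metis not0_implies_Suc)
  then obtain w where w: "{u, w} \<in> E" "(w, v) \<in> adj E ^^ n"
    using relpow_Suc_D2[OF n(2)] by (auto simp: adj_def)
  have "d w v \<le> n" using w(2) by (rule gdist_le)
  moreover have "d u v \<le> d w v + 1"
    using d_triangle[of u w v] edge_in_V[OF w(1)] assms d_edge[OF w(1)] by simp
  ultimately show ?thesis using that w n by simp
qed

text \<open>A walk from outside \<open>A\<close> to \<open>w\<close> must enter \<open>A\<close> and
  can do so only at \<open>p\<close>; induction on its length splits it at the entry. The additivity
  of distances at cycles, bridges and threads rests on this.\<close>

lemma d_gate:
  assumes V: "u \<in> V" "w \<in> V" "p \<in> V" and uA: "u \<notin> A" and wA: "w \<in> A"
    and gate: "\<And>x y. {x, y} \<in> E \<Longrightarrow> x \<notin> A \<Longrightarrow> y \<in> A \<Longrightarrow> y = p"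
  shows "d u w = d u p + d p w"
proof -
  have *: "d u p + d p w \<le> n" if "(u, w) \<in> adj E ^^ n" "u \<in> V" "u \<notin> A" for n u
    using that
  proof (induction n arbitrary: u)
    case 0
    then show ?case using wA by auto
  next
    case (Suc n)
    then obtain y where y: "{u, y} \<in> E" "(y, w) \<in> adj E ^^ n"
      using relpow_Suc_D2[OF Suc.prems(1)] by (auto simp: adj_def)
    show ?case
    proof (cases "y \<in> A")
      case True
      then have "y = p" using gate y Suc.prems by blast
      then show ?thesis using y d_edge gdist_le[OF y(2)] by simp
    next
      case False
      then have "d y p + d p w \<le> n" using Suc.IH y edge_in_V by blast
      moreover have "d u p \<le> d y p + 1"
        using d_edge_le[of y u p] y(1) V(3) by (simp add: gdist_commute insert_commute)
      ultimately show ?thesis by simp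
    qed
  qed
  have "(u, w) \<in> adj E ^^ d u w" using V(1,2) by (rule d_attained)
  from *[OF this V(1) uA] d_triangle[of u p w] V show ?thesis by simp
qed

text \<open>A path from \<open>n\<close> back to \<open>m\<close> that avoids the edge would close
  up with it to a cycle.\<close>

lemma bridge_separates:
  assumes e: "{m, n} \<in> E" and nocyc: "\<And>C. C \<in> cycles E \<Longrightarrow> {m, n} \<notin> C"
  shows "m \<notin> component (E - {{m, n}}) n"
proof
  assume "m \<in> component (E - {{m, n}}) n"
  then obtain p where p: "walk (E - {{m, n}}) p" "distinct p" "hd p = n" "last p = m"
    by (rule component_distinct_walk)
  have ne: "p \<noteq> []" using p(1) by (simp add: walk_def)
  have mn: "m \<noteq> n" using edge_neq[OF e] .
  \<comment> \<open>One vertex would mean \<open>m = n\<close>, two would mean using the deleted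
    edge.\<close>
  have "3 \<le> length p"
  proof (rule ccontr)
    assume "\<not> 3 \<le> length p"
    then consider x where "p = [x]" | x y where "p = [x, y]"
      using ne by (cases p rule: remdups_adj.cases) (auto simp: Suc_le_eq)
    then show False using p mn by cases (auto simp: walk_def insert_commute)
  qed
  moreover have "walk E p" using p(1) by (rule walk_mono) auto
  ultimately have "closed_edges p \<in> cycles E" using p e by (intro cyclesI) simp_all
  moreover have "{m, n} \<in> closed_edges p"
    using closed_edges_subset_iff[OF ne, of "closed_edges p"] p by simp
  ultimately show False using nocyc by blast
qed

lemma cycle_connected:
  assumes "C \<in> cycles E" "u \<in> \<Union>C" "v \<in> \<Union>C"
  shows "v \<in> component C u"
proof -
  obtain vs where vs: "labeling C vs" "vs ! 0 = u" using labeling_from[OF assms(1,2)] .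
  have "vs ! i \<in> component C u" if "i < length vs" for i
    using that
  proof (induction i)
    case 0
    then show ?case using vs by simp
  next
    case (Suc i)
    then show ?case using component_step[of "vs ! i" C u "vs ! Suc i"] labeling_edge[OF vs(1)] by simp
  qed
  moreover have "v \<in> set vs" using assms(3) labeling_set[OF vs(1)] by simp
  ultimately show ?thesis by (metis in_set_conv_nth)
qed

section \<open>Components hanging at the vertices of a cycle\<close>

abbreviation T :: "'a set set \<Rightarrow> 'a \<Rightarrow> 'a set" where
  "T C u \<equiv> component (E - C) u"

lemma T_unique:
  assumes "C \<in> cycles E" "u \<in> \<Union>C" "v \<in> \<Union>C" "w \<in> T C u" "w \<in> T C v"
  shows "u = v"
  using component_cycle_vertex[OF assms(1,3,2)] component_trans component_sym assms by metis

lemma T_cover: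
  assumes C: "C \<in> cycles E" and w: "w \<in> V"
  obtains u where "u \<in> \<Union>C" "w \<in> T C u"
proof -
  obtain vs where vs: "labeling C vs" using C by (rule cyclesE)
  then have "0 < length vs" by (auto simp: labeling_def)
  then have v0: "vs ! 0 \<in> \<Union>C" using labeling_set[OF vs] by simp
  let ?A = "{w. \<exists>u\<in>\<Union>C. w \<in> T C u}"
  have "w \<in> component E (vs ! 0)" by (rule connected[OF cycle_in_V[OF C v0] w])
  then have "w \<in> ?A"
  proof (rule component_closed)
    show "vs ! 0 \<in> ?A" by (rule CollectI, rule bexI[OF _ v0]) simp
  next
    fix x y assume x: "x \<in> ?A" and e: "{x, y} \<in> E"
    show "y \<in> ?A"
    proof (cases "{x, y} \<in> C")
      case True
      then have "y \<in> \<Union>C" by blast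
      show ?thesis by (rule CollectI, rule bexI[OF _ \<open>y \<in> \<Union>C\<close>]) simp
    next
      case False
      then have xy: "{x, y} \<in> E - C" using e by simp
      obtain u where "u \<in> \<Union>C" "x \<in> T C u" using x by blast
      then show ?thesis using component_step[OF _ xy] by blast
    qed
  qed
  then obtain u where "u \<in> \<Union>C" "w \<in> T C u" by blast
  then show ?thesis by (rule that)
qed

text \<open>Edges outside \<open>C\<close> do not leave a component of \<open>E - C\<close>, and
  \<open>p\<close> is the only vertex of \<open>C\<close> in \<open>T C p\<close>; so
  \<open>p\<close> is a gate in the sense of \<open>d_gate\<close>.\<close>

lemma T_entry:
  assumes "C \<in> cycles E" "p \<in> \<Union>C" "{x, y} \<in> E" "x \<notin> T C p" "y \<in> T C p"
  shows "y = p" "{x, y} \<in> C"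
proof -
  show C: "{x, y} \<in> C"
  proof (rule ccontr)
    assume "{x, y} \<notin> C"
    then have "{y, x} \<in> E - C" using assms by (simp add: insert_commute)
    then show False using component_step assms by metis
  qed
  then show "y = p" using component_cycle_vertex[OF assms(1,2), of y] assms(5) by blast
qed

lemma T_in_V: "C \<in> cycles E \<Longrightarrow> p \<in> \<Union>C \<Longrightarrow> w \<in> T C p \<Longrightarrow> w \<in> V"
  using component_sub_V cycle_in_V by blast

lemma d_T_gate:
  assumes "C \<in> cycles E" "p \<in> \<Union>C" "s \<in> V" "s \<notin> T C p" "x \<in> T C p"
  shows "d s x = d s p + d p x"
proof (rule d_gate[where A = "T C p"])
  show "x \<in> V" "p \<in> V" using assms T_in_V cycle_in_V by blast+
  show "y = p" if "{x, y} \<in> E" "x \<notin> T C p" "y \<in> T C p" for x y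
    using T_entry(1)[OF assms(1,2) that] .
qed (use assms in auto)

lemma d_T_far:
  assumes "C \<in> cycles E" "p \<in> \<Union>C" "q \<in> \<Union>C" "p \<noteq> q" "s \<in> T C p" "x \<in> T C q"
  shows "d s x = d s p + d p q + d q x"
proof -
  have sq: "s \<notin> T C q" using T_unique assms by blast
  have "q \<notin> T C p" using component_cycle_vertex assms by blast
  then have "d q s = d q p + d p s" using d_T_gate assms T_in_V cycle_in_V by blast
  moreover have "d s x = d s q + d q x" using d_T_gate sq assms T_in_V by blast
  ultimately show ?thesis by (simp add: gdist_commute)
qed

lemma labeling_nth_cycle: "labeling C vs \<Longrightarrow> i < length vs \<Longrightarrow> vs ! i \<in> \<Union>C"
  using labeling_set by (metis nth_mem)

lemma labeling_nth_eq: "labeling C vs \<Longrightarrow> i < length vs \<Longrightarrow> j < length vs \<Longrightarrow> vs ! i = vs ! j \<longleftrightarrow> i = j"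
  by (simp add: labeling_def nth_eq_iff_index_eq)

lemma d_labeling_le:
  assumes C: "C \<in> cycles E" and vs: "labeling C vs" and ij: "i \<le> j" "j < length vs"
  shows "d (vs ! i) (vs ! j) \<le> j - i"
  using ij
proof (induction j)
  case (Suc j)
  show ?case
  proof (cases "i = Suc j")
    case False
    have e: "{vs ! j, vs ! Suc j} \<in> E" using labeling_edge[OF vs] Suc.prems C by (auto simp: cycles_def)
    have "vs ! i \<in> V" using labeling_nth_cycle[OF vs] cycle_in_V[OF C] Suc.prems by simp
    then show ?thesis using d_edge_le[OF e, of "vs ! i"] Suc False by simp
  qed simp
qed simp

text \<open>The lower bound is the Lipschitz property of the projection onto the cycle that collapses
  each component of \<open>E - C\<close> to its vertex on \<open>C\<close>.\<close>

lemma d_labeling: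
  assumes C: "C \<in> cycles E" and vs: "labeling C vs" and ij: "i < length vs" "j < length vs"
  shows "d (vs ! i) (vs ! j) = cdist (length vs) i j"
proof -
  let ?g = "length vs"
  have inV: "vs ! l \<in> V" if "l < ?g" for l
    using labeling_nth_cycle[OF vs that] cycle_in_V[OF C] by blast
  have g3: "3 \<le> ?g" using vs by (simp add: labeling_def)
  have CE: "C \<subseteq> E" using C by (simp add: cycles_def)
  \<comment> \<open>The way from index \<open>i\<close> down to 0, across the closing edge and down
    from the last index to \<open>j\<close> gives the second term of \<open>cdist\<close>.\<close>
  have ub: "d (vs ! i) (vs ! j) \<le> cdist ?g i j" if "i \<le> j" "j < ?g" for i j
  proof -
    have "d (vs ! i) (vs ! j) \<le> d (vs ! i) (vs ! 0) + d (vs ! 0) (vs ! j)"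
      using that by (intro d_triangle inV) auto
    also have "\<dots> \<le> d (vs ! i) (vs ! 0) + (d (vs ! 0) (vs ! (?g - 1)) + d (vs ! (?g - 1)) (vs ! j))"
      using that by (intro add_left_mono d_triangle inV) auto
    finally have "d (vs ! i) (vs ! j) \<le> d (vs ! 0) (vs ! i) + d (vs ! (?g - 1)) (vs ! 0) + d (vs ! j) (vs ! (?g - 1))"
      by (simp add: gdist_commute)
    moreover have "d (vs ! (?g - 1)) (vs ! 0) = 1"
      using d_edge labeling_closing_edge[OF vs] CE by blast
    moreover have "d (vs ! 0) (vs ! i) \<le> i - 0" "d (vs ! j) (vs ! (?g - 1)) \<le> ?g - 1 - j"
      using d_labeling_le[OF C vs, of 0 i] d_labeling_le[OF C vs, of j "?g - 1"] that by auto
    moreover have "d (vs ! i) (vs ! j) \<le> j - i" using that by (rule d_labeling_le[OF C vs])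
    ultimately show ?thesis using that by (simp add: cdist_def)
  qed
  have upper: "d (vs ! i) (vs ! j) \<le> cdist ?g i j"
    using ub[of i j] ub[of j i] ij by (cases "i \<le> j") (simp_all add: gdist_commute cdist_commute)
  \<comment> \<open>The projection: \<open>idx w\<close> is the index of the cycle vertex at which
    \<open>w\<close> hangs.\<close>
  define idx where "idx w = (THE l. l < ?g \<and> w \<in> T C (vs ! l))" for w
  have idx: "idx w = l" if "l < ?g" "w \<in> T C (vs ! l)" for l w
    unfolding idx_def
  proof (rule the_equality)
    fix k assume "k < ?g \<and> w \<in> T C (vs ! k)"
    then have "vs ! k = vs ! l"
      using T_unique[OF C labeling_nth_cycle[OF vs, of k] labeling_nth_cycle[OF vs, of l], of w] that by simp
    then show "k = l" using labeling_nth_eq[OF vs] that \<open>k < ?g \<and> w \<in> T C (vs ! k)\<close> by blast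
  qed (use that in simp)
  have idx_ex: "\<exists>l<?g. w \<in> T C (vs ! l)" if wV: "w \<in> V" for w
  proof -
    obtain u where "u \<in> set vs" "w \<in> T C u"
      using T_cover[OF C wV] labeling_set[OF vs] by metis
    then show ?thesis by (metis in_set_conv_nth)
  qed
  have lip: "cdist ?g i (idx y) \<le> cdist ?g i (idx x) + 1" if e: "{x, y} \<in> E" for x y
  proof (cases "{x, y} \<in> C")
    case True
    show ?thesis
    proof (cases rule: labeling_edgeE[OF vs True])
      case (1 l)
      then have "(x = vs ! l \<and> y = vs ! Suc l) \<or> (y = vs ! l \<and> x = vs ! Suc l)"
        by (auto simp: doubleton_eq_iff)
      moreover have "idx (vs ! l) = l" "idx (vs ! Suc l) = Suc l" using 1 idx by simp_all
      ultimately show ?thesis using 1 ij by (auto simp: cdist_def)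
    next
      case 2
      then have "(x = vs ! 0 \<and> y = vs ! (?g - 1)) \<or> (y = vs ! 0 \<and> x = vs ! (?g - 1))"
        by (auto simp: doubleton_eq_iff)
      moreover have "idx (vs ! 0) = 0" "idx (vs ! (?g - 1)) = ?g - 1" using g3 by (auto intro: idx)
      ultimately show ?thesis using g3 ij by (auto simp: cdist_def)
    qed
  next
    case False
    obtain l where l: "l < ?g" "x \<in> T C (vs ! l)" using idx_ex edge_in_V[OF e] by blast
    then have "y \<in> T C (vs ! l)" using component_step e False by (metis DiffI)
    then show ?thesis using idx l by simp
  qed
  have "cdist ?g i (idx (vs ! j)) \<le> cdist ?g i (idx (vs ! i)) + d (vs ! i) (vs ! j)"
    by (rule gdist_lipschitz[OF lip]) (use inV ij connected in auto)
  then have "cdist ?g i j \<le> d (vs ! i) (vs ! j)" using idx ij by (simp add: cdist_def)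
  then show ?thesis using upper by simp
qed

section \<open>Distances across a bridge\<close>

lemma bridge_entry:
  assumes "{m, n} \<in> E" "\<And>C. C \<in> cycles E \<Longrightarrow> {m, n} \<notin> C"
    and "{x, y} \<in> E" "x \<notin> component (E - {{m, n}}) n" "y \<in> component (E - {{m, n}}) n"
  shows "x = m" "y = n"
proof -
  have "{x, y} = {m, n}"
  proof (rule ccontr)
    assume "{x, y} \<noteq> {m, n}"
    then have "{y, x} \<in> E - {{m, n}}" using assms(3) by (simp add: insert_commute)
    then show False using component_step assms(4,5) by metis
  qed
  then show "x = m" "y = n" using assms(4,5) bridge_separates[OF assms(1,2)]
    by (auto simp: doubleton_eq_iff)
qed

lemma bridge_cover:
  assumes e: "{m, n} \<in> E" and w: "w \<in> V"
  shows "w \<in> component (E - {{m, n}}) n \<or> w \<in> component (E - {{m, n}}) m"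
proof -
  let ?F = "E - {{m, n}}"
  let ?A = "component ?F n \<union> component ?F m"
  have "w \<in> component E n" using connected edge_in_V[OF e] w by simp
  then have "w \<in> ?A"
  proof (rule component_closed)
    fix x y assume x: "x \<in> ?A" and e: "{x, y} \<in> E"
    show "y \<in> ?A"
    proof (cases "{x, y} = {m, n}")
      case True
      then show ?thesis by (auto simp: doubleton_eq_iff)
    next
      case False
      then have "{x, y} \<in> ?F" using e by simp
      then show ?thesis using x component_step by fast
    qed
  qed simp
  then show ?thesis by simp
qed

text \<open>Walks enter the far side only at \<open>n\<close> and leave it only to \<open>m\<close>,
  so \<open>d_gate\<close> applies both to the side and to its complement.\<close>

lemma d_bridge:
  assumes e: "{m, n} \<in> E" "\<And>C. C \<in> cycles E \<Longrightarrow> {m, n} \<notin> C"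
    and u: "u \<in> V" "u \<notin> component (E - {{m, n}}) n" and w: "w \<in> component (E - {{m, n}}) n"
  shows "d u w = d u m + 1 + d n w"
proof -
  let ?B = "component (E - {{m, n}}) n"
  have V: "m \<in> V" "n \<in> V" "w \<in> V" using e edge_in_V component_sub_V[OF w] by auto
  have "d u w = d u n + d n w"
    using bridge_entry(2)[OF e] u w V by (intro d_gate[where A = ?B]) auto
  moreover have "d n u = d n m + d m u"
  proof (rule d_gate[where A = "- ?B"])
    fix x y assume "{x, y} \<in> E" "x \<notin> - ?B" "y \<in> - ?B"
    then show "y = m" using bridge_entry(1)[OF e, of y x] by (simp add: insert_commute)
  qed (use u V in auto)
  ultimately show ?thesis using d_edge[OF e(1)] by (simp add: gdist_commute)
qed

section \<open>Parts without landmarks\<close>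

definition nbrs :: "'a \<Rightarrow> 'a set" where
  "nbrs v = {w. {v, w} \<in> E}"

lemma nbrs_iff [simp]: "w \<in> nbrs v \<longleftrightarrow> {v, w} \<in> E"
  by (simp add: nbrs_def)

lemma finite_nbrs [simp]: "finite (nbrs v)"
  by (rule finite_subset[OF _ finite_V]) (use edge_in_V in auto)

lemma degree_nbrs: "degree E v = card (nbrs v)"
proof -
  have "{e \<in> E. v \<in> e} = (\<lambda>w. {v, w}) ` nbrs v"
  proof (intro equalityI subsetI)
    fix e assume "e \<in> {e \<in> E. v \<in> e}"
    then have e: "e \<in> E" "v \<in> e" by simp_all
    obtain x y where xy: "e = {x, y}" using edgeE[OF e(1)] by metis
    then have "e = {v, x} \<or> e = {v, y}" using e(2) by auto
    then show "e \<in> (\<lambda>w. {v, w}) ` nbrs v" using e(1) by auto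
  qed auto
  moreover have "inj_on (\<lambda>w. {v, w}) (nbrs v)"
    by (auto simp: inj_on_def doubleton_eq_iff)
  ultimately show ?thesis by (simp add: degree_def card_image)
qed

lemma cycle_two_nbrs:
  assumes "C \<in> cycles E" "u \<in> \<Union>C"
  obtains x y where "x \<noteq> y" "{u, x} \<in> C" "{u, y} \<in> C"
proof -
  obtain vs where vs: "labeling C vs" "vs ! 0 = u" using labeling_from[OF assms] .
  have n: "3 \<le> length vs" using vs by (simp add: labeling_def)
  have "{u, vs ! 1} \<in> C" using labeling_edge[OF vs(1), of 0] vs n by simp
  moreover have "{u, vs ! (length vs - 1)} \<in> C"
    using labeling_closing_edge[OF vs(1)] vs by (simp add: insert_commute)
  moreover have "vs ! 1 \<noteq> vs ! (length vs - 1)"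
    using labeling_nth_eq[OF vs(1), of 1 "length vs - 1"] n by simp
  ultimately show ?thesis using that by blast
qed

text \<open>A thread without the degree condition at \<open>v\<close>: the inductive construction of
  threads and the case of a path graph attach such paths at vertices of degree 2. For threads the
  last condition follows from the degrees.\<close>

definition pendant_path :: "'a \<Rightarrow> 'a list \<Rightarrow> bool" where
  "pendant_path v us \<longleftrightarrow> walk E us \<and> distinct us \<and> degree E (hd us) = 1 \<and>
     (\<forall>u\<in>set (tl us). degree E u = 2) \<and> {last us, v} \<in> E \<and> v \<notin> set us"

lemma thread_pendant_path: "thread E v us \<longleftrightarrow> 3 \<le> degree E v \<and> pendant_path v us"
proof -
  have "v \<notin> set us" if "thread E v us"
  proof
    assume "v \<in> set us"
    then have "v = hd us \<or> v \<in> set (tl us)" by (cases us) auto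
    then show False using that by (auto simp: thread_def)
  qed
  then show ?thesis by (auto simp: thread_def pendant_path_def)
qed

text \<open>The degrees along the path are used up by predecessor and successor, where
  \<open>v\<close> counts as the successor of the last vertex.\<close>

lemma pendant_path_nbrs:
  assumes us: "pendant_path v us" and i: "i < length us" and w: "{us ! i, w} \<in> E"
  shows "w = (if Suc i = length us then v else us ! Suc i) \<or> (0 < i \<and> w = us ! (i - 1))"
proof -
  define nxt where "nxt = (if Suc i = length us then v else us ! Suc i)"
  have walk: "\<And>i. Suc i < length us \<Longrightarrow> {us ! i, us ! Suc i} \<in> E" and dist: "distinct us"
    using us by (auto simp: pendant_path_def walk_def)
  have ne: "us \<noteq> []" using i by auto
  have nxt: "nxt \<in> nbrs (us ! i)"
  proof (cases "Suc i = length us")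
    case True
    then have "us ! i = last us" using ne by (metis last_conv_nth diff_Suc_1)
    then show ?thesis using True us by (simp add: nxt_def pendant_path_def)
  qed (use walk i in \<open>simp add: nxt_def\<close>)
  show ?thesis
  proof (cases i)
    case 0
    then have "card (nbrs (us ! i)) = 1"
      using us ne by (simp add: pendant_path_def hd_conv_nth flip: degree_nbrs)
    then have "nbrs (us ! i) = {nxt}" using nxt by (auto simp: card_1_singleton_iff simp del: nbrs_iff)
    then show ?thesis using w nxt_def nbrs_iff by blast
  next
    case (Suc j)
    have "us ! i \<in> set (tl us)" using Suc i by (metis length_tl nth_tl nth_mem less_diff_conv Suc_eq_plus1)
    then have c: "card (nbrs (us ! i)) = 2"
      using us by (simp add: pendant_path_def flip: degree_nbrs)
    have prev: "us ! j \<in> nbrs (us ! i)" using walk[of j] Suc i by (simp add: insert_commute)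
    have "nxt \<noteq> us ! j"
    proof (cases "Suc i = length us")
      case True
      have "us ! j \<in> set us" using Suc i by simp
      then show ?thesis using True us by (auto simp: nxt_def pendant_path_def)
    next
      case False
      then have "Suc i < length us" using i by simp
      then show ?thesis using False dist Suc i by (simp add: nxt_def nth_eq_iff_index_eq)
    qed
    then have "nbrs (us ! i) = {nxt, us ! j}"
      using nxt prev c by (intro card_subset_eq[symmetric]) auto
    then show ?thesis using w nxt_def Suc nbrs_iff by (metis diff_Suc_1 insertE singletonD zero_less_Suc)
  qed
qed

lemma pendant_path_in_V:
  assumes "pendant_path v us" shows "v \<in> V" "set us \<subseteq> V"
proof -
  show "v \<in> V" using assms edge_in_V by (auto simp: pendant_path_def)
  have ne: "us \<noteq> []" using assms by (auto simp: pendant_path_def walk_def)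
  show "set us \<subseteq> V"
  proof
    fix u assume "u \<in> set us"
    then obtain i where i: "i < length us" "us ! i = u" by (auto simp: in_set_conv_nth)
    show "u \<in> V"
    proof (cases "Suc i = length us")
      case True
      then have "u = last us" using ne i by (metis last_conv_nth diff_Suc_1)
      then show ?thesis using assms edge_in_V by (auto simp: pendant_path_def)
    next
      case False
      then have "{us ! i, us ! Suc i} \<in> E"
        using assms i(1) unfolding pendant_path_def walk_def by (metis Suc_lessI)
      then show ?thesis using edge_in_V i by blast
    qed
  qed
qed

text \<open>The segment from the leaf up to index \<open>i\<close> can be left only to the successor
  of \<open>us ! i\<close>, which is therefore a gate of the complement. The induction runs from
  \<open>v\<close> towards the leaf.\<close>

lemma d_pendant_path:
  assumes us: "pendant_path v us" and i: "i < length us" and s: "s \<in> V" "s \<notin> set us"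
  shows "d s (us ! i) = d s v + (length us - i)"
  using i
proof (induction "length us - i" arbitrary: i)
  case (Suc k)
  define nxt where "nxt = (if Suc i = length us then v else us ! Suc i)"
  let ?A = "(!) us ` {..i}"
  have distinct: "distinct us" and v: "v \<notin> set us" using us by (auto simp: pendant_path_def)
  have sub: "?A \<subseteq> set us" using Suc.prems by auto
  have nxtA: "nxt \<notin> ?A"
    using v sub distinct Suc.prems by (auto simp: nxt_def nth_eq_iff_index_eq)
  have edge: "y = nxt" if xy: "{x, y} \<in> E" "x \<in> ?A" "y \<notin> ?A" for x y
  proof -
    obtain j where j: "j \<le> i" "x = us ! j" using xy(2) by auto
    have jl: "j < length us" using j Suc.prems by simp
    have "y = (if Suc j = length us then v else us ! Suc j) \<or> (0 < j \<and> y = us ! (j - 1))"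
      using pendant_path_nbrs[OF us jl] that j by simp
    moreover have "\<not> (0 < j \<and> y = us ! (j - 1))"
      using xy(3) j by auto
    moreover have "j = i"
    proof (rule ccontr)
      assume "j \<noteq> i"
      then have "y \<in> ?A" using calculation j Suc.prems by auto
      then show False using xy by simp
    qed
    ultimately show ?thesis by (auto simp: nxt_def)
  qed
  have inV: "us ! i \<in> V" "nxt \<in> V"
    using pendant_path_in_V[OF us] Suc.prems by (auto simp: nxt_def)
  have "us ! i \<in> ?A" by simp
  then have "d (us ! i) s = d (us ! i) nxt + d nxt s"
    using sub s by (intro d_gate[where A = "- ?A"] inV) (auto intro: edge)
  moreover have "{us ! i, nxt} \<in> E"
  proof (cases "Suc i = length us")
    case True
    then have "us ! i = last us" using Suc.prems by (metis last_conv_nth diff_Suc_1 list.size(3) not_less_zero)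
    then show ?thesis using True us by (simp add: nxt_def pendant_path_def)
  next
    case False
    then show ?thesis using us Suc.prems by (simp add: nxt_def pendant_path_def walk_def)
  qed
  moreover from this have "d (us ! i) nxt = 1" by (rule d_edge)
  ultimately have "d s (us ! i) = d s nxt + 1" by (simp add: gdist_commute)
  moreover have "d s nxt = d s v + (length us - Suc i)"
    using Suc by (auto simp: nxt_def)
  ultimately show ?case using Suc.prems by simp
qed simp

text \<open>A cycle through \<open>us ! i\<close> uses two neighbours of it, hence also the
  predecessor; descending in this way it would reach the leaf, which has only one neighbour.\<close>

lemma pendant_path_off_cycle:
  assumes us: "pendant_path v us" and C: "C \<in> cycles E" and i: "i < length us"
  shows "us ! i \<notin> \<Union>C"
  using i
proof (induction i)
  have CE: "C \<subseteq> E" using C by (simp add: cycles_def)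
  {
    case 0
    show ?case
    proof
      assume "us ! 0 \<in> \<Union>C"
      then obtain x y where "x \<noteq> y" "{us ! 0, x} \<in> C" "{us ! 0, y} \<in> C"
        using cycle_two_nbrs[OF C] by metis
      then show False
        using pendant_path_nbrs[OF us 0, of x] pendant_path_nbrs[OF us 0, of y] CE by auto
    qed
  next
    case (Suc i)
    show ?case
    proof
      assume "us ! Suc i \<in> \<Union>C"
      then obtain x y where xy: "x \<noteq> y" "{us ! Suc i, x} \<in> C" "{us ! Suc i, y} \<in> C"
        using cycle_two_nbrs[OF C] by metis
      then have "x = us ! i \<or> y = us ! i"
        using pendant_path_nbrs[OF us Suc.prems, of x] pendant_path_nbrs[OF us Suc.prems, of y] CE
        by fastforce
      then have "us ! i \<in> \<Union>C" using xy by auto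
      then show False using Suc by simp
    qed
  }
qed

lemma degree_cycle_bridge:
  assumes C: "C \<in> cycles E" and p: "p \<in> \<Union>C" and n: "{p, n} \<in> E" "{p, n} \<notin> C"
  shows "3 \<le> degree E p"
proof -
  obtain x y where xy: "x \<noteq> y" "{p, x} \<in> C" "{p, y} \<in> C" using cycle_two_nbrs[OF C p] .
  have "card {n, x, y} \<le> card (nbrs p)"
    using n xy C by (intro card_mono) (auto simp: cycles_def)
  moreover have "n \<noteq> x" "n \<noteq> y" using n xy by auto
  ultimately show ?thesis using xy by (simp add: degree_nbrs)
qed

text \<open>\<open>D\<close> is connected without edges of \<open>C\<close>, so \<open>v\<close>
  lies in \<open>T C p\<close>. A walk in \<open>T D v\<close> that met an edge of \<open>C\<close>
  could run along \<open>C\<close> to \<open>p\<close> without using \<open>D\<close>, although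
  \<open>p\<close> and \<open>v\<close> are different vertices of \<open>D\<close>.\<close>

lemma crossing_component:
  assumes C: "C \<in> cycles E" and D: "D \<in> cycles E" "C \<noteq> D"
    and p: "p \<in> \<Union>C" "p \<in> \<Union>D" and v: "v \<in> \<Union>D" "v \<noteq> p"
  shows "T D v \<subseteq> T C p"
proof
  fix w assume w: "w \<in> T D v"
  have CE: "C \<subseteq> E - D" "D \<subseteq> E - C" using cycles_disjoint C D by (auto simp: cycles_def)
  have vp: "v \<in> T C p"
    using component_mono[OF cycle_connected[OF D(1) p(2) v(1)] CE(2)] .
  have "w \<in> component (E - D - C) v"
  proof (rule component_restrict[OF w])
    fix x y assume x: "x \<in> component (E - D - C) v" and e: "{x, y} \<in> E - D"
    have xv: "x \<in> T D v" using x by (rule component_mono) auto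
    have "{x, y} \<notin> C"
    proof
      assume "{x, y} \<in> C"
      then have "p \<in> T D x" using component_mono[OF cycle_connected[OF C _ p(1)] CE(1)] by blast
      then have "p \<in> T D v" using component_trans xv by metis
      then show False using component_cycle_vertex[OF D(1) v(1) p(2)] v(2) by simp
    qed
    then show "{x, y} \<in> E - D - C" using e by simp
  qed
  then have "w \<in> T C v" by (rule component_mono) auto
  then show "w \<in> T C p" using component_trans vp by metis
qed

end

section \<open>Landmark-free parts under biactivity and branch resolution\<close>

locale cactus_landmarks = cactus_graph +
  fixes S :: "'a set"
  assumes S_sub: "S \<subseteq> V" and biactive: "biactive E S" and branch_resolving: "branch_resolving V E S"
begin

lemma two_active:
  assumes "C \<in> cycles E"
  obtains u v where "u \<noteq> v" "active E S C u" "active E S C v"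
proof -
  let ?A = "{v \<in> \<Union>C. active E S C v}"
  have c: "2 \<le> card ?A" using biactive assms by (auto simp: biactive_def num_active_def)
  then have "finite ?A" by (metis card.infinite not_numeral_le_zero)
  then have "\<not> (\<forall>a\<in>?A. \<forall>b\<in>?A. a = b)" using c card_le_Suc0_iff_eq[of ?A] by auto
  then show ?thesis using that by blast
qed

lemma free_thread_unique:
  "free_thread E S v us \<Longrightarrow> free_thread E S v us' \<Longrightarrow> us = us'"
  using branch_resolving pendant_path_in_V(1)
  unfolding branch_resolving_def free_thread_def thread_pendant_path by blast

text \<open>If \<open>D\<close> lay on the landmark-free side, all landmarks would be beyond the
  bridge and would reach \<open>m\<close> without using \<open>D\<close>. They would all hang at the
  same vertex of \<open>D\<close>, against biactivity.\<close>

lemma bridge_side_no_cycle: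
  assumes e: "{m, n} \<in> E" "\<And>C. C \<in> cycles E \<Longrightarrow> {m, n} \<notin> C"
    and free: "component (E - {{m, n}}) n \<inter> S = {}" and D: "D \<in> cycles E" "v \<in> \<Union>D"
  shows "v \<notin> component (E - {{m, n}}) n"
proof
  let ?F = "E - {{m, n}}"
  assume v: "v \<in> component ?F n"
  have DF: "D \<subseteq> ?F" using D e(2)[OF D(1)] by (auto simp: cycles_def)
  have inA: "w \<in> component ?F n" if "w \<in> \<Union>D" for w
    using component_trans[OF v component_mono[OF cycle_connected[OF D that] DF]] .
  have mT: "m \<in> T D u" if "active E S D u" for u
  proof -
    obtain s where s: "s \<in> T D u" "s \<in> S" using \<open>active E S D u\<close> by (auto simp: active_def)
    have "s \<in> component ?F m" using bridge_cover[OF e(1)] s(2) S_sub free by blast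
    then have "s \<in> component (?F - D) m"
    proof (rule component_restrict)
      fix x y assume x: "x \<in> component (?F - D) m" and xy: "{x, y} \<in> ?F"
      have "{x, y} \<notin> D"
      proof
        assume "{x, y} \<in> D"
        then have "x \<in> component ?F n" using inA by blast
        moreover have "m \<in> component ?F x"
          using component_sym[OF component_mono[OF x]] by blast
        ultimately have "m \<in> component ?F n" by (rule component_trans)
        then show False using bridge_separates[OF e] by simp
      qed
      then show "{x, y} \<in> ?F - D" using xy by simp
    qed
    then have "s \<in> T D m" by (rule component_mono) auto
    then show ?thesis using component_trans[OF s(1) component_sym] by simp
  qed
  obtain v1 v2 where "v1 \<noteq> v2" "active E S D v1" "active E S D v2" using two_active[OF D(1)] .
  then show False using T_unique[OF D(1), of v1 v2 m] mT by (auto simp: active_def)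
qed

text \<open>Induction on the size of the side. By \<open>bridge_side_no_cycle\<close> every further
  edge at \<open>n\<close> is again a bridge, with a smaller landmark-free side. Two such edges
  would give two \<open>S\<close>-free threads at \<open>n\<close>, which then has degree at least
  3, against branch resolution.\<close>

lemma bridge_side_pendant_path:
  assumes "{m, n} \<in> E" "\<And>C. C \<in> cycles E \<Longrightarrow> {m, n} \<notin> C"
    and "component (E - {{m, n}}) n \<inter> S = {}"
  obtains us where "pendant_path m us" "last us = n" "set us = component (E - {{m, n}}) n"
proof -
  have "\<exists>us. pendant_path m us \<and> last us = n \<and> set us = component (E - {{m, n}}) n"
    using assms
  proof (induction "card (component (E - {{m, n}}) n)" arbitrary: m n rule: less_induct)
    case less
    let ?A = "component (E - {{m, n}}) n"
    note e = less.prems(1,2)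
    have mA: "m \<notin> ?A" using bridge_separates[OF e] .
    have finA: "finite ?A"
      using component_sub_V[where F = "E - {{m, n}}" and u = n] edge_in_V[OF e(1)]
      by (intro finite_subset[OF _ finite_V]) auto
    have mN: "m \<in> nbrs n" using e(1) by (simp add: insert_commute)
    have branch: "(\<forall>C\<in>cycles E. {n, n'} \<notin> C) \<and> n \<notin> component (E - {{n, n'}}) n' \<and>
        component (E - {{n, n'}}) n' \<subseteq> ?A \<and>
        (\<exists>us. pendant_path n us \<and> last us = n' \<and> set us = component (E - {{n, n'}}) n')"
      if n': "n' \<in> nbrs n - {m}" for n'
    proof -
      let ?B = "component (E - {{n, n'}}) n'"
      have e': "{n, n'} \<in> E" "{n, n'} \<noteq> {m, n}" using n' by (auto simp: doubleton_eq_iff)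
      have nocyc: "{n, n'} \<notin> C" if "C \<in> cycles E" for C
        using bridge_side_no_cycle[OF less.prems that, of n] by auto
      have nB: "n \<notin> ?B" using bridge_separates[OF e'(1) nocyc] by simp
      \<comment> \<open>A walk inside \<open>?B\<close> avoids \<open>n\<close>, hence also the edge
        \<open>{m, n}\<close>.\<close>
      have "?B \<subseteq> ?A"
      proof
        fix w assume "w \<in> ?B"
        then have "w \<in> component (E - {{m, n}} - {{n, n'}}) n'"
        proof (rule component_restrict)
          fix x y assume x: "x \<in> component (E - {{m, n}} - {{n, n'}}) n'" and xy: "{x, y} \<in> E - {{n, n'}}"
          have xB: "x \<in> ?B" using x by (rule component_mono) auto
          then have "y \<in> ?B" using component_step xy by metis
          then show "{x, y} \<in> E - {{m, n}} - {{n, n'}}"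
            using xB nB xy by (auto simp: doubleton_eq_iff)
        qed
        then have "w \<in> component (E - {{m, n}}) n'" by (rule component_mono) auto
        moreover have "n' \<in> ?A" using component_step[of n _ n n'] e' by simp
        ultimately show "w \<in> ?A" using component_trans by metis
      qed
      moreover have "card ?B < card ?A"
        using \<open>?B \<subseteq> ?A\<close> nB finA by (intro psubset_card_mono) auto
      ultimately show ?thesis
        using less.hyps[of n n'] e'(1) nocyc nB less.prems(3) by blast
    qed
    consider "nbrs n - {m} = {}" | n' where "nbrs n - {m} = {n'}"
      | n1 n2 where "n1 \<noteq> n2" "n1 \<in> nbrs n - {m}" "n2 \<in> nbrs n - {m}"
      by blast
    then show ?case
    proof cases
      case 1
      then have N: "nbrs n = {m}" using mN by blast
      have "?A \<subseteq> {n}"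
      proof
        fix w assume "w \<in> ?A"
        then show "w \<in> {n}"
        proof (rule component_closed)
          fix x y assume "x \<in> {n}" "{x, y} \<in> E - {{m, n}}"
          then have "y \<in> nbrs n" "{n, y} \<noteq> {m, n}" by simp_all
          then show "y \<in> {n}" using N by auto
        qed simp
      qed
      then have "set [n] = ?A" by auto
      moreover have "pendant_path m [n]"
        using N e edge_neq[OF e(1)] by (simp add: pendant_path_def degree_nbrs insert_commute)
      ultimately show ?thesis by (intro exI[of _ "[n]"]) simp
    next
      case 2
      then have n': "n' \<in> nbrs n - {m}" by blast
      let ?B = "component (E - {{n, n'}}) n'"
      obtain us where us: "pendant_path n us" "last us = n'" "set us = ?B"
        using branch[OF n'] by blast
      have N: "nbrs n = {m, n'}" using 2 mN by blast
      have ne: "us \<noteq> []" using us by (auto simp: pendant_path_def walk_def)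
      have "?A \<subseteq> insert n ?B"
      proof
        fix w assume "w \<in> ?A"
        then show "w \<in> insert n ?B"
        proof (rule component_closed)
          fix x y assume x: "x \<in> insert n ?B" and xy: "{x, y} \<in> E - {{m, n}}"
          show "y \<in> insert n ?B"
          proof (cases "x = n")
            case True
            then have "y \<in> nbrs n" "y \<noteq> m" using xy by (auto simp: insert_commute)
            then show ?thesis using N by auto
          next
            case False
            then have "x \<in> ?B" using x by simp
            then show ?thesis using xy component_step[of x "E - {{n, n'}}" n' y]
              by (cases "{x, y} = {n, n'}") (auto simp: doubleton_eq_iff)
          qed
        qed simp
      qed
      moreover have "insert n ?B \<subseteq> ?A" using branch[OF n'] by auto
      ultimately have "set (us @ [n]) = ?A" using us by auto
      moreover have "pendant_path m (us @ [n])"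
        using us e ne N n' mA calculation edge_neq[OF e(1)] branch[OF n']
        by (auto simp: pendant_path_def walk_append degree_nbrs insert_commute)
      ultimately show ?thesis by (intro exI[of _ "us @ [n]"]) simp
    next
      case 3
      have deg: "3 \<le> degree E n"
      proof -
        have "{m, n1, n2} \<subseteq> nbrs n" using mN 3 by auto
        then have "card {m, n1, n2} \<le> card (nbrs n)" by (intro card_mono) auto
        moreover have "card {m, n1, n2} = 3" using 3 by (auto simp: card_insert_if)
        ultimately show ?thesis by (simp add: degree_nbrs)
      qed
      have free: "\<exists>us. free_thread E S n us \<and> last us = n'" if n': "n' \<in> nbrs n - {m}" for n'
      proof -
        obtain us where "pendant_path n us" "last us = n'" "set us \<subseteq> ?A"
          using branch[OF n'] by auto
        then show ?thesis
          using deg less.prems(3) unfolding free_thread_def thread_pendant_path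
          by (intro exI[of _ us]) auto
      qed
      then show ?thesis using 3 free_thread_unique by metis
    qed
  qed
  then show ?thesis using that by blast
qed

text \<open>Every edge at \<open>p\<close> off \<open>C\<close> is a bridge, since another cycle
  through \<open>p\<close> would bring landmarks into \<open>T C p\<close> by
  \<open>crossing_component\<close>. So each such edge starts an \<open>S\<close>-free thread, and
  branch resolution allows only one.\<close>

lemma inactive_component:
  assumes C: "C \<in> cycles E" and p: "p \<in> \<Union>C" and free: "T C p \<inter> S = {}"
  shows "T C p = {p} \<or> (\<exists>us. free_thread E S p us \<and> T C p = insert p (set us))"
proof -
  have CE: "C \<subseteq> E" using C by (simp add: cycles_def)
  have branch: "\<exists>us. free_thread E S p us \<and> last us = n \<and> set us \<subseteq> T C p" if n: "{p, n} \<in> E - C" for n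
  proof -
    have nocyc: "{p, n} \<notin> D" if D: "D \<in> cycles E" for D
    proof
      assume pn: "{p, n} \<in> D"
      then have CD: "C \<noteq> D" using n by auto
      have pD: "p \<in> \<Union>D" using pn by blast
      obtain v1 v2 where "v1 \<noteq> v2" "active E S D v1" "active E S D v2" using two_active[OF D] .
      then obtain v where v: "v \<noteq> p" "active E S D v" by metis
      then show False
        using crossing_component[OF C D CD p pD _ v(1)] free by (auto simp: active_def)
    qed
    have pn: "{p, n} \<in> E" using n by simp
    let ?A = "component (E - {{p, n}}) n"
    have CF: "C \<subseteq> E - {{p, n}}" using n CE by auto
    have pA: "p \<notin> ?A" using bridge_separates[OF pn nocyc] by simp
    have sub: "?A \<subseteq> T C p"
    proof
      fix w assume "w \<in> ?A"
      then have "w \<in> component (E - {{p, n}} - C) n"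
      proof (rule component_restrict)
        fix x y assume x: "x \<in> component (E - {{p, n}} - C) n" and xy: "{x, y} \<in> E - {{p, n}}"
        have "{x, y} \<notin> C"
        proof
          assume "{x, y} \<in> C"
          then have "x \<in> \<Union>C" by blast
          then have "p \<in> component (E - {{p, n}}) x"
            using component_mono[OF cycle_connected[OF C _ p] CF] by blast
          moreover have "x \<in> ?A" using x by (rule component_mono) auto
          ultimately show False using component_trans pA by metis
        qed
        then show "{x, y} \<in> E - {{p, n}} - C" using xy by simp
      qed
      then have "w \<in> T C n" by (rule component_mono) auto
      moreover have "n \<in> T C p" using component_step[of p _ p n] n by simp
      ultimately show "w \<in> T C p" using component_trans by metis
    qed
    then have "?A \<inter> S = {}" using free by blast
    then obtain us where us: "pendant_path p us" "last us = n" "set us = ?A"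
      using bridge_side_pendant_path[OF pn nocyc] by metis
    have "3 \<le> degree E p" using degree_cycle_bridge[OF C p pn] n by simp
    then show ?thesis
      using us sub \<open>?A \<inter> S = {}\<close> unfolding free_thread_def thread_pendant_path by metis
  qed
  show ?thesis
  proof (cases "\<exists>n. {p, n} \<in> E - C")
    case False
    have "T C p \<subseteq> {p}"
    proof
      fix w assume "w \<in> T C p"
      then show "w \<in> {p}" by (rule component_closed) (use False in auto)
    qed
    then show ?thesis by auto
  next
    case True
    then obtain n us where n: "{p, n} \<in> E - C" and us: "free_thread E S p us" "last us = n" "set us \<subseteq> T C p"
      using branch by metis
    have pp: "pendant_path p us" using us(1) by (simp add: free_thread_def thread_pendant_path)
    then have ne: "us \<noteq> []" by (auto simp: pendant_path_def walk_def)
    have "T C p \<subseteq> insert p (set us)"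
    proof
      fix w assume "w \<in> T C p"
      then show "w \<in> insert p (set us)"
      proof (rule component_closed)
        fix x y assume x: "x \<in> insert p (set us)" and xy: "{x, y} \<in> E - C"
        show "y \<in> insert p (set us)"
        proof (cases "x = p")
          case True
          then obtain us' where "free_thread E S p us'" "last us' = y" using branch[of y] xy by blast
          then have "last us = y" using free_thread_unique us(1) by blast
          then show ?thesis using ne last_in_set by blast
        next
          case False
          then obtain i where i: "i < length us" "x = us ! i" using x by (auto simp: in_set_conv_nth)
          then show ?thesis using pendant_path_nbrs[OF pp i(1), of y] xy by (auto split: if_splits)
        qed
      qed simp
    qed
    then show ?thesis using us by auto
  qed
qed

section \<open>Canonical labelings and critical vertices\<close>

text \<open>\<open>half \<epsilon> g\<close> is the floor of \<open>g/2\<close> for \<open>\<epsilon> = 1\<close>, the vertex case, and the ceiling for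
  \<open>\<epsilon> = 0\<close>, the edge case.\<close>

definition half :: "nat \<Rightarrow> nat \<Rightarrow> nat" where
  "half \<epsilon> g = (g + 1 - \<epsilon>) div 2"

text \<open>For \<epsilon> = 1 and a landmark \<open>s\<close>, the vertex \<open>n\<close> has
  distance \<open>d s m + 1\<close>; for \<epsilon> = 0 the edge \<open>{m, n}\<close> has distance
  \<open>d s m\<close>. Either value depends on \<open>m\<close> alone, which is why two such
  neighbours go undistinguished.\<close>

definition outward :: "nat \<Rightarrow> 'a \<Rightarrow> 'a \<Rightarrow> bool" where
  "outward \<epsilon> m n \<longleftrightarrow> {m, n} \<in> E \<and> (\<forall>s\<in>S. d s m + \<epsilon> \<le> d s n)"

lemma labeling_ne: "labeling C vs \<Longrightarrow> vs \<noteq> []"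
  by (auto simp: labeling_def)

lemma d_to_cycle:
  assumes "C \<in> cycles E" "u \<in> \<Union>C" "v \<in> \<Union>C" "s \<in> T C u"
  shows "d s v = d s u + d u v"
  using d_T_far[OF assms(1-3) _ assms(4), of v] by (cases "u = v") simp_all

lemma active_cover:
  assumes "C \<in> cycles E" "s \<in> S"
  obtains u where "active E S C u" "u \<in> \<Union>C" "s \<in> T C u"
  using T_cover[OF assms(1), of s] assms S_sub unfolding active_def by blast

text \<open>A landmark reaches \<open>m\<close> and \<open>n\<close> through the active vertex
  \<open>u\<close> at which it hangs, so \<open>d s u\<close> cancels.\<close>

lemma outward_cycle:
  assumes C: "C \<in> cycles E" and mn: "{m, n} \<in> C"
  shows "outward \<epsilon> m n \<longleftrightarrow> (\<forall>u. active E S C u \<longrightarrow> d u m + \<epsilon> \<le> d u n)"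
proof -
  have V: "m \<in> \<Union>C" "n \<in> \<Union>C" and mnE: "{m, n} \<in> E" using mn C by (auto simp: cycles_def)
  show ?thesis
  proof
    assume out: "outward \<epsilon> m n"
    show "\<forall>u. active E S C u \<longrightarrow> d u m + \<epsilon> \<le> d u n"
    proof (intro allI impI)
      fix u assume "active E S C u"
      then obtain s where s: "u \<in> \<Union>C" "s \<in> T C u" "s \<in> S" by (auto simp: active_def)
      then have "d s m + \<epsilon> \<le> d s n" using out by (simp add: outward_def)
      then show "d u m + \<epsilon> \<le> d u n"
        using d_to_cycle[OF C s(1) V(1) s(2)] d_to_cycle[OF C s(1) V(2) s(2)] by simp
    qed
  next
    assume act: "\<forall>u. active E S C u \<longrightarrow> d u m + \<epsilon> \<le> d u n"
    have "d s m + \<epsilon> \<le> d s n" if sS: "s \<in> S" for s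
    proof -
      obtain u where u: "active E S C u" "u \<in> \<Union>C" "s \<in> T C u" using active_cover[OF C sS] .
      then show ?thesis
        using act d_to_cycle[OF C u(2) V(1) u(3)] d_to_cycle[OF C u(2) V(2) u(3)] by simp
    qed
    then show "outward \<epsilon> m n" using mnE by (simp add: outward_def)
  qed
qed

lemma active_index:
  assumes "labeling C vs" "active E S C u"
  obtains l where "l < length vs" "vs ! l = u"
  using assms labeling_set[OF assms(1)] by (auto simp: active_def in_set_conv_nth)

text \<open>From index \<open>l\<close>, the direct way to 0 must beat the opposite way to
  \<open>g - 1\<close> by \<epsilon>, that is \<open>l + \<epsilon> \<le> g - 1 - l\<close>; the
  largest solution is \<open>half \<epsilon> g - 1\<close>. This is the origin of the bounds on
  \<open>k\<close> in configurations B and D and of those on critical vertices.\<close>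

lemma outward_labeling:
  assumes C: "C \<in> cycles E" and ws: "labeling C ws" and eps: "\<epsilon> \<le> 1"
  shows "outward \<epsilon> (ws ! 0) (ws ! (length ws - 1)) \<longleftrightarrow>
    (\<forall>l<length ws. active E S C (ws ! l) \<longrightarrow> l \<le> half \<epsilon> (length ws) - 1)"
proof -
  let ?g = "length ws"
  have g3: "3 \<le> ?g" using ws by (simp add: labeling_def)
  have e: "{ws ! 0, ws ! (?g - 1)} \<in> C" using labeling_closing_edge[OF ws] by (simp add: insert_commute)
  have key: "d (ws ! l) (ws ! 0) + \<epsilon> \<le> d (ws ! l) (ws ! (?g - 1)) \<longleftrightarrow> l \<le> half \<epsilon> ?g - 1"
    if "l < ?g" for l
  proof -
    have "d (ws ! l) (ws ! 0) = cdist ?g l 0" "d (ws ! l) (ws ! (?g - 1)) = cdist ?g l (?g - 1)"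
      using that g3 by (auto intro!: d_labeling[OF C ws])
    moreover have "\<epsilon> = 0 \<or> \<epsilon> = 1" using eps by auto
    ultimately show ?thesis using that g3 by (auto simp: cdist_def half_def min_def split: if_splits)
  qed
  show ?thesis unfolding outward_cycle[OF C e]
    using key active_index[OF ws] by metis
qed

lemma labeling_nbr:
  assumes vs: "labeling C vs" and n: "{vs ! 0, n} \<in> C"
  shows "n = vs ! 1 \<or> n = vs ! (length vs - 1)"
proof (cases rule: labeling_edgeE[OF vs n])
  case (1 i)
  then consider "vs ! 0 = vs ! i" "n = vs ! Suc i" | "vs ! 0 = vs ! Suc i"
    by (auto simp: doubleton_eq_iff)
  then show ?thesis
  proof cases
    case a: 1
    then have "i = 0" using labeling_nth_eq[OF vs, of 0 i] 1(1) labeling_ne[OF vs] by simp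
    then show ?thesis using a by simp
  next
    case 2
    then show ?thesis using labeling_nth_eq[OF vs, of 0 "Suc i"] 1(1) labeling_ne[OF vs] by simp
  qed
qed (auto simp: doubleton_eq_iff)

text \<open>The neighbour is put at the last index so that \<open>outward_labeling\<close>
  applies.\<close>

lemma nbr_labeling:
  assumes C: "C \<in> cycles E" and mn: "{m, n} \<in> C"
  obtains ws where "labeling C ws" "ws ! 0 = m" "ws ! (length ws - 1) = n"
proof -
  have "m \<in> \<Union>C" using mn by blast
  then obtain vs where vs: "labeling C vs" "vs ! 0 = m" using labeling_from[OF C] by blast
  let ?g = "length vs"
  have g3: "3 \<le> ?g" using vs by (simp add: labeling_def)
  then have g0: "0 < ?g" by linarith
  show ?thesis
  proof (cases "n = vs ! (?g - 1)")
    case False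
    then have n: "n = vs ! 1" using labeling_nbr[OF vs(1)] mn vs(2) by auto
    obtain ws where ws: "labeling C ws" "length ws = ?g"
      "\<And>j. j < ?g \<Longrightarrow> ws ! j = vs ! (reflected ?g 0 j)"
      using labeling_reflect[OF vs(1) g0] by metis
    show ?thesis using that[OF ws(1)] ws(2) ws(3)[of 0] ws(3)[of "?g - 1"] vs(2) n g3 g0 by simp
  qed (use that vs in simp)
qed

text \<open>Biactivity makes the set under \<open>Max\<close> nonempty. Upper bounds on
  \<open>last_active\<close> are proved through the third fact, index by index.\<close>

lemma last_active:
  assumes C: "C \<in> cycles E" and vs: "labeling C vs"
  shows "last_active E S C vs < length vs" "active E S C (vs ! last_active E S C vs)"
    and "last_active E S C vs \<le> b \<longleftrightarrow> (\<forall>l<length vs. active E S C (vs ! l) \<longrightarrow> l \<le> b)"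
proof -
  let ?A = "{i. i < length vs \<and> active E S C (vs ! i)}"
  obtain u where "active E S C u" using two_active[OF C] .
  then have ne: "?A \<noteq> {}" using active_index[OF vs] by blast
  have fin: "finite ?A" by simp
  have "last_active E S C vs \<in> ?A" unfolding last_active_def using Max_in[OF fin ne] .
  then show "last_active E S C vs < length vs" "active E S C (vs ! last_active E S C vs)" by simp_all
  show "last_active E S C vs \<le> b \<longleftrightarrow> (\<forall>l<length vs. active E S C (vs ! l) \<longrightarrow> l \<le> b)"
    unfolding last_active_def using Max_le_iff[OF fin ne] by auto
qed

lemma last_active_ge:
  assumes "C \<in> cycles E" "labeling C vs" "l < length vs" "active E S C (vs ! l)"
  shows "l \<le> last_active E S C vs"
  using last_active(3)[OF assms(1,2), of "last_active E S C vs"] assms(3,4) by blast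

lemma cdist_le: "cdist g i j \<le> (if i \<le> j then j - i else i - j)"
  by (simp add: cdist_def)

text \<open>The active vertices at the indices 0 and \<open>last_active\<close> of \<open>ws\<close>
  really are that far apart if this is at most half the cycle, whereas two vertices with indices in
  \<open>{0..b}\<close> have distance at most \<open>b\<close>.\<close>

lemma active_span_le:
  assumes C: "C \<in> cycles E" and ws: "labeling C ws" "active E S C (ws ! 0)"
    and k: "2 * last_active E S C ws \<le> card C"
    and vs: "labeling C vs" and all: "\<And>l. l < length vs \<Longrightarrow> active E S C (vs ! l) \<Longrightarrow> l \<le> b"
  shows "last_active E S C ws \<le> b"
proof -
  let ?k = "last_active E S C ws"
  have act: "?k < length ws" "active E S C (ws ! ?k)" using last_active[OF C ws(1)] by auto
  have g: "length ws = card C" "length vs = card C" using labeling_length ws vs by auto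
  obtain a where a: "a < length vs" "vs ! a = ws ! 0" using active_index[OF vs ws(2)] .
  obtain c where c: "c < length vs" "vs ! c = ws ! ?k" using active_index[OF vs act(2)] .
  have "a \<le> b" "c \<le> b" using all a c ws(2) act(2) by auto
  then have "cdist (length vs) a c \<le> b" using cdist_le[of "length vs" a c] by (auto split: if_splits)
  moreover have "cdist (length vs) a c = d (ws ! 0) (ws ! ?k)" using d_labeling[OF C vs a(1) c(1)] a c by simp
  moreover have "d (ws ! 0) (ws ! ?k) = cdist (length ws) 0 ?k"
    using act(1) by (intro d_labeling[OF C ws(1)]) linarith+
  moreover have "cdist (length ws) 0 ?k = ?k" using k g by (simp add: cdist_def)
  ultimately show ?thesis by simp
qed

text \<open>Spares the comparison with the other labelings: a span of at most half the cycle is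
  already minimal.\<close>

lemma canonicalI:
  assumes C: "C \<in> cycles E" and ws: "labeling C ws" "active E S C (ws ! 0)"
    and k: "2 * last_active E S C ws \<le> card C"
  shows "canonical_labeling E S C ws"
  unfolding canonical_labeling_def
  using active_span_le[OF C ws k] last_active_ge[OF C] ws by blast

lemma canonical_two_active:
  assumes C: "C \<in> cycles E" and vs: "canonical_labeling E S C vs" and two: "num_active E S C = 2"
    and k: "k = last_active E S C vs"
  shows "2 * k \<le> card C" "0 < k" "k < card C"
    and "\<And>l. l < length vs \<Longrightarrow> active E S C (vs ! l) \<longleftrightarrow> l = 0 \<or> l = k"
proof -
  have lab: "labeling C vs" and act0: "active E S C (vs ! 0)"
    and min: "\<And>ws. labeling C ws \<Longrightarrow> active E S C (ws ! 0) \<Longrightarrow> k \<le> last_active E S C ws"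
    using vs k by (auto simp: canonical_labeling_def)
  let ?g = "length vs"
  have g: "card C = ?g" using labeling_length[OF lab] by simp
  have kl: "k < ?g" "active E S C (vs ! k)" using last_active[OF C lab] k by auto
  show "k < card C" using kl g by simp
  show k0: "0 < k"
  proof (rule ccontr)
    assume "\<not> 0 < k"
    then have z: "l = 0" if "l < ?g" "active E S C (vs ! l)" for l
      using last_active_ge[OF C lab that] k by simp
    obtain u v where "u \<noteq> v" "active E S C u" "active E S C v" using two_active[OF C] .
    then show False using active_index[OF lab] z by metis
  qed
  have "card {vs ! 0, vs ! k} = 2"
    using labeling_nth_eq[OF lab _ kl(1), of 0] k0 kl(1) labeling_ne[OF lab] by (auto simp: card_insert_if)
  moreover have "finite {v \<in> \<Union>C. active E S C v}"
    using labeling_set[OF lab] by simp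
  moreover have "{vs ! 0, vs ! k} \<subseteq> {v \<in> \<Union>C. active E S C v}"
    using act0 kl by (auto simp: active_def)
  ultimately have eq: "{v \<in> \<Union>C. active E S C v} = {vs ! 0, vs ! k}"
    using two unfolding num_active_def by (metis card_subset_eq)
  show act: "active E S C (vs ! l) \<longleftrightarrow> l = 0 \<or> l = k" if l: "l < ?g" for l
  proof
    assume a: "active E S C (vs ! l)"
    then have "vs ! l \<in> {v \<in> \<Union>C. active E S C v}" by (auto simp: active_def)
    then have "vs ! l = vs ! 0 \<or> vs ! l = vs ! k" using eq by blast
    then show "l = 0 \<or> l = k"
      using labeling_nth_eq[OF lab l, of 0] labeling_nth_eq[OF lab l, of k] kl labeling_ne[OF lab] by auto
  qed (use act0 kl in auto)
  \<comment> \<open>Starting at the other active vertex gives the span \<open>g - k\<close>, so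
    minimality of \<open>k\<close> yields \<open>2 * k \<le> g\<close>.\<close>
  obtain ws where ws: "labeling C ws" "length ws = ?g"
    "\<And>j. j < ?g \<Longrightarrow> ws ! j = vs ! (rotated ?g k j)"
    using labeling_rotate[OF lab kl(1)] by metis
  have "active E S C (ws ! 0)" using ws(3)[of 0] kl labeling_ne[OF lab] by simp
  then have "k \<le> last_active E S C ws" using min ws(1) by blast
  also have "last_active E S C ws \<le> ?g - k"
    unfolding last_active(3)[OF C ws(1)]
  proof (intro allI impI)
    fix l assume l: "l < length ws" "active E S C (ws ! l)"
    let ?m = "rotated ?g k l"
    have "?m < ?g" using kl(1) l ws(2) by auto
    then have "?m = 0 \<or> ?m = k" using act[of ?m] l ws(2) ws(3)[of l] by simp
    then show "l \<le> ?g - k" using kl(1) k0 l(1) ws(2) by (auto split: if_splits)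
  qed
  finally show "2 * k \<le> card C" using g kl by simp
qed

lemma two_activeI:
  assumes C: "C \<in> cycles E" and ws: "labeling C ws" "active E S C (ws ! 0)"
    and only: "\<And>l. l < length ws \<Longrightarrow> active E S C (ws ! l) \<Longrightarrow> l = 0 \<or> l = k"
    and k: "2 * k \<le> card C"
  shows "canonical_labeling E S C ws" "last_active E S C ws = k" "num_active E S C = 2"
proof -
  have g: "length ws = card C" using labeling_length[OF ws(1)] .
  obtain u v where uv: "u \<noteq> v" "active E S C u" "active E S C v" using two_active[OF C] .
  then obtain a b where ab: "a < length ws" "b < length ws" "ws ! a = u" "ws ! b = v" 
    using active_index[OF ws(1)] by metis
  then have "a = 0 \<and> b = k \<or> a = k \<and> b = 0" using only[of a] only[of b] uv by auto
  then have kk: "active E S C (ws ! k)" "k < length ws" "k \<noteq> 0"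
    using ab uv by (cases "k = 0"; auto)+
  have "last_active E S C ws \<le> k" unfolding last_active(3)[OF C ws(1)] using only by auto
  then show l: "last_active E S C ws = k" using last_active_ge[OF C ws(1) kk(2,1)] by simp
  show "canonical_labeling E S C ws" using canonicalI[OF C ws] l k by simp
  have "{v \<in> \<Union>C. active E S C v} = {ws ! 0, ws ! k}"
  proof (intro equalityI subsetI)
    fix v assume "v \<in> {v \<in> \<Union>C. active E S C v}"
    then obtain l where "l < length ws" "ws ! l = v" "active E S C v" using active_index[OF ws(1)] by blast
    then show "v \<in> {ws ! 0, ws ! k}" using only by blast
  qed (use ws(2) kk in \<open>auto simp: active_def\<close>)
  moreover have "ws ! 0 \<noteq> ws ! k" using labeling_nth_eq[OF ws(1), of 0 k] kk labeling_ne[OF ws(1)] by auto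
  ultimately show "num_active E S C = 2" by (simp add: num_active_def)
qed

text \<open>Configurations B and D in one: \<open>h\<close> is the floor or the ceiling of
  \<open>g/2\<close>, and \<open>g - h\<close> is the other rounding.\<close>

definition thread_config :: "nat \<Rightarrow> 'a set set \<Rightarrow> bool" where
  "thread_config \<epsilon> C \<longleftrightarrow>
     (\<exists>vs. canonical_labeling E S C vs \<and>
        (let g = card C; h = half \<epsilon> g; k = last_active E S C vs in
           k \<le> h - 1 \<and>
           (\<exists>i \<in> {k..h - 1} \<union> {g - h + k + 1..g - 1} \<union> {0}.
              \<exists>us. free_thread E S (vs ! i) us)))"

lemma config_B_thread_config: "config_B E S C \<longleftrightarrow> thread_config 1 C"
proof -
  have "card C - half 1 (card C) = (card C + 1) div 2" by (simp add: half_def)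
  then show ?thesis
    unfolding config_B_def thread_config_def Let_def by (simp add: half_def)
qed

lemma config_D_thread_config: "config_D E S C \<longleftrightarrow> thread_config 0 C"
proof -
  have "card C - half 0 (card C) = card C div 2" by (simp add: half_def)
  then show ?thesis
    unfolding config_D_def thread_config_def Let_def by (simp add: half_def)
qed

text \<open>The index ranges consist of positions from which all active vertices lie within
  \<open>h - 1\<close> steps in one direction: backwards if \<open>k \<le> i \<le> h - 1\<close>,
  forwards across index 0 if \<open>g - i + k \<le> h - 1\<close>, and \<open>i = 0\<close> itself.
  So the thread can be moved to index 0 and canonicity forgotten.\<close>

lemma thread_config_iff:
  assumes C: "C \<in> cycles E" and eps: "\<epsilon> \<le> 1"
  shows "thread_config \<epsilon> C \<longleftrightarrow>
    (\<exists>ws us. labeling C ws \<and> last_active E S C ws \<le> half \<epsilon> (length ws) - 1 \<and> free_thread E S (ws ! 0) us)"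
proof
  assume "thread_config \<epsilon> C"
  then obtain vs i us where can: "canonical_labeling E S C vs"
    and k: "last_active E S C vs \<le> half \<epsilon> (card C) - 1"
    and i: "i \<in> {last_active E S C vs..half \<epsilon> (card C) - 1} \<union>
      {card C - half \<epsilon> (card C) + last_active E S C vs + 1..card C - 1} \<union> {0}"
    and us: "free_thread E S (vs ! i) us"
    unfolding thread_config_def Let_def by blast
  let ?k = "last_active E S C vs"
  let ?h = "half \<epsilon> (card C)"
  have lab: "labeling C vs" using can by (simp add: canonical_labeling_def)
  have g: "card C = length vs" using labeling_length[OF lab] by simp
  have g3: "3 \<le> card C" using lab g by (simp add: labeling_def)
  have h: "1 \<le> ?h" "2 * ?h \<le> card C + 1" "?h < card C" using g3 eps by (auto simp: half_def)
  have ge: "l \<le> ?k" if "l < length vs" "active E S C (vs ! l)" for l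
    using last_active_ge[OF C lab that] .
  have il: "i < length vs" using i g h by auto
  consider "i = 0" | "?k \<le> i" "i \<le> ?h - 1" | "card C - ?h + ?k + 1 \<le> i" using i by fastforce
  then show "\<exists>ws us. labeling C ws \<and> last_active E S C ws \<le> half \<epsilon> (length ws) - 1 \<and> free_thread E S (ws ! 0) us"
  proof cases
    case 1
    then show ?thesis using lab k us g by auto
  next
    case 2
    obtain ws where ws: "labeling C ws" "length ws = length vs"
      "\<And>j. j < length vs \<Longrightarrow> ws ! j = vs ! (reflected (length vs) i j)"
      using labeling_reflect[OF lab il] by metis
    have "last_active E S C ws \<le> ?h - 1" unfolding last_active(3)[OF C ws(1)]
    proof (intro allI impI)
      fix l assume l: "l < length ws" "active E S C (ws ! l)"
      let ?m = "reflected (length vs) i l"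
      have "?m < length vs" using il by auto
      then have "?m \<le> ?k" using ge[of ?m] l ws(2) ws(3)[of l] by simp
      then show "l \<le> ?h - 1" using l ws(2) 2 by (auto split: if_splits)
    qed
    moreover have "free_thread E S (ws ! 0) us" using us ws(3)[of 0] il labeling_ne[OF lab] by simp
    ultimately show ?thesis using ws g by auto
  next
    case 3
    obtain ws where ws: "labeling C ws" "length ws = length vs"
      "\<And>j. j < length vs \<Longrightarrow> ws ! j = vs ! (rotated (length vs) i j)"
      using labeling_rotate[OF lab il] by metis
    have "last_active E S C ws \<le> ?h - 1" unfolding last_active(3)[OF C ws(1)]
    proof (intro allI impI)
      fix l assume l: "l < length ws" "active E S C (ws ! l)"
      let ?m = "rotated (length vs) i l"
      have "?m < length vs" using il l ws(2) by auto
      then have "?m \<le> ?k" using ge[of ?m] l ws(2) ws(3)[of l] by simp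
      then show "l \<le> ?h - 1" using l ws(2) 3 il h g by (auto split: if_splits)
    qed
    moreover have "free_thread E S (ws ! 0) us" using us ws(3)[of 0] il labeling_ne[OF lab] by simp
    ultimately show ?thesis using ws g by auto
  qed
next
  assume "\<exists>ws us. labeling C ws \<and> last_active E S C ws \<le> half \<epsilon> (length ws) - 1 \<and> free_thread E S (ws ! 0) us"
  then obtain ws us where ws: "labeling C ws" "last_active E S C ws \<le> half \<epsilon> (length ws) - 1"
    and us: "free_thread E S (ws ! 0) us" by blast
  let ?g = "length ws"
  let ?h = "half \<epsilon> ?g"
  have g: "card C = ?g" using labeling_length[OF ws(1)] by simp
  have g3: "3 \<le> ?g" using ws(1) by (simp add: labeling_def)
  have h: "1 \<le> ?h" "2 * ?h \<le> ?g + 1" "?h < ?g" using g3 eps by (auto simp: half_def)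
  \<comment> \<open>Rotating the first active vertex to the front makes the labeling canonical and
    moves the thread from index 0 to \<open>g - i0\<close>, unless \<open>i0 = 0\<close>.\<close>
  define i0 where "i0 = (LEAST l. l < ?g \<and> active E S C (ws ! l))"
  let ?kw = "last_active E S C ws"
  have k0: "?kw < ?g \<and> active E S C (ws ! ?kw)" using last_active[OF C ws(1)] by simp
  have i0: "i0 < ?g" "active E S C (ws ! i0)"
    using LeastI[of "\<lambda>l. l < ?g \<and> active E S C (ws ! l)", OF k0] by (auto simp: i0_def)
  have i0_le: "i0 \<le> l" if "l < ?g" "active E S C (ws ! l)" for l
    unfolding i0_def using that by (intro Least_le) simp
  have le_k0: "l \<le> ?kw" if "l < ?g" "active E S C (ws ! l)" for l
    using last_active_ge[OF C ws(1) that] .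
  obtain vs where vs: "labeling C vs" "length vs = ?g"
    "\<And>j. j < ?g \<Longrightarrow> vs ! j = ws ! (rotated ?g i0 j)"
    using labeling_rotate[OF ws(1) i0(1)] by metis
  let ?k = "last_active E S C vs"
  have i0k: "i0 \<le> ?kw" using le_k0 i0 by simp
  have kle: "?k \<le> ?kw - i0" unfolding last_active(3)[OF C vs(1)]
  proof (intro allI impI)
    fix l assume l: "l < length vs" "active E S C (vs ! l)"
    let ?m = "rotated ?g i0 l"
    have "?m < ?g" "active E S C (ws ! ?m)" using l vs(2) vs(3)[of l] i0 by auto
    then have "i0 \<le> ?m" "?m \<le> ?kw" using i0_le le_k0 by blast+
    then show "l \<le> ?kw - i0" using l vs(2) i0k i0(1) by (auto split: if_splits)
  qed
  have "active E S C (vs ! 0)" using i0 vs(3)[of 0] labeling_ne[OF ws(1)] by simp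
  then have can: "canonical_labeling E S C vs"
    using kle ws(2) h g by (intro canonicalI[OF C vs(1)]) auto
  define i where "i = (if i0 = 0 then 0 else ?g - i0)"
  have "vs ! i = ws ! 0" using vs(3)[of i] i0 by (auto simp: i_def)
  then have "free_thread E S (vs ! i) us" using us by simp
  moreover have "i \<in> {?k..?h - 1} \<union> {?g - ?h + ?k + 1..?g - 1} \<union> {0}"
    using kle ws(2) i0k h i0(1) by (auto simp: i_def)
  moreover have "?k \<le> ?h - 1" using kle ws(2) by simp
  ultimately show "thread_config \<epsilon> C" unfolding thread_config_def Let_def g using can by blast
qed

section \<open>Critical vertices\<close>

definition critical :: "nat \<Rightarrow> 'a set set \<Rightarrow> 'a \<Rightarrow> bool" where
  "critical \<epsilon> C v \<longleftrightarrow>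
     (\<exists>p. S_path E S C p \<and> length p - 1 \<le> half \<epsilon> (card C) - 1 \<and> v \<in> {hd p, last p})"

lemma vertex_critical_eq: "vertex_critical E S C v \<longleftrightarrow> critical 1 C v"
  by (simp add: vertex_critical_def critical_def half_def)

lemma edge_critical_eq: "edge_critical E S C v \<longleftrightarrow> critical 0 C v"
  by (simp add: edge_critical_def critical_def half_def)

text \<open>An inactive end of an \<open>S\<close>-path could be dropped, so both ends are active;
  counted from either end, all active vertices lie on the path. Conversely the initial segment of
  such a labeling up to its last active index is an \<open>S\<close>-path, by
  \<open>active_span_le\<close>.\<close>

lemma critical_iff:
  assumes C: "C \<in> cycles E" and eps: "\<epsilon> \<le> 1"
  shows "critical \<epsilon> C v \<longleftrightarrow>
    (\<exists>ws. labeling C ws \<and> ws ! 0 = v \<and> active E S C v \<and> last_active E S C ws \<le> half \<epsilon> (length ws) - 1)"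
proof
  assume "critical \<epsilon> C v"
  then obtain p where p: "S_path E S C p" "length p - 1 \<le> half \<epsilon> (card C) - 1" "v \<in> {hd p, last p}"
    by (auto simp: critical_def)
  then obtain vs n where vs: "labeling C vs" "p = take n vs" "p \<noteq> []"
    by (auto simp: S_path_def subpath_def)
  have cov: "{v \<in> \<Union>C. active E S C v} \<subseteq> set p"
    and min: "\<And>q. subpath C q \<Longrightarrow> {v \<in> \<Union>C. active E S C v} \<subseteq> set q \<Longrightarrow> length p \<le> length q"
    using p(1) by (auto simp: S_path_def)
  let ?g = "length vs" and ?L = "length p"
  have g: "card C = ?g" using labeling_length[OF vs(1)] by simp
  have g3: "3 \<le> ?g" using vs(1) by (simp add: labeling_def)
  have h: "1 \<le> half \<epsilon> ?g" "half \<epsilon> ?g < ?g" using g3 eps by (auto simp: half_def)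
  have L: "1 \<le> ?L" "?L \<le> half \<epsilon> ?g" "?L < ?g"
    using p(2) vs(3) h g by (cases p; auto)+
  have nL: "p = take ?L vs" using vs(2) by (metis length_take min.commute take_take take_all_iff nle_le)
  have nth: "p ! i = vs ! i" if "i < ?L" for i using that nL by (metis nth_take)
  have hdlast: "hd p = vs ! 0" "last p = vs ! (?L - 1)"
    using vs(3) nth L by (simp_all add: hd_conv_nth last_conv_nth)
  have actL: "l < ?L" if l: "l < ?g" "active E S C (vs ! l)" for l
  proof -
    have "vs ! l \<in> set p" using l cov by (auto simp: active_def)
    then obtain i where "i < ?L" "p ! i = vs ! l" by (auto simp: in_set_conv_nth)
    then show ?thesis using nth labeling_nth_eq[OF vs(1), of i l] l L by auto
  qed
  obtain u w where uw: "u \<noteq> w" "active E S C u" "active E S C w" using two_active[OF C] .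
  have "u \<in> set p" "w \<in> set p" using uw cov by (auto simp: active_def)
  \<comment> \<open>With at least two vertices, the path stays nonempty when an end is dropped
    below.\<close>
  then have L2: "2 \<le> ?L" using uw(1) by (cases p; cases "tl p") (auto simp: Suc_le_eq)
  have act_last: "active E S C (vs ! (?L - 1))"
  proof (rule ccontr)
    assume n: "\<not> active E S C (vs ! (?L - 1))"
    have "{v \<in> \<Union>C. active E S C v} \<subseteq> set (take (?L - 1) vs)"
    proof
      fix x assume "x \<in> {v \<in> \<Union>C. active E S C v}"
      then obtain l where l: "l < ?g" "vs ! l = x" "active E S C x" using active_index[OF vs(1)] by blast
      then have "l < ?L - 1" using actL[of l] n by (cases "l = ?L - 1") auto
      then show "x \<in> set (take (?L - 1) vs)" using l by (auto simp: in_set_conv_nth)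
    qed
    moreover have "vs \<noteq> []" using g3 by auto
    then have "subpath C (take (?L - 1) vs)" using vs(1) L2 by (auto simp: subpath_def)
    ultimately have "?L \<le> length (take (?L - 1) vs)" using min by blast
    then show False using L by simp
  qed
  have act_first: "active E S C (vs ! 0)"
  proof (rule ccontr)
    assume n: "\<not> active E S C (vs ! 0)"
    \<comment> \<open>Subpaths are initial segments of labelings, so dropping the first vertex means
      rotating by one.\<close>
    obtain ws where ws: "labeling C ws" "length ws = ?g"
      "\<And>j. j < ?g \<Longrightarrow> ws ! j = vs ! (rotated ?g 1 j)"
      using labeling_rotate[OF vs(1), of 1] g3 by (metis less_le_trans one_less_numeral_iff semiring_norm(77))
    have "{v \<in> \<Union>C. active E S C v} \<subseteq> set (take (?L - 1) ws)"
    proof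
      fix x assume "x \<in> {v \<in> \<Union>C. active E S C v}"
      then obtain l where l: "l < ?g" "vs ! l = x" "active E S C x" using active_index[OF vs(1)] by blast
      then have l0: "0 < l" "l < ?L" using actL[of l] n by (auto intro: gr0I)
      then have "ws ! (l - 1) = x" using ws(3)[of "l - 1"] l by simp
      then show "x \<in> set (take (?L - 1) ws)"
        using l0 L ws(2) by (auto simp: in_set_conv_nth intro!: exI[of _ "l - 1"])
    qed
    moreover have "ws \<noteq> []" using g3 ws(2) by auto
    then have "subpath C (take (?L - 1) ws)" using ws(1) L2 by (auto simp: subpath_def)
    ultimately have "?L \<le> length (take (?L - 1) ws)" using min by blast
    also have "\<dots> \<le> ?L - 1" by simp
    finally show False using L(1) by linarith
  qed
  show "\<exists>ws. labeling C ws \<and> ws ! 0 = v \<and> active E S C v \<and> last_active E S C ws \<le> half \<epsilon> (length ws) - 1"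
  proof (cases "v = vs ! 0")
    case True
    have "last_active E S C vs \<le> half \<epsilon> ?g - 1"
      unfolding last_active(3)[OF C vs(1)] using actL L by fastforce
    then show ?thesis using vs(1) act_first True by blast
  next
    case False
    then have v: "v = vs ! (?L - 1)" using p(3) hdlast by simp
    have "?L - 1 < ?g" using L by simp
    then obtain ws where ws: "labeling C ws" "length ws = ?g"
      "\<And>j. j < ?g \<Longrightarrow> ws ! j = vs ! (reflected ?g (?L - 1) j)"
      using labeling_reflect[OF vs(1)] by metis
    have "last_active E S C ws \<le> half \<epsilon> ?g - 1" unfolding last_active(3)[OF C ws(1)]
    proof (intro allI impI)
      fix l assume l: "l < length ws" "active E S C (ws ! l)"
      show "l \<le> half \<epsilon> ?g - 1"
      proof -
        let ?m = "reflected ?g (?L - 1) l"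
        have "?m < ?g" using L by auto
        then have "?m < ?L" using actL[of ?m] l ws(2) ws(3)[of l] by simp
        then show ?thesis using l ws(2) L by (auto split: if_splits)
      qed
    qed
    moreover have "ws ! 0 = v" using ws(3)[of 0] g3 v by (simp flip: length_greater_0_conv)
    ultimately show ?thesis using ws act_last v by auto
  qed
next
  assume "\<exists>ws. labeling C ws \<and> ws ! 0 = v \<and> active E S C v \<and> last_active E S C ws \<le> half \<epsilon> (length ws) - 1"
  then obtain ws where ws: "labeling C ws" "ws ! 0 = v" "active E S C v"
    and k: "last_active E S C ws \<le> half \<epsilon> (length ws) - 1" by blast
  let ?k = "last_active E S C ws" and ?g = "length ws"
  have g: "card C = ?g" using labeling_length[OF ws(1)] by simp
  have g3: "3 \<le> ?g" using ws(1) by (simp add: labeling_def)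
  have k2: "2 * ?k \<le> card C" "?k < ?g" using k g3 eps g by (auto simp: half_def)
  let ?p = "take (Suc ?k) ws"
  have len: "length ?p = Suc ?k" using k2 by simp
  have "S_path E S C ?p" unfolding S_path_def
  proof (intro conjI allI impI)
    show "subpath C ?p" using ws(1) k2 by (auto simp: subpath_def)
    show "{v \<in> \<Union>C. active E S C v} \<subseteq> set ?p"
    proof
      fix x assume "x \<in> {v \<in> \<Union>C. active E S C v}"
      then obtain l where l: "l < ?g" "ws ! l = x" "active E S C x" using active_index[OF ws(1)] by blast
      then have "l \<le> ?k" using last_active_ge[OF C ws(1)] by blast
      then show "x \<in> set ?p" using l k2 by (auto simp: in_set_conv_nth intro!: exI[of _ l])
    qed
    fix q assume q: "subpath C q \<and> {v \<in> \<Union>C. active E S C v} \<subseteq> set q"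
    then obtain vs n where vs: "labeling C vs" "q = take n vs" "q \<noteq> []" by (auto simp: subpath_def)
    have "?k \<le> length q - 1"
    proof (rule active_span_le[OF C ws(1) _ k2(1) vs(1)])
      show "active E S C (ws ! 0)" using ws by simp
      fix l assume l: "l < length vs" "active E S C (vs ! l)"
      then have "vs ! l \<in> set q" using q by (auto simp: active_def)
      then obtain i where i: "i < length q" "q ! i = vs ! l" by (auto simp: in_set_conv_nth)
      then have "vs ! i = vs ! l" "i < length vs" using vs(2) by auto
      then have "i = l" using labeling_nth_eq[OF vs(1)] l by blast
      then show "l \<le> length q - 1" using i by simp
    qed
    then show "length ?p \<le> length q" using len vs(3) by (cases q) auto
  qed
  moreover have "hd ?p = v" using ws k2 by (cases ws) auto
  ultimately show "critical \<epsilon> C v" unfolding critical_def using len k g by (intro exI[of _ ?p]) simp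
qed

section \<open>Pairs of outward neighbours\<close>

lemma outward_cycleE:
  assumes C: "C \<in> cycles E" and mn: "{m, n} \<in> C" and out: "outward \<epsilon> m n" and eps: "\<epsilon> \<le> 1"
  obtains ws where "labeling C ws" "ws ! 0 = m" "ws ! (length ws - 1) = n"
    "last_active E S C ws \<le> half \<epsilon> (length ws) - 1"
proof -
  obtain ws where ws: "labeling C ws" "ws ! 0 = m" "ws ! (length ws - 1) = n"
    using nbr_labeling[OF C mn] .
  then have "last_active E S C ws \<le> half \<epsilon> (length ws) - 1"
    using outward_labeling[OF C ws(1) eps] out last_active(3)[OF C ws(1)] by simp
  then show ?thesis using that ws by blast
qed

lemma outward_cycleI:
  assumes C: "C \<in> cycles E" and ws: "labeling C ws" "last_active E S C ws \<le> half \<epsilon> (length ws) - 1"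
    and eps: "\<epsilon> \<le> 1"
  shows "outward \<epsilon> (ws ! 0) (ws ! (length ws - 1))"
  using outward_labeling[OF C ws(1) eps] ws(2) last_active(3)[OF C ws(1)] by blast

text \<open>That \<open>n1\<close> is outward confines the active indices to the half that starts at
  \<open>m\<close>, where every index but 0 is nearer to \<open>n2 = ws ! 1\<close>. So
  \<open>m\<close> would be the only active vertex.\<close>

lemma outward_same_cycle:
  assumes C: "C \<in> cycles E" and n: "{m, n1} \<in> C" "{m, n2} \<in> C" "n1 \<noteq> n2"
    and out: "outward \<epsilon> m n1" "outward \<epsilon> m n2" and eps: "\<epsilon> \<le> 1"
  shows False
proof -
  obtain ws where ws: "labeling C ws" "ws ! 0 = m" "ws ! (length ws - 1) = n1"
    and k: "last_active E S C ws \<le> half \<epsilon> (length ws) - 1"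
    using outward_cycleE[OF C n(1) out(1) eps] .
  let ?g = "length ws"
  have g3: "3 \<le> ?g" using ws by (simp add: labeling_def)
  have out2: "\<forall>u. active E S C u \<longrightarrow> d u m + \<epsilon> \<le> d u n2"
    using out(2) outward_cycle[OF C n(2)] by simp
  have n2: "n2 = ws ! 1" using labeling_nbr[OF ws(1)] n(2,3) ws(2,3) by auto
  have zero: "l = 0" if l: "l < ?g" "active E S C (ws ! l)" for l
  proof -
    have "l \<le> half \<epsilon> ?g - 1" using last_active_ge[OF C ws(1) l] k by simp
    moreover have "d (ws ! l) (ws ! 0) \<le> d (ws ! l) (ws ! 1)"
      using out2 l(2) ws(2) n2 by (metis le_add1 order_trans)
    moreover have "d (ws ! l) (ws ! 0) = cdist ?g l 0" "d (ws ! l) (ws ! 1) = cdist ?g l 1"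
      using l(1) g3 by (auto intro!: d_labeling[OF C ws(1)])
    moreover have "2 * half \<epsilon> ?g \<le> ?g + 1" by (simp add: half_def)
    ultimately show ?thesis using g3 l(1) by (auto simp: cdist_def min_def split: if_splits)
  qed
  obtain u v where "u \<noteq> v" "active E S C u" "active E S C v" using two_active[OF C] .
  then show False using active_index[OF ws(1)] zero by metis
qed

text \<open>A landmark behind the bridge would be nearer to \<open>n\<close> than to
  \<open>m\<close>, so that side is free of landmarks and \<open>bridge_side_pendant_path\<close>
  applies.\<close>

lemma outward_bridge:
  assumes nocyc: "\<And>C. C \<in> cycles E \<Longrightarrow> {m, n} \<notin> C" and out: "outward \<epsilon> m n"
  obtains us where "pendant_path m us" "last us = n" "set us = component (E - {{m, n}}) n" "set us \<inter> S = {}"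
proof -
  have e: "{m, n} \<in> E" using out by (simp add: outward_def)
  have m: "m \<in> V" "m \<notin> component (E - {{m, n}}) n"
    using edge_in_V[OF e] bridge_separates[OF e nocyc] by simp_all
  have "component (E - {{m, n}}) n \<inter> S = {}"
  proof (rule equals0I)
    fix s assume s: "s \<in> component (E - {{m, n}}) n \<inter> S"
    then have "d m s = d m m + 1 + d n s" using d_bridge[OF e nocyc m] by blast
    moreover have "d s m \<le> d s n" using out s by (auto simp: outward_def)
    ultimately show False by (simp add: gdist_commute)
  qed
  then show ?thesis using bridge_side_pendant_path[OF e nocyc] that by metis
qed

text \<open>The case in which \<open>m\<close> has degree 2 and branch resolution gives nothing:
  both sides of \<open>m\<close> are pendant paths, and together with \<open>m\<close> they exhaust
  the graph.\<close>

lemma two_pendant_paths_path_graph: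
  assumes us1: "pendant_path m us1" "last us1 = n1" "set us1 = component (E - {{m, n1}}) n1"
    and us2: "pendant_path m us2" "last us2 = n2" "set us2 = component (E - {{m, n2}}) n2"
    and n: "n1 \<noteq> n2" and N: "nbrs m = {n1, n2}"
  shows "path_graph V E"
proof -
  define p where "p = us1 @ m # rev us2"
  have ne: "us1 \<noteq> []" "us2 \<noteq> []" using us1 us2 by (auto simp: pendant_path_def walk_def)
  have mV: "m \<in> V" using pendant_path_in_V us1 by blast
  have m: "m \<notin> set us1" "m \<notin> set us2" using us1 us2 by (auto simp: pendant_path_def)
  have e: "{m, n1} \<in> E" "{m, n2} \<in> E" using N nbrs_iff by blast+
  have n2A: "n2 \<notin> set us1"
  proof
    assume "n2 \<in> set us1"
    moreover have "{n2, m} \<in> E - {{m, n1}}" using e n by (auto simp: insert_commute doubleton_eq_iff)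
    ultimately have "m \<in> set us1" using component_step us1(3) by metis
    then show False using m by simp
  qed
  \<comment> \<open>An edge entering \<open>set us1\<close> from outside starts at \<open>m\<close>,
    and \<open>m\<close> is not on \<open>us2\<close>.\<close>
  have disj: "set us1 \<inter> set us2 = {}"
  proof -
    have "w \<in> set us2 \<and> w \<notin> set us1" if "w \<in> component (E - {{m, n2}}) n2" for w
    proof -
      from that have "w \<in> {x. x \<in> set us2 \<and> x \<notin> set us1}"
      proof (rule component_closed)
        show "n2 \<in> {x. x \<in> set us2 \<and> x \<notin> set us1}" using n2A ne us2 by auto
        fix x y assume x: "x \<in> {x. x \<in> set us2 \<and> x \<notin> set us1}" and xy: "{x, y} \<in> E - {{m, n2}}"
        have "y \<in> set us2" using component_step[of x _ n2 y] x xy us2(3) by blast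
        moreover have "y \<notin> set us1"
        proof
          assume "y \<in> set us1"
          then obtain i where i: "i < length us1" "us1 ! i = y" by (auto simp: in_set_conv_nth)
          have "{us1 ! i, x} \<in> E" using xy i by (simp add: insert_commute)
          then have "x = m \<or> x \<in> set us1"
            using pendant_path_nbrs[OF us1(1) i(1), of x] i(1) by (auto split: if_splits)
          then show False using x m by auto
        qed
        ultimately show "y \<in> {x. x \<in> set us2 \<and> x \<notin> set us1}" by simp
      qed
      then show ?thesis by simp
    qed
    then show ?thesis using us2(3) by blast
  qed
  let ?D = "{{p ! i, p ! Suc i} | i. Suc i < length p}"
  have walkD: "walk ?D p" by (auto simp: walk_def p_def)
  have hd2: "hd (rev us2) = last us2" using ne by (simp add: hd_rev)
  have "walk ?D us1" "{last us1, m} \<in> ?D" "walk ?D (m # rev us2)"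
    using walkD ne walk_append[of us1 "m # rev us2" ?D] unfolding p_def by simp_all
  moreover from this have "{last us2, m} \<in> ?D" "walk ?D us2"
    using ne hd2 by (simp_all add: walk_Cons walk_rev insert_commute del: mem_Collect_eq)
  ultimately have W: "walk ?D us1" "walk ?D us2" "{last us1, m} \<in> ?D" "{last us2, m} \<in> ?D" by blast+
  have side: "y \<in> insert m (set us) \<and> {x, y} \<in> F"
    if us: "pendant_path m us" "walk F us" "{last us, m} \<in> F" and x: "x \<in> set us" "{x, y} \<in> E" for us x y F
  proof -
    obtain i where i: "i < length us" "us ! i = x" using x(1) by (auto simp: in_set_conv_nth)
    have ne: "us \<noteq> []" using i by auto
    consider "Suc i = length us" "y = m" | "Suc i < length us" "y = us ! Suc i" | "0 < i" "y = us ! (i - 1)"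
      using pendant_path_nbrs[OF us(1) i(1), of y] x i by (auto split: if_splits)
    then show ?thesis
    proof cases
      case 1
      then have "x = last us" using ne i by (metis last_conv_nth diff_Suc_1)
      then show ?thesis using us 1 by simp
    next
      case 2
      then show ?thesis using us(2) i unfolding walk_def by auto
    next
      case 3
      then have "{us ! (i - 1), us ! Suc (i - 1)} \<in> F" using us(2) i(1) 3(1) unfolding walk_def
        by (metis Suc_pred')
      then show ?thesis using 3 i by (auto simp: insert_commute)
    qed
  qed
  have edges: "y \<in> set p \<and> {x, y} \<in> ?D" if x: "x \<in> set p" "{x, y} \<in> E" for x y
  proof -
    consider "x \<in> set us1" | "x = m" | "x \<in> set us2" using x(1) by (auto simp: p_def)
    then show ?thesis
    proof cases
      case 1
      then show ?thesis using side[OF us1(1) W(1,3) 1 x(2)] unfolding p_def by auto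
    next
      case 2
      then have "y = n1 \<or> y = n2" using x(2) N nbrs_iff by blast
      moreover have "n1 \<in> set p" "n2 \<in> set p" using us1(2) us2(2) ne by (auto simp: p_def)
      ultimately show ?thesis using W(3,4) us1(2) us2(2) 2 by (auto simp: insert_commute)
    next
      case 3
      then show ?thesis using side[OF us2(1) W(2,4) 3 x(2)] unfolding p_def by auto
    qed
  qed
  have "V \<subseteq> set p"
  proof
    fix w assume "w \<in> V"
    then have "w \<in> component E m" using connected mV by simp
    then show "w \<in> set p" by (rule component_closed) (use edges in \<open>auto simp: p_def\<close>)
  qed
  moreover have "set p \<subseteq> V" using pendant_path_in_V us1(1) us2(1) by (auto simp: p_def)
  moreover have "distinct p" using us1(1) us2(1) m disj by (auto simp: p_def pendant_path_def)
  moreover have "E = ?D"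
  proof
    show "E \<subseteq> ?D"
    proof
      fix f assume f: "f \<in> E"
      then obtain x y where "f = {x, y}" using edgeE by metis
      then show "f \<in> ?D" using edges[of x y] f edge_in_V[of x y] \<open>V \<subseteq> set p\<close> by blast
    qed
    have "walk E p" using us1 us2 ne e hd2 unfolding p_def
      by (simp add: walk_append walk_Cons walk_rev pendant_path_def insert_commute)
    then show "?D \<subseteq> E" by (auto simp: walk_def)
  qed
  ultimately show ?thesis unfolding path_graph_def by (intro exI[of _ p]) (auto simp: p_def)
qed

section \<open>Two outward neighbours against threads and incident cycles\<close>

definition two_outward :: "nat \<Rightarrow> bool" where
  "two_outward \<epsilon> \<longleftrightarrow> (\<exists>m n1 n2. n1 \<noteq> n2 \<and> outward \<epsilon> m n1 \<and> outward \<epsilon> m n2)"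

definition critically_incident :: "nat \<Rightarrow> 'a set set \<Rightarrow> 'a set set \<Rightarrow> bool" where
  "critically_incident \<epsilon> C D \<longleftrightarrow> C \<noteq> D \<and> (\<exists>v \<in> \<Union>C \<inter> \<Union>D. critical \<epsilon> C v \<and> critical \<epsilon> D v)"

text \<open>\<open>D\<close> has an active vertex other than \<open>p\<close>; by
  \<open>crossing_component\<close> the landmarks behind it belong to \<open>T C p\<close>.\<close>

lemma crossing_active:
  assumes C: "C \<in> cycles E" and D: "D \<in> cycles E" "C \<noteq> D" and p: "p \<in> \<Union>C" "p \<in> \<Union>D"
  shows "active E S C p"
proof -
  obtain v1 v2 where "v1 \<noteq> v2" "active E S D v1" "active E S D v2" using two_active[OF D(1)] .
  then obtain v where v: "v \<noteq> p" "active E S D v" by metis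
  then have "T D v \<subseteq> T C p" using crossing_component[OF C D p _ v(1)] by (simp add: active_def)
  then show ?thesis using v(2) p(1) by (auto simp: active_def)
qed

text \<open>The landmark-free path behind the bridge is a thread because \<open>m\<close> has two
  more neighbours on \<open>C\<close>.\<close>

lemma two_outward_mixed:
  assumes nocyc: "\<And>C. C \<in> cycles E \<Longrightarrow> {m, n1} \<notin> C" and C: "C \<in> cycles E" "{m, n2} \<in> C"
    and out: "outward \<epsilon> m n1" "outward \<epsilon> m n2" and eps: "\<epsilon> \<le> 1"
  shows "thread_config \<epsilon> C"
proof -
  obtain us where us: "pendant_path m us" "set us \<inter> S = {}" using outward_bridge[OF nocyc out(1)] .
  have m: "m \<in> \<Union>C" using C(2) by blast
  have e: "{m, n1} \<in> E" using out by (simp add: outward_def)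
  have "free_thread E S m us"
    using degree_cycle_bridge[OF C(1) m e nocyc[OF C(1)]] us by (simp add: free_thread_def thread_pendant_path)
  moreover obtain ws where "labeling C ws" "ws ! 0 = m" "last_active E S C ws \<le> half \<epsilon> (length ws) - 1"
    using outward_cycleE[OF C out(2) eps] .
  ultimately show ?thesis using thread_config_iff[OF C(1) eps] by blast
qed

text \<open>If both edges lie on cycles, the cycles differ by \<open>outward_same_cycle\<close> and
  \<open>m\<close> is critical on both. If just one does, the other starts a thread. If both are
  bridges, there are two pendant paths at \<open>m\<close>, excluded by branch resolution for degree
  at least 3 and by \<open>nopath\<close> for degree 2.\<close>

lemma two_outward_imp:
  assumes out: "two_outward \<epsilon>" and eps: "\<epsilon> \<le> 1" and nopath: "\<not> path_graph V E"
  shows "(\<exists>C\<in>cycles E. thread_config \<epsilon> C) \<or> (\<exists>C\<in>cycles E. \<exists>D\<in>cycles E. critically_incident \<epsilon> C D)"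
proof -
  obtain m n1 n2 where n: "n1 \<noteq> n2" and o1: "outward \<epsilon> m n1" and o2: "outward \<epsilon> m n2"
    using out by (auto simp: two_outward_def)
  have e: "{m, n1} \<in> E" "{m, n2} \<in> E" using o1 o2 by (auto simp: outward_def)
  show ?thesis
  proof (cases "\<exists>C\<in>cycles E. {m, n1} \<in> C")
    case c1: True
    then obtain C where C: "C \<in> cycles E" "{m, n1} \<in> C" by blast
    show ?thesis
    proof (cases "\<exists>D\<in>cycles E. {m, n2} \<in> D")
      case True
      then obtain D where D: "D \<in> cycles E" "{m, n2} \<in> D" by blast
      have CD: "C \<noteq> D" using outward_same_cycle[OF C(1) C(2) _ n o1 o2 eps] D by auto
      have m: "m \<in> \<Union>C" "m \<in> \<Union>D" using C D by blast+
      have "active E S C m" "active E S D m"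
        using crossing_active[OF C(1) D(1) CD m] crossing_active[OF D(1) C(1) CD[symmetric] m(2,1)] by auto
      then have "critical \<epsilon> C m" "critical \<epsilon> D m"
        using critical_iff[OF C(1) eps] critical_iff[OF D(1) eps]
          outward_cycleE[OF C o1 eps] outward_cycleE[OF D o2 eps] by metis+
      then show ?thesis using C D CD m unfolding critically_incident_def by blast
    next
      case False
      then show ?thesis using two_outward_mixed[of m n2 C n1] C o1 o2 eps by blast
    qed
  next
    case b1: False
    show ?thesis
    proof (cases "\<exists>D\<in>cycles E. {m, n2} \<in> D")
      case True
      then show ?thesis using two_outward_mixed[of m n1 _ n2] b1 o1 o2 eps by blast
    next
      case b2: False
      obtain us1 where us1: "pendant_path m us1" "last us1 = n1" "set us1 = component (E - {{m, n1}}) n1"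
        "set us1 \<inter> S = {}" using outward_bridge[OF _ o1] b1 by metis
      obtain us2 where us2: "pendant_path m us2" "last us2 = n2" "set us2 = component (E - {{m, n2}}) n2"
        "set us2 \<inter> S = {}" using outward_bridge[OF _ o2] b2 by metis
      show ?thesis
      proof (cases "3 \<le> degree E m")
        case True
        then have "us1 = us2"
          using us1 us2 free_thread_unique by (metis free_thread_def thread_pendant_path)
        then show ?thesis using us1 us2 n by simp
      next
        case False
        have sub: "{n1, n2} \<subseteq> nbrs m" using e by simp
        moreover have "card (nbrs m) \<le> card {n1, n2}" using False n by (simp add: degree_nbrs)
        ultimately have "nbrs m = {n1, n2}" using card_seteq[OF finite_nbrs sub] by simp
        then show ?thesis
          using two_pendant_paths_path_graph[OF us1(1-3) us2(1-3) n] nopath by simp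
      qed
    qed
  qed
qed

lemma thread_config_two_outward:
  assumes C: "C \<in> cycles E" and conf: "thread_config \<epsilon> C" and eps: "\<epsilon> \<le> 1"
  shows "two_outward \<epsilon>"
proof -
  obtain ws us where ws: "labeling C ws" "last_active E S C ws \<le> half \<epsilon> (length ws) - 1"
    and us: "free_thread E S (ws ! 0) us" using conf thread_config_iff[OF C eps] by blast
  have pp: "pendant_path (ws ! 0) us" and Sus: "set us \<inter> S = {}"
    using us by (simp_all add: free_thread_def thread_pendant_path)
  have ne: "us \<noteq> []" using pp by (auto simp: pendant_path_def walk_def)
  then have last: "last us = us ! (length us - 1)" by (rule last_conv_nth)
  have "outward \<epsilon> (ws ! 0) (last us)" unfolding outward_def
  proof (intro conjI ballI)
    show "{ws ! 0, last us} \<in> E" using pp by (simp add: pendant_path_def insert_commute)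
    fix s assume "s \<in> S"
    then have "d s (us ! (length us - 1)) = d s (ws ! 0) + (length us - (length us - 1))"
      using d_pendant_path[OF pp, of "length us - 1" s] ne S_sub Sus by auto
    then show "d s (ws ! 0) + \<epsilon> \<le> d s (last us)" using last ne eps by (cases us) auto
  qed
  moreover have "outward \<epsilon> (ws ! 0) (ws ! (length ws - 1))" by (rule outward_cycleI[OF C ws eps])
  moreover have "last us \<noteq> ws ! (length ws - 1)"
    using pendant_path_off_cycle[OF pp C, of "length us - 1"] last ne
      labeling_nth_cycle[OF ws(1), of "length ws - 1"] labeling_ne[OF ws(1)] by auto
  ultimately show ?thesis unfolding two_outward_def by blast
qed

lemma critically_incident_two_outward:
  assumes C: "C \<in> cycles E" and D: "D \<in> cycles E" and inc: "critically_incident \<epsilon> C D" and eps: "\<epsilon> \<le> 1"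
  shows "two_outward \<epsilon>"
proof -
  obtain v where CD: "C \<noteq> D" and v: "critical \<epsilon> C v" "critical \<epsilon> D v"
    using inc by (auto simp: critically_incident_def)
  obtain ws where ws: "labeling C ws" "ws ! 0 = v" "last_active E S C ws \<le> half \<epsilon> (length ws) - 1"
    using v(1) critical_iff[OF C eps] by blast
  obtain vs where vs: "labeling D vs" "vs ! 0 = v" "last_active E S D vs \<le> half \<epsilon> (length vs) - 1"
    using v(2) critical_iff[OF D eps] by blast
  have "outward \<epsilon> v (ws ! (length ws - 1))" "outward \<epsilon> v (vs ! (length vs - 1))"
    using outward_cycleI[OF C ws(1,3) eps] outward_cycleI[OF D vs(1,3) eps] ws vs by simp_all
  \<comment> \<open>Equal neighbours would give \<open>C\<close> and \<open>D\<close> a common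
    edge.\<close>
  moreover have "ws ! (length ws - 1) \<noteq> vs ! (length vs - 1)"
    using labeling_closing_edge[OF ws(1)] labeling_closing_edge[OF vs(1)] ws(2) vs(2)
      cycles_disjoint[OF C D] CD by metis
  ultimately show ?thesis unfolding two_outward_def by blast
qed

lemma two_outward_iff:
  assumes "\<epsilon> \<le> 1" "\<not> path_graph V E"
  shows "two_outward \<epsilon> \<longleftrightarrow>
    (\<exists>C\<in>cycles E. thread_config \<epsilon> C) \<or> (\<exists>C\<in>cycles E. \<exists>D\<in>cycles E. critically_incident \<epsilon> C D)"
  using two_outward_imp thread_config_two_outward critically_incident_two_outward assms by blast

lemma edge_dist_pair: "edge_dist E s {x, y} = min (d s x) (d s y)"
  by (simp add: edge_dist_def)

lemma two_outward_vertices: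
  assumes "two_outward 1" shows "\<not> vertex_metric_generator V E S"
proof -
  obtain m n1 n2 where n: "n1 \<noteq> n2" and o: "outward 1 m n1" "outward 1 m n2"
    using assms by (auto simp: two_outward_def)
  have e: "{m, n1} \<in> E" "{m, n2} \<in> E" using o by (auto simp: outward_def)
  have "d s n1 = d s n2" if "s \<in> S" for s
    using that o d_edge_le[OF e(1), of s] d_edge_le[OF e(2), of s] S_sub by (force simp: outward_def)
  moreover have "n1 \<in> V" "n2 \<in> V" using edge_in_V e by auto
  ultimately show ?thesis using n unfolding vertex_metric_generator_def by metis
qed

lemma two_outward_edges:
  assumes "two_outward 0" shows "\<not> edge_metric_generator E S"
proof -
  obtain m n1 n2 where n: "n1 \<noteq> n2" and o: "outward 0 m n1" "outward 0 m n2"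
    using assms by (auto simp: two_outward_def)
  have e: "{m, n1} \<in> E" "{m, n2} \<in> E" using o by (auto simp: outward_def)
  have "edge_dist E s {m, n1} = edge_dist E s {m, n2}" if "s \<in> S" for s
    using that o by (auto simp: outward_def edge_dist_pair)
  moreover have "{m, n1} \<noteq> {m, n2}" using n by (auto simp: doubleton_eq_iff)
  ultimately show ?thesis using e(1,2) unfolding edge_metric_generator_def by metis
qed

end

section \<open>Cycles with two active vertices\<close>

text \<open>The undistinguished pair of configuration A: for antipodal active vertices both
  neighbours of index 0 lie on shortest ways from one to the other.\<close>

lemma cdist_antipodal_nbrs:
  assumes "2 * k = g" "2 \<le> k" "l = 0 \<or> l = k"
  shows "cdist g l 1 = cdist g l (g - 1)"
proof -
  obtain e where e: "k = 2 + e" using assms(2) le_Suc_ex by blast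
  have "g = 4 + 2 * e" using assms(1) e by simp
  then show ?thesis using assms(3) e by (auto simp: cdist_def)
qed

text \<open>For \<open>i\<close> between the active indices 0 and \<open>k\<close>, the index
  \<open>h + k - i\<close> lies on the other arc and exceeds \<open>i\<close> in distance from both
  of them by the same \<open>h - k\<close>. This explains the thread length \<open>g/2 - k\<close>
  in C and the index of the second thread in E.\<close>

lemma cdist_reflect_even:
  assumes "g = 2 * h" "k \<le> h" "i \<le> k" "h + k - i < g" "l = 0 \<or> l = k"
  shows "cdist g l i + (h - k) = cdist g l (h + k - i)"
proof -
  \<comment> \<open>Sums in place of differences: no truncated subtraction is left when
    \<open>cdist\<close> is unfolded.\<close>
  obtain f where f: "k = i + f" using assms(3) le_Suc_ex by blast
  obtain e where e: "h = k + e" using assms(2) le_Suc_ex by blast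
  have "h + k - i = i + 2 * f + e" "g = 2 * (i + f + e)" using e f assms(1) by simp_all
  then show ?thesis using assms(5) e f by (auto simp: cdist_def)
qed

text \<open>For odd \<open>g\<close> the counterpart of \<open>i\<close> is an edge: index
  \<open>h + k - i\<close> is farther by \<open>h - k\<close> from \<open>k\<close>, and its
  successor is farther by \<open>h - k\<close> from 0.\<close>

lemma cdist_reflect_odd:
  assumes "g = 2 * h + 1" "k \<le> h" "i \<le> k" "l = 0 \<or> l = k"
  shows "cdist g l i + (h - k) =
    min (cdist g l (h + k - i)) (cdist g l (if Suc (h + k - i) < g then Suc (h + k - i) else 0))"
proof -
  obtain f where f: "k = i + f" using assms(3) le_Suc_ex by blast
  obtain e where e: "h = k + e" using assms(2) le_Suc_ex by blast
  define j where "j = i + 2 * f + e"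
  have j: "h + k - i = j" and g: "g = 2 * (i + f + e) + 1" and a: "h - k = e"
    using e f assms(1) by (simp_all add: j_def)
  show ?thesis
  proof (cases "i + e = 0")
    \<comment> \<open>Exactly for \<open>i = 0\<close> and \<open>k = h\<close> the successor wraps
      round to index 0.\<close>
    case True
    then show ?thesis using assms(4) e f g j by (auto simp: cdist_def j_def)
  next
    case False
    then have lt: "Suc j < g" by (auto simp: j_def g)
    have "cdist g l i + e = min (cdist g l j) (cdist g l (Suc j))"
      using assms(4)
    proof
      assume "l = 0"
      moreover have "cdist g 0 i = i" "cdist g 0 j = min j (i + e + 1)" "cdist g 0 (Suc j) = min (j + 1) (i + e)"
        by (simp_all add: cdist_def j_def g)
      ultimately show ?thesis by (simp add: j_def)
    next
      assume "l = k"
      moreover have "cdist g k i = f" "cdist g k j = min (f + e) (2 * i + f + e + 1)"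
        "cdist g k (Suc j) = min (f + e + 1) (2 * i + f + e)"
        by (simp_all add: cdist_def j_def g f)
      ultimately show ?thesis by simp
    qed
    then show ?thesis using lt by (simp add: j a)
  qed
qed

context cactus_landmarks
begin

text \<open>Working form of the common part of A, C and E: minimality of the labeling is replaced by
  \<open>2 * k \<le> length ws\<close>, and that index \<open>k\<close> is active follows from
  biactivity.\<close>

definition two_act :: "'a set set \<Rightarrow> 'a list \<Rightarrow> nat \<Rightarrow> bool" where
  "two_act C ws k \<longleftrightarrow> labeling C ws \<and> active E S C (ws ! 0) \<and> 2 * k \<le> length ws \<and>
     (\<forall>l<length ws. active E S C (ws ! l) \<longrightarrow> l = 0 \<or> l = k)"

lemma two_act_iff:
  assumes C: "C \<in> cycles E"
  shows "two_act C ws k \<longleftrightarrow>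
    canonical_labeling E S C ws \<and> last_active E S C ws = k \<and> num_active E S C = 2"
proof
  assume "two_act C ws k"
  then have lab: "labeling C ws" and act: "active E S C (ws ! 0)" and k: "2 * k \<le> length ws"
    and only: "\<And>l. l < length ws \<Longrightarrow> active E S C (ws ! l) \<Longrightarrow> l = 0 \<or> l = k"
    by (auto simp: two_act_def)
  have k': "2 * k \<le> card C" using k labeling_length[OF lab] by simp
  show "canonical_labeling E S C ws \<and> last_active E S C ws = k \<and> num_active E S C = 2"
    using two_activeI[OF C lab act only k'] by blast
next
  assume r: "canonical_labeling E S C ws \<and> last_active E S C ws = k \<and> num_active E S C = 2"
  then have lab: "labeling C ws" "active E S C (ws ! 0)" by (auto simp: canonical_labeling_def)
  note two = canonical_two_active[OF C, of ws k]
  show "two_act C ws k"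
    unfolding two_act_def using lab two r labeling_length[OF lab(1)] by auto
qed

lemma config_A_iff:
  assumes C: "C \<in> cycles E"
  shows "config_A E S C \<longleftrightarrow> (\<exists>ws k. two_act C ws k \<and> 2 * k = length ws)"
proof -
  have "config_A E S C \<longleftrightarrow> (\<exists>ws k. two_act C ws k \<and> even (card C) \<and> k = card C div 2)"
    unfolding config_A_def Let_def two_act_iff[OF C] by blast
  also have "\<dots> \<longleftrightarrow> (\<exists>ws k. two_act C ws k \<and> 2 * k = length ws)"
  proof -
    have "(even (card C) \<and> k = card C div 2) \<longleftrightarrow> 2 * k = length ws" if "two_act C ws k" for ws k
    proof -
      have "(even n \<and> k = n div 2) \<longleftrightarrow> 2 * k = n" for n :: nat by presburger
      then show ?thesis using that labeling_length[of C ws] by (simp add: two_act_def)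
    qed
    then show ?thesis by blast
  qed
  finally show ?thesis .
qed

lemma config_C_iff:
  assumes C: "C \<in> cycles E"
  shows "config_C E S C \<longleftrightarrow> (\<exists>ws k i us. two_act C ws k \<and> even (length ws) \<and> i \<le> k \<and>
    free_thread E S (ws ! i) us \<and> length ws div 2 \<le> length us + k)"
proof -
  have len: "length ws = card C \<and> k \<le> card C div 2" if "two_act C ws k" for ws k
    using that labeling_length[of C ws] by (auto simp: two_act_def)
  have "config_C E S C \<longleftrightarrow> (\<exists>ws k. two_act C ws k \<and> even (card C) \<and> k \<le> card C div 2 \<and>
    (\<exists>i \<in> {0..k}. \<exists>us. free_thread E S (ws ! i) us \<and> card C div 2 \<le> length us + k))"
    unfolding config_C_def Let_def two_act_iff[OF C] by blast
  also have "\<dots> \<longleftrightarrow> (\<exists>ws k. two_act C ws k \<and> even (length ws) \<and>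
    (\<exists>i \<in> {0..k}. \<exists>us. free_thread E S (ws ! i) us \<and> length ws div 2 \<le> length us + k))"
    by (intro iff_exI conj_cong refl) (drule len, simp)+
  finally show ?thesis by (simp only: atLeastAtMost_iff Bex_def le0 simp_thms) blast
qed

lemma config_E_iff:
  assumes C: "C \<in> cycles E"
  shows "config_E E S C \<longleftrightarrow> (\<exists>ws k i us. two_act C ws k \<and> i \<le> k \<and>
    free_thread E S (ws ! i) us \<and> length ws div 2 + 1 \<le> length us + k \<and>
    (even (length ws) \<longrightarrow> (\<exists>us. free_thread E S (ws ! ((length ws div 2 + k - i) mod length ws)) us)))"
proof -
  have len: "length ws = card C" if "two_act C ws k" for ws k
    using that labeling_length[of C ws] by (auto simp: two_act_def)
  have "config_E E S C \<longleftrightarrow> (\<exists>ws k. two_act C ws k \<and>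
      (\<exists>i \<in> {0..k}. (\<exists>us. free_thread E S (ws ! i) us \<and> card C div 2 + 1 \<le> length us + k) \<and>
         (even (card C) \<longrightarrow> (\<exists>us. free_thread E S (ws ! ((card C div 2 + k - i) mod card C)) us))))"
    unfolding config_E_def Let_def two_act_iff[OF C] by blast
  also have "\<dots> \<longleftrightarrow> (\<exists>ws k. two_act C ws k \<and>
      (\<exists>i \<in> {0..k}. (\<exists>us. free_thread E S (ws ! i) us \<and> length ws div 2 + 1 \<le> length us + k) \<and>
         (even (length ws) \<longrightarrow> (\<exists>us. free_thread E S (ws ! ((length ws div 2 + k - i) mod length ws)) us))))"
    using len by (intro iff_exI conj_cong refl) simp
  finally show ?thesis by (simp only: atLeastAtMost_iff Bex_def le0 simp_thms) blast
qed

text \<open>Seen from \<open>C\<close>, a landmark is the active vertex at which it hangs, moved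
  back by a constant \<open>c\<close>. Comparisons thus reduce to \<open>cdist\<close> from 0 and
  from \<open>k\<close>.\<close>

lemma two_act_distances:
  assumes C: "C \<in> cycles E" and ws: "two_act C ws k" and s: "s \<in> S"
  obtains l c where "l = 0 \<or> l = k" "\<forall>j<length ws. d s (ws ! j) = c + cdist (length ws) l j"
proof -
  have lab: "labeling C ws" using ws by (simp add: two_act_def)
  obtain u where u: "active E S C u" "u \<in> \<Union>C" "s \<in> T C u" using active_cover[OF C s] .
  obtain l where l: "l < length ws" "ws ! l = u" using active_index[OF lab u(1)] .
  have "l = 0 \<or> l = k" using ws l u(1) by (auto simp: two_act_def)
  moreover have "d s (ws ! j) = d s u + cdist (length ws) l j" if j: "j < length ws" for j
    using d_to_cycle[OF C u(2) labeling_nth_cycle[OF lab j] u(3)] d_labeling[OF C lab l(1) j] l(2) by simp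
  ultimately show ?thesis using that by blast
qed

text \<open>The vertex at height \<open>a\<close> over \<open>v\<close>. Threads are listed from the
  leaf, so this is index \<open>length us - a\<close>, and height 0 is \<open>v\<close>
  itself.\<close>

definition thread_pt :: "'a \<Rightarrow> 'a list \<Rightarrow> nat \<Rightarrow> 'a" where
  "thread_pt v us a = (if a = 0 then v else us ! (length us - a))"

lemma d_thread_pt:
  assumes us: "free_thread E S v us" and a: "a \<le> length us" and s: "s \<in> S"
  shows "d s (thread_pt v us a) = d s v + a"
proof (cases "a = 0")
  case False
  have "pendant_path v us" "s \<in> V" "s \<notin> set us"
    using us s S_sub by (auto simp: free_thread_def thread_pendant_path)
  then show ?thesis using d_pendant_path[of v us "length us - a" s] a False by (simp add: thread_pt_def)
qed (simp add: thread_pt_def)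

lemma thread_pt_edge:
  assumes us: "free_thread E S v us" and a: "a < length us"
  shows "{thread_pt v us a, thread_pt v us (Suc a)} \<in> E"
proof -
  have w: "walk E us" "{last us, v} \<in> E" using us by (auto simp: free_thread_def thread_def)
  show ?thesis
  proof (cases "a = 0")
    case True
    have "us \<noteq> []" using a by auto
    then show ?thesis using True w by (simp add: thread_pt_def last_conv_nth insert_commute)
  next
    case False
    then have "Suc (length us - Suc a) = length us - a" "length us - a < length us" using a by auto
    then have "{us ! (length us - Suc a), us ! (length us - a)} \<in> E" using w(1) unfolding walk_def by metis
    then show ?thesis using False by (simp add: thread_pt_def insert_commute)
  qed
qed

lemma thread_pt_off_cycle:
  assumes us: "free_thread E S v us" and C: "C \<in> cycles E" and a: "0 < a" "a \<le> length us"
  shows "thread_pt v us a \<notin> \<Union>C"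
  using pendant_path_off_cycle[of v us C "length us - a"] us C a
  by (simp add: thread_pt_def free_thread_def thread_pendant_path)

section \<open>Undistinguished pairs from the configurations A, C and E\<close>

lemma not_vertex_generatorI:
  assumes "x \<in> V" "y \<in> V" "x \<noteq> y" "\<And>s. s \<in> S \<Longrightarrow> d s x = d s y"
  shows "\<not> vertex_metric_generator V E S"
  using assms unfolding vertex_metric_generator_def by metis

lemma not_edge_generatorI:
  assumes "{x, y} \<in> E" "{x', y'} \<in> E" "{x, y} \<noteq> {x', y'}"
    "\<And>s. s \<in> S \<Longrightarrow> min (d s x) (d s y) = min (d s x') (d s y')"
  shows "\<not> edge_metric_generator E S"
  using assms unfolding edge_metric_generator_def by (metis edge_dist_pair)

lemma config_A_imp:
  assumes C: "C \<in> cycles E" and A: "config_A E S C"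
  shows "\<not> vertex_metric_generator V E S" "\<not> edge_metric_generator E S"
proof -
  obtain ws k where ws: "two_act C ws k" and k: "2 * k = length ws" using A config_A_iff[OF C] by blast
  have lab: "labeling C ws" using ws by (simp add: two_act_def)
  let ?g = "length ws"
  have "3 \<le> ?g" using lab by (simp add: labeling_def)
  then have g4: "4 \<le> ?g" using k by presburger
  have in_C: "ws ! 1 \<in> \<Union>C" "ws ! (?g - 1) \<in> \<Union>C"
    using labeling_nth_cycle[OF lab] g4 by simp_all
  have V: "ws ! 1 \<in> V" "ws ! (?g - 1) \<in> V" using in_C cycle_in_V[OF C] by auto
  have ne: "ws ! 1 \<noteq> ws ! (?g - 1)" using labeling_nth_eq[OF lab, of 1 "?g - 1"] g4 by simp
  have eq: "d s (ws ! 1) = d s (ws ! (?g - 1))" if s: "s \<in> S" for s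
  proof -
    obtain l c where l: "l = 0 \<or> l = k" "\<forall>j<?g. d s (ws ! j) = c + cdist ?g l j"
      using two_act_distances[OF C ws s] .
    have "2 \<le> k" using g4 k by linarith
    then have "cdist ?g l 1 = cdist ?g l (?g - 1)" using cdist_antipodal_nbrs[OF k _ l(1)] by simp
    moreover have "1 < ?g" "?g - 1 < ?g" using g4 by linarith+
    ultimately show ?thesis using l(2) by simp
  qed
  show "\<not> vertex_metric_generator V E S" using not_vertex_generatorI[OF V ne eq] .
  have "{ws ! 0, ws ! 1} \<in> E" "{ws ! 0, ws ! (?g - 1)} \<in> E"
    using labeling_edge[OF lab, of 0] labeling_closing_edge[OF lab] g4 C
    by (auto simp: cycles_def insert_commute)
  moreover have "{ws ! 0, ws ! 1} \<noteq> {ws ! 0, ws ! (?g - 1)}" using ne by (auto simp: doubleton_eq_iff)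
  ultimately show "\<not> edge_metric_generator E S" by (rule not_edge_generatorI) (simp only: eq)
qed

text \<open>The undistinguished vertices are \<open>ws ! (h + k - i)\<close> and the one at height
  \<open>h - k\<close> on the thread at \<open>ws ! i\<close>. For \<open>2 * k = g\<close> that
  height would be 0, and configuration A takes over.\<close>

lemma config_C_imp:
  assumes C: "C \<in> cycles E" and conf: "config_C E S C"
  shows "\<not> vertex_metric_generator V E S"
proof -
  obtain ws k i us where ws: "two_act C ws k" and g: "even (length ws)" and i: "i \<le> k"
    and us: "free_thread E S (ws ! i) us" and len: "length ws div 2 \<le> length us + k"
    using conf config_C_iff[OF C] by blast
  let ?g = "length ws"
  have lab: "labeling C ws" and k: "2 * k \<le> ?g" using ws by (auto simp: two_act_def)
  show ?thesis
  proof (cases "2 * k = ?g")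
    case True
    then show ?thesis using config_A_imp[OF C] config_A_iff[OF C] ws by blast
  next
    case False
    then have k': "2 * k < ?g" using k by simp
    obtain h where h: "?g = 2 * h" using g by (rule evenE)
    define a where "a = h - k"
    let ?x = "thread_pt (ws ! i) us a" and ?y = "ws ! (h + k - i)"
    have a: "0 < a" "a \<le> length us" using k' h len by (auto simp: a_def)
    have j: "h + k - i < ?g" using i k' h by simp
    have x: "?x \<notin> \<Union>C" using thread_pt_off_cycle[OF us C a] .
    have y: "?y \<in> \<Union>C" using labeling_nth_cycle[OF lab j] .
    show ?thesis
    proof (rule not_vertex_generatorI)
      obtain b where b: "a = Suc b" using a(1) gr0_implies_Suc by blast
      show "?x \<in> V" using thread_pt_edge[OF us, of b] a b edge_in_V by simp
      show "?y \<in> V" using cycle_in_V[OF C y] .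
      show "?x \<noteq> ?y" using x y by auto
      fix s assume s: "s \<in> S"
      obtain l c where l: "l = 0 \<or> l = k" "\<forall>j<?g. d s (ws ! j) = c + cdist ?g l j"
        using two_act_distances[OF C ws s] .
      have "d s ?x = d s (ws ! i) + a" using d_thread_pt[OF us a(2) s] .
      moreover have "cdist ?g l i + a = cdist ?g l (h + k - i)"
        unfolding a_def using k h i j l(1) by (intro cdist_reflect_even) linarith+
      moreover have "i < ?g" using i k' by linarith
      ultimately show "d s ?x = d s ?y" using l(2) j by simp
    qed
  qed
qed

text \<open>The thread edge between the heights \<open>h - k\<close> and \<open>h - k + 1\<close>
  over \<open>ws ! i\<close> is undistinguished from an edge opposite to it: for even
  \<open>g\<close> the first edge of the thread at index \<open>h + k - i\<close>, for odd
  \<open>g\<close> the cycle edge from that index to the next.\<close>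

lemma config_E_imp:
  assumes C: "C \<in> cycles E" and conf: "config_E E S C"
  shows "\<not> edge_metric_generator E S"
proof -
  obtain ws k i us where ws: "two_act C ws k" and i: "i \<le> k"
    and us: "free_thread E S (ws ! i) us" and len: "length ws div 2 + 1 \<le> length us + k"
    and even: "even (length ws) \<Longrightarrow>
      \<exists>us. free_thread E S (ws ! ((length ws div 2 + k - i) mod length ws)) us"
    using conf config_E_iff[OF C] by blast
  let ?g = "length ws"
  have lab: "labeling C ws" and k: "2 * k \<le> ?g" using ws by (auto simp: two_act_def)
  define h where "h = ?g div 2"
  define a where "a = h - k"
  let ?x = "thread_pt (ws ! i) us a" and ?y = "thread_pt (ws ! i) us (Suc a)"
  have a: "a < length us" using k len by (auto simp: a_def h_def)
  have xy: "{?x, ?y} \<in> E" using thread_pt_edge[OF us a] .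
  have y: "?y \<notin> \<Union>C" using thread_pt_off_cycle[OF us C, of "Suc a"] a by simp
  have dxy: "min (d s ?x) (d s ?y) = d s (ws ! i) + a" if "s \<in> S" for s
    using d_thread_pt[OF us _ that, of a] d_thread_pt[OF us _ that, of "Suc a"] a by simp
  show ?thesis
  proof (cases "2 * k = ?g")
    case True
    then show ?thesis using config_A_imp[OF C] config_A_iff[OF C] ws by blast
  next
    case False
    then have k': "2 * k < ?g" using k by simp
    show ?thesis
    proof (cases "even ?g")
      case True
      then have h: "?g = 2 * h" by (simp add: h_def)
      have j: "h + k - i < ?g" using i k' h by simp
      let ?q = "ws ! (h + k - i)"
      obtain us' where us': "free_thread E S ?q us'" using even[OF True] j by (auto simp: h_def)
      have ne: "0 < length us'" using us' by (auto simp: free_thread_def thread_def walk_def)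
      let ?x' = "thread_pt ?q us' 0" and ?y' = "thread_pt ?q us' (Suc 0)"
      have q: "?q \<in> \<Union>C" using labeling_nth_cycle[OF lab j] .
      have x': "?x' = ?q" by (simp add: thread_pt_def)
      have a0: "0 < a" using k' h by (simp add: a_def)
      have "?x \<notin> \<Union>C" using thread_pt_off_cycle[OF us C a0] a by simp
      then have dist: "{?x, ?y} \<noteq> {?x', ?y'}" using y q x' by (auto simp: doubleton_eq_iff)
      show ?thesis
      proof (rule not_edge_generatorI[OF xy thread_pt_edge[OF us' ne] dist])
        fix s assume s: "s \<in> S"
        obtain l c where l: "l = 0 \<or> l = k" "\<forall>j<?g. d s (ws ! j) = c + cdist ?g l j"
          using two_act_distances[OF C ws s] .
        have "min (d s ?x') (d s ?y') = d s ?q"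
          using d_thread_pt[OF us' _ s, of 0] d_thread_pt[OF us' _ s, of "Suc 0"] ne by simp
        moreover have "d s (ws ! i) + a = d s ?q"
        proof -
          have "cdist ?g l i + a = cdist ?g l (h + k - i)"
            unfolding a_def using k h i j l(1) by (intro cdist_reflect_even) linarith+
          moreover have "i < ?g" using i k' by linarith
          ultimately show ?thesis using l(2) j by simp
        qed
        ultimately show "min (d s ?x) (d s ?y) = min (d s ?x') (d s ?y')" using dxy[OF s] by simp
      qed
    next
      case False
      then have h: "?g = 2 * h + 1" by (simp add: h_def)
      let ?m = "if Suc (h + k - i) < ?g then Suc (h + k - i) else 0"
      let ?x' = "ws ! (h + k - i)" and ?y' = "ws ! ?m"
      have jl: "h + k - i < ?g" "?m < ?g" using i k' h by auto
      have e: "{?x', ?y'} \<in> C"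
      proof (cases "Suc (h + k - i) < ?g")
        case True
        then show ?thesis using labeling_edge[OF lab] by simp
      next
        case False
        then have "h + k - i = ?g - 1" using jl by simp
        then show ?thesis using False labeling_closing_edge[OF lab] by simp
      qed
      have "?x' \<in> \<Union>C" "?y' \<in> \<Union>C" using e by blast+
      then have dist: "{?x, ?y} \<noteq> {?x', ?y'}" using y by (auto simp: doubleton_eq_iff)
      have e': "{?x', ?y'} \<in> E" using e C by (auto simp: cycles_def)
      show ?thesis
      proof (rule not_edge_generatorI[OF xy e' dist])
        fix s assume s: "s \<in> S"
        obtain l c where l: "l = 0 \<or> l = k" "\<forall>j<?g. d s (ws ! j) = c + cdist ?g l j"
          using two_act_distances[OF C ws s] .
        have "d s (ws ! i) + a = min (d s ?x') (d s ?y')"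
        proof -
          have "cdist ?g l i + a = min (cdist ?g l (h + k - i)) (cdist ?g l ?m)"
            unfolding a_def using k h i l(1) by (intro cdist_reflect_odd) linarith+
          moreover have "i < ?g" using i k' by linarith
          ultimately have "d s (ws ! i) + a = c + min (cdist ?g l (h + k - i)) (cdist ?g l ?m)"
            using l(2) by simp
          also have "\<dots> = min (d s ?x') (d s ?y')"
            using l(2)[rule_format, OF jl(1)] l(2)[rule_format, OF jl(2)]
            by (simp only: min_add_distrib_right)
          finally show ?thesis .
        qed
        then show "min (d s ?x) (d s ?y) = min (d s ?x') (d s ?y')" using dxy[OF s] by simp
      qed
    qed
  qed
qed

end

section \<open>Undistinguished pairs\<close>

text \<open>Each arc between the indices 0 and \<open>j\<close> has one equation,
  \<open>l + a = (j - l) + b\<close> or \<open>(g - l) + a = (l - j) + b\<close>. The bounds on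
  \<open>a\<close> exclude an \<open>l\<close> whose shortest way to one of the two indices passes
  the other, since its distances to them would differ by \<open>cdist g 0 j\<close>.\<close>

lemma cdist_balanced_vertices:
  assumes "j < g" "l < g" "b \<le> a" "a < b + cdist g 0 j"
    and "cdist g l 0 + a = cdist g l j + b"
  shows "(l < j \<and> 2 * l + a = j + b) \<or> (j < l \<and> 2 * l + b = g + j + a)"
proof (cases "l < j")
  case True
  obtain r where r: "j = l + r" using True less_imp_add_positive by blast
  obtain t where t: "g = j + t" using assms(1) less_imp_add_positive by blast
  have "cdist g l 0 = min l (r + t)" "cdist g l j = min r (l + t)" "cdist g 0 j = min (l + r) t"
    by (auto simp: cdist_def r t)
  then have "l + a = r + b" using assms(3-5) by (auto simp: min_def split: if_splits)
  then show ?thesis using True r by simp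
next
  case False
  obtain r where r: "l = j + r" using False le_Suc_ex not_less by blast
  obtain t where t: "g = l + t" using assms(2) less_imp_add_positive by blast
  have "cdist g l 0 = min (j + r) t" "cdist g l j = min r (t + j)" "cdist g 0 j = min j (r + t)"
    by (auto simp: cdist_def r t)
  then have "r + b = t + a \<and> 0 < r" using assms(2-5) t by (auto simp: min_def split: if_splits)
  then show ?thesis using r t by simp
qed

text \<open>As in \<open>cdist_balanced_vertices\<close>, with \<open>b = 0\<close> and the edge
  from \<open>j\<close> to \<open>j + 1\<close> in place of a vertex; its near end is
  \<open>j\<close> on one arc and \<open>j + 1\<close> on the other.\<close>

lemma cdist_balanced_vertex_edge:
  assumes "Suc j < g" "l < g" "a < min (cdist g 0 j) (cdist g 0 (Suc j))"
    and "cdist g l 0 + a = min (cdist g l j) (cdist g l (Suc j))"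
  shows "(l \<le> j \<and> 2 * l + a = j) \<or> (j < l \<and> 2 * l = g + j + a + 1)"
proof (cases "l \<le> j")
  case True
  obtain r where r: "j = l + r" using True le_Suc_ex by blast
  obtain t where t: "g = Suc j + t" "0 < t" using assms(1) less_imp_add_positive by blast
  have "cdist g l 0 = min l (r + Suc t)" "cdist g l j = min r (l + Suc t)"
    "cdist g l (Suc j) = min (Suc r) (l + t)" "cdist g 0 j = min (l + r) (Suc t)"
    "cdist g 0 (Suc j) = min (Suc (l + r)) t"
    by (auto simp: cdist_def r t)
  then have "l + a = r" using assms(3,4) by (auto simp: min_def split: if_splits)
  then show ?thesis using True r by simp
next
  case False
  then have "Suc j \<le> l" by simp
  then obtain r where r: "l = Suc j + r" using le_Suc_ex by blast
  obtain t where t: "g = l + t" "0 < t" using assms(2) less_imp_add_positive by blast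
  have "cdist g l 0 = min (Suc (j + r)) t" "cdist g l j = min (Suc r) (t + j)"
    "cdist g l (Suc j) = min r (t + Suc j)" "cdist g 0 j = min j (Suc (r + t))"
    "cdist g 0 (Suc j) = min (Suc j) (r + t)"
    by (auto simp: cdist_def r t)
  then have "r = t + a" using assms(3,4) by (auto simp: min_def split: if_splits)
  then show ?thesis using r t by simp
qed

text \<open>The closing edge and the edge from \<open>j\<close> to \<open>j + 1\<close> leave two
  arcs, with the equations \<open>l = j - l\<close> and
  \<open>g - 1 - l = l - (j + 1)\<close>.\<close>

lemma cdist_balanced_edges:
  assumes "Suc j < g" "l < g"
    and "min (cdist g l 0) (cdist g l (g - 1)) = min (cdist g l j) (cdist g l (Suc j))"
  shows "2 * l = j \<or> 2 * l = g + j"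
proof (cases "l \<le> j")
  case True
  obtain r where r: "j = l + r" using True le_Suc_ex by blast
  obtain t where t: "g = Suc j + t" "0 < t" using assms(1) less_imp_add_positive by blast
  have "cdist g l 0 = min l (r + Suc t)" "cdist g l j = min r (l + Suc t)"
    "cdist g l (Suc j) = min (Suc r) (l + t)" "cdist g l (g - 1) = min (r + t) (Suc l)"
    by (auto simp: cdist_def r t)
  then have "l = r" using assms(3) t by (auto simp: min_def split: if_splits)
  then show ?thesis using r by simp
next
  case False
  then have "Suc j \<le> l" by simp
  then obtain r where r: "l = Suc j + r" using le_Suc_ex by blast
  obtain t where t: "g = Suc (l + t)" using assms(2) less_imp_Suc_add by blast
  have "cdist g l 0 = min l (Suc t)" "cdist g l j = min (Suc r) (Suc t + j)"
    "cdist g l (Suc j) = min r (t + 2 + j)" "cdist g l (g - 1) = min t (Suc l)"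
    by (auto simp: cdist_def r t)
  then have "r = t" using assms(3) r by (auto simp: min_def split: if_splits)
  then show ?thesis using r t by simp
qed

context cactus_landmarks
begin

section \<open>Heights over inactive vertices and steps towards an item\<close>

lemma inactive_vertex:
  assumes C: "C \<in> cycles E" and p: "p \<in> \<Union>C" and inact: "\<not> active E S C p"
    and x: "x \<in> T C p" "x \<noteq> p"
  obtains us i where "free_thread E S p us" "i < length us" "x = us ! i" "d p x = length us - i"
proof -
  have "T C p \<inter> S = {}" using inact p unfolding active_def by blast
  then obtain us where us: "free_thread E S p us" "T C p = insert p (set us)"
    using inactive_component[OF C p] x by blast
  obtain i where i: "i < length us" "x = us ! i" using x us(2) by (auto simp: in_set_conv_nth)
  have pp: "pendant_path p us" using us(1) by (simp add: free_thread_def thread_pendant_path)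
  then have "d p x = length us - i"
    using d_pendant_path[OF pp i(1), of p] i cycle_in_V[OF C p] by (simp add: pendant_path_def)
  then show ?thesis using that us i by blast
qed

text \<open>The ends of the edge have different heights on the thread at \<open>p\<close>, or one of
  them is \<open>p\<close> itself, so the lower height is less than the length of the thread. The
  strictness yields the extra 1 in configuration E.\<close>

lemma inactive_edge:
  assumes C: "C \<in> cycles E" and p: "p \<in> \<Union>C" and inact: "\<not> active E S C p"
    and xy: "{x, y} \<in> E" "x \<in> T C p" "y \<in> T C p"
  obtains us where "free_thread E S p us" "min (d p x) (d p y) < length us"
proof -
  have ne: "x \<noteq> y" using edge_neq[OF xy(1)] .
  have "\<exists>us. free_thread E S p us \<and> min (d p x) (d p y) < length us"
  proof (cases "x = p \<or> y = p")
    case True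
    then have zero: "min (d p x) (d p y) = 0" by auto
    have "\<exists>z. z \<in> T C p \<and> z \<noteq> p" using True ne xy by metis
    then obtain us i where us: "free_thread E S p us" "i < length us"
      using inactive_vertex[OF C p inact] by metis
    then have "min (d p x) (d p y) < length us" using zero by linarith
    then show ?thesis using us(1) by blast
  next
    case False
    obtain us i where us: "free_thread E S p us" "i < length us" "x = us ! i" "d p x = length us - i"
      using inactive_vertex[OF C p inact xy(2)] False by metis
    obtain us' j where us': "free_thread E S p us'" "j < length us'" "y = us' ! j" "d p y = length us' - j"
      using inactive_vertex[OF C p inact xy(3)] False by metis
    have "us' = us" using free_thread_unique us(1) us'(1) by blast
    then have "i \<noteq> j" using us(3) us'(3) ne by auto
    moreover have "d p y = length us - j" "j < length us" using us' \<open>us' = us\<close> by simp_all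
    ultimately have "min (d p x) (d p y) < length us"
      using us(2,4) by (auto simp: min_def)
    then show ?thesis using us(1) by blast
  qed
  then show ?thesis using that by blast
qed

text \<open>If all landmarks see the item as if through \<open>m\<close>, a step from
  \<open>m\<close> towards it leads away from each of them: otherwise a landmark \<open>s\<close>
  would reach the item in fewer than \<open>d s m + c\<close> steps. For \<open>c = 0\<close> the
  item is an edge at \<open>m\<close>, and its other end is outward for \<epsilon> = 0.\<close>

lemma toward_outward:
  assumes V: "m \<in> V" "x \<in> V" "y \<in> V" and c: "c = min (d m x) (d m y)"
    and eq: "\<And>s. s \<in> S \<Longrightarrow> min (d s x) (d s y) = d s m + c"
    and pos: "0 < c \<or> \<epsilon> = 0 \<and> {x, y} \<in> E" and eps: "\<epsilon> \<le> 1"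
  obtains n where "outward \<epsilon> m n"
    "min (d n x) (d n y) + 1 = c \<or> c = 0 \<and> n \<in> {x, y} \<and> n \<noteq> m"
proof (cases "0 < c")
  case True
  have near: "\<exists>n. outward \<epsilon> m n \<and> min (d n x) (d n y) + 1 = c"
    if xy: "x \<in> V" "y \<in> V" "c = d m x" "c \<le> d m y"
      "\<And>s. s \<in> S \<Longrightarrow> min (d s x) (d s y) = d s m + c" for x y
  proof -
    have "m \<noteq> x" using True xy(3) by auto
    then obtain n where n: "{m, n} \<in> E" "d m x = d n x + 1" using d_next[OF V(1) xy(1)] by blast
    have nV: "n \<in> V" using edge_in_V[OF n(1)] by simp
    have "d s m + \<epsilon> \<le> d s n" if s: "s \<in> S" for s
    proof -
      have "d s m + c \<le> d s x" using xy(5)[OF s] by simp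
      moreover have "d s x \<le> d s n + d n x" using d_triangle nV xy(1) S_sub s by blast
      ultimately show ?thesis using n(2) xy(3) eps by linarith
    qed
    then have "outward \<epsilon> m n" using n(1) by (simp add: outward_def)
    moreover have "d m y \<le> d m n + d n y" using d_triangle[OF V(1) nV xy(2)] .
    then have "min (d n x) (d n y) + 1 = c" using n xy(3,4) d_edge[OF n(1)] by auto
    ultimately show ?thesis by blast
  qed
  have "\<exists>n. outward \<epsilon> m n \<and> min (d n x) (d n y) + 1 = c"
  proof (cases "d m x \<le> d m y")
    case True
    then show ?thesis using near[OF V(2,3)] c eq by simp
  next
    case False
    then have "\<exists>n. outward \<epsilon> m n \<and> min (d n y) (d n x) + 1 = c"
      using near[OF V(3,2)] c eq by (simp add: min.commute)
    then show ?thesis by (simp add: min.commute)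
  qed
  then show ?thesis using that by blast
next
  case False
  then have c0: "c = 0" and eps0: "\<epsilon> = 0" and e: "{x, y} \<in> E" using pos by auto
  have "m = x \<or> m = y" using c c0 d_eq_0_iff[OF V(1,2)] d_eq_0_iff[OF V(1,3)] by (auto simp: min_def split: if_splits)
  then obtain n where n: "{m, n} \<in> E" "n \<in> {x, y}" "n \<noteq> m"
    using e edge_neq[OF e] by (auto simp: insert_commute)
  have "outward \<epsilon> m n" unfolding outward_def
  proof (intro conjI ballI)
    fix s assume "s \<in> S"
    then have "min (d s x) (d s y) = d s m" using eq c0 by simp
    then show "d s m + \<epsilon> \<le> d s n" using n(2) eps0 by auto
  qed (rule n(1))
  then show ?thesis using that n c0 by blast
qed

lemma outward_mono: "outward \<epsilon> m n \<Longrightarrow> \<epsilon>' \<le> \<epsilon> \<Longrightarrow> outward \<epsilon>' m n"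
  by (force simp: outward_def)

lemma two_outward_mono: "two_outward \<epsilon> \<Longrightarrow> \<epsilon>' \<le> \<epsilon> \<Longrightarrow> two_outward \<epsilon>'"
  unfolding two_outward_def using outward_mono by blast

text \<open>If the active indices are at least half the cycle apart, the labeling started at
  \<open>l2\<close> meets \<open>l1\<close> after \<open>length vs - l2 + l1\<close> steps, at most
  half the cycle.\<close>

lemma two_act_rotate:
  assumes C: "C \<in> cycles E" and vs: "labeling C vs" and l: "l1 < l2" "l2 < length vs"
    and only: "\<And>l. l < length vs \<Longrightarrow> active E S C (vs ! l) \<Longrightarrow> l = l1 \<or> l = l2"
    and far: "length vs \<le> 2 * (l2 - l1)"
  obtains ws where "two_act C ws (length vs - l2 + l1)" "length ws = length vs"
    "\<And>j. j < length vs \<Longrightarrow> ws ! j = vs ! (rotated (length vs) l2 j)"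
proof -
  let ?g = "length vs"
  obtain ws where ws: "labeling C ws" "length ws = ?g"
    "\<And>j. j < ?g \<Longrightarrow> ws ! j = vs ! (rotated ?g l2 j)"
    using labeling_rotate[OF vs l(2)] by metis
  obtain u v where uv: "u \<noteq> v" "active E S C u" "active E S C v" using two_active[OF C] .
  obtain a where a: "a < ?g" "vs ! a = u" using active_index[OF vs uv(2)] .
  obtain b where b: "b < ?g" "vs ! b = v" using active_index[OF vs uv(3)] .
  have "a = l1 \<or> a = l2" "b = l1 \<or> b = l2" using only a b uv by auto
  then have "active E S C (vs ! l2)" using a b uv by auto
  moreover have "ws ! 0 = vs ! l2" using ws(3)[of 0] l(2) labeling_ne[OF vs] by simp
  ultimately have act0: "active E S C (ws ! 0)" by simp
  have "two_act C ws (?g - l2 + l1)" unfolding two_act_def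
  proof (intro conjI allI impI)
    obtain r t where "l2 = l1 + r" "?g = l2 + t" using l less_imp_add_positive by metis
    then show "2 * (?g - l2 + l1) \<le> length ws" using far ws(2) by simp
    fix j assume j: "j < length ws" "active E S C (ws ! j)"
    let ?m = "rotated ?g l2 j"
    have "?m < ?g" using j l ws(2) by auto
    then have "?m = l1 \<or> ?m = l2" using only[of ?m] j ws(2) ws(3)[of j] by simp
    then show "j = 0 \<or> j = ?g - l2 + l1" using j(1) l ws(2) by (auto split: if_splits)
  qed (use ws(1) act0 in auto)
  then show ?thesis using that ws by blast
qed

text \<open>Biactivity gives two active indices, and \<open>P\<close> and \<open>Q\<close> admit one
  each. This is how an equation with one solution on each arc leaves room for just two active
  vertices.\<close>

lemma active_pair:
  assumes C: "C \<in> cycles E" and vs: "labeling C vs"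
    and cases: "\<And>l. l < length vs \<Longrightarrow> active E S C (vs ! l) \<Longrightarrow> P l \<or> Q l"
    and P: "\<And>l l'. P l \<Longrightarrow> P l' \<Longrightarrow> l = l'" and Q: "\<And>l l'. Q l \<Longrightarrow> Q l' \<Longrightarrow> l = l'"
  obtains l1 l2 where "l1 < length vs" "l2 < length vs" "P l1" "Q l2"
    "\<And>l. l < length vs \<Longrightarrow> active E S C (vs ! l) \<Longrightarrow> l = l1 \<or> l = l2"
proof -
  obtain u v where uv: "u \<noteq> v" "active E S C u" "active E S C v" using two_active[OF C] .
  obtain a where a: "a < length vs" "vs ! a = u" using active_index[OF vs uv(2)] .
  obtain b where b: "b < length vs" "vs ! b = v" using active_index[OF vs uv(3)] .
  have ab: "a \<noteq> b" "P a \<or> Q a" "P b \<or> Q b" using a b uv cases by auto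
  have "\<exists>l1 l2. l1 < length vs \<and> l2 < length vs \<and> P l1 \<and> Q l2"
    using ab a(1) b(1) P Q by blast
  then obtain l1 l2 where l: "l1 < length vs" "l2 < length vs" "P l1" "Q l2" by blast
  show ?thesis
  proof (rule that[OF l])
    fix l assume "l < length vs" "active E S C (vs ! l)"
    then have "P l \<or> Q l" by (rule cases)
    then show "l = l1 \<or> l = l2" using P Q l by blast
  qed
qed

text \<open>With \<open>p\<close> at index 0 and \<open>q\<close> at \<open>j\<close>, the active
  indices are \<open>(j + b - a)/2\<close> and \<open>(g + j + a - b)/2\<close>. Started at the
  second, the labeling has \<open>k = g/2 - (a - b)\<close>, and \<open>p\<close> and
  \<open>q\<close> move to \<open>i\<close> and \<open>g/2 + k - i\<close>, the positions named in
  configuration E.\<close>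

lemma balanced_vertices:
  assumes C: "C \<in> cycles E" and pq: "p \<in> \<Union>C" "q \<in> \<Union>C"
    and ab: "b \<le> a" "a < b + d p q"
    and bal: "\<And>u. active E S C u \<Longrightarrow> d u p + a = d u q + b"
  obtains ws k i where "two_act C ws k" "i \<le> k" "2 * (k + a - b) = length ws" "ws ! i = p"
    "length ws div 2 + k - i < length ws" "ws ! (length ws div 2 + k - i) = q"
proof -
  obtain vs where vs: "labeling C vs" "vs ! 0 = p" using labeling_from[OF C pq(1)] .
  let ?g = "length vs"
  have g3: "3 \<le> ?g" using vs by (simp add: labeling_def)
  then have g0: "0 < ?g" by linarith
  obtain j where j: "j < ?g" "vs ! j = q" using pq(2) labeling_set[OF vs(1)] by (auto simp: in_set_conv_nth)
  have D: "d p q = cdist ?g 0 j" using d_labeling[OF C vs(1) g0 j(1)] vs(2) j(2) by simp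
  have key: "(l < j \<and> 2 * l + a = j + b) \<or> (j < l \<and> 2 * l + b = ?g + j + a)"
    if l: "l < ?g" "active E S C (vs ! l)" for l
  proof (rule cdist_balanced_vertices[OF j(1) l(1) ab(1)])
    show "a < b + cdist ?g 0 j" using ab(2) D by simp
    show "cdist ?g l 0 + a = cdist ?g l j + b"
      using bal[OF l(2)] d_labeling[OF C vs(1) l(1) g0] d_labeling[OF C vs(1) l(1) j(1)] vs(2) j(2) by simp
  qed
  obtain l1 l2 where l: "l1 < ?g" "l2 < ?g" "l1 < j \<and> 2 * l1 + a = j + b" "j < l2 \<and> 2 * l2 + b = ?g + j + a"
    and only: "\<And>l. l < ?g \<Longrightarrow> active E S C (vs ! l) \<Longrightarrow> l = l1 \<or> l = l2"
    by (rule active_pair[OF C vs(1) key]) auto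
  have l12: "l1 < l2" "?g \<le> 2 * (l2 - l1)" using l ab(1) by auto
  obtain ws where ws: "two_act C ws (?g - l2 + l1)" "length ws = ?g"
    "\<And>j. j < ?g \<Longrightarrow> ws ! j = vs ! (rotated ?g l2 j)"
    using two_act_rotate[OF C vs(1) l12(1) l(2) only l12(2)] by metis
  let ?k = "?g - l2 + l1" and ?i = "?g - l2"
  have "2 * (?k + a - b) = ?g" using l by auto
  then have half: "?g div 2 = ?k + a - b" by linarith
  have idx: "?g div 2 + ?k - ?i = ?i + j" unfolding half using l by auto
  have "ws ! ?i = p" using ws(3)[of ?i] l(2,4) vs(2) by auto
  moreover have "?i + j < ?g" using l by auto
  moreover have "ws ! (?i + j) = q" using ws(3)[of "?i + j"] l(2,4) j(2) by auto
  moreover have "?i \<le> ?k" by simp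
  ultimately show ?thesis
    using that[OF ws(1), of ?i] \<open>2 * (?k + a - b) = ?g\<close> idx ws(2) by simp
qed

text \<open>Here the active indices are \<open>(j - a)/2\<close> and
  \<open>(g + j + a + 1)/2\<close>, both integral only for odd \<open>g\<close>.\<close>

lemma balanced_vertex_edge:
  assumes C: "C \<in> cycles E" and p: "p \<in> \<Union>C" and q: "{q, q'} \<in> C"
    and a: "a < min (d p q) (d p q')"
    and bal: "\<And>u. active E S C u \<Longrightarrow> d u p + a = min (d u q) (d u q')"
  obtains ws k i where "two_act C ws k" "i \<le> k" "2 * (k + a) + 1 = length ws" "ws ! i = p"
proof -
  obtain vs where vs: "labeling C vs" "vs ! 0 = p" using labeling_from[OF C p] .
  let ?g = "length vs"
  have g3: "3 \<le> ?g" using vs by (simp add: labeling_def)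
  then have g0: "0 < ?g" by linarith
  have "p \<noteq> q" "p \<noteq> q'" using a by auto
  \<comment> \<open>The edge is not the closing one, because \<open>p = vs ! 0\<close> is not among
    its ends.\<close>
  have "\<exists>j. Suc j < ?g \<and> {q, q'} = {vs ! j, vs ! Suc j}"
  proof (cases rule: labeling_edgeE[OF vs(1) q])
    case 2
    then have "p = q \<or> p = q'" using vs(2) by (auto simp: doubleton_eq_iff)
    then show ?thesis using \<open>p \<noteq> q\<close> \<open>p \<noteq> q'\<close> by simp
  qed blast
  then obtain j where j: "Suc j < ?g" "{q, q'} = {vs ! j, vs ! Suc j}" by blast
  have minq: "min (d u q) (d u q') = min (d u (vs ! j)) (d u (vs ! Suc j))" for u
    using j(2) by (auto simp: doubleton_eq_iff min.commute)
  have jl: "j < ?g" using j by simp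
  have key: "(l \<le> j \<and> 2 * l + a = j) \<or> (j < l \<and> 2 * l = ?g + j + a + 1)"
    if l: "l < ?g" "active E S C (vs ! l)" for l
  proof (rule cdist_balanced_vertex_edge[OF j(1) l(1)])
    show "a < min (cdist ?g 0 j) (cdist ?g 0 (Suc j))"
      using a minq[of p] d_labeling[OF C vs(1) g0 jl] d_labeling[OF C vs(1) g0 j(1)] vs(2) by simp
    show "cdist ?g l 0 + a = min (cdist ?g l j) (cdist ?g l (Suc j))"
      using bal[OF l(2)] minq[of "vs ! l"] d_labeling[OF C vs(1) l(1) g0] d_labeling[OF C vs(1) l(1) jl]
        d_labeling[OF C vs(1) l(1) j(1)] vs(2) by simp
  qed
  obtain l1 l2 where l: "l1 < ?g" "l2 < ?g" "l1 \<le> j \<and> 2 * l1 + a = j" "j < l2 \<and> 2 * l2 = ?g + j + a + 1"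
    and only: "\<And>l. l < ?g \<Longrightarrow> active E S C (vs ! l) \<Longrightarrow> l = l1 \<or> l = l2"
    by (rule active_pair[OF C vs(1) key]) auto
  have l12: "l1 < l2" "?g \<le> 2 * (l2 - l1)" using l by auto
  obtain ws where ws: "two_act C ws (?g - l2 + l1)" "length ws = ?g"
    "\<And>j. j < ?g \<Longrightarrow> ws ! j = vs ! (rotated ?g l2 j)"
    using two_act_rotate[OF C vs(1) l12(1) l(2) only l12(2)] by metis
  let ?k = "?g - l2 + l1" and ?i = "?g - l2"
  have "2 * (?k + a) + 1 = ?g" using l by auto
  moreover have "ws ! ?i = p" using ws(3)[of ?i] l(2,4) vs(2) by auto
  moreover have "?i \<le> ?k" by simp
  ultimately show ?thesis using that[OF ws(1), of ?i] ws(2) by simp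
qed

text \<open>With \<open>{x, y}\<close> as closing edge, the only possible active indices are
  \<open>j/2\<close> and \<open>(g + j)/2\<close>, which are antipodal.\<close>

lemma balanced_edges:
  assumes C: "C \<in> cycles E" and e: "{x, y} \<in> C" "{x', y'} \<in> C" "{x, y} \<noteq> {x', y'}"
    and bal: "\<And>u. active E S C u \<Longrightarrow> min (d u x) (d u y) = min (d u x') (d u y')"
  shows "config_A E S C"
proof -
  obtain vs where vs: "labeling C vs" "vs ! 0 = x" "vs ! (length vs - 1) = y"
    using nbr_labeling[OF C e(1)] .
  let ?g = "length vs"
  have g3: "3 \<le> ?g" using vs by (simp add: labeling_def)
  then have g0: "0 < ?g" "?g - 1 < ?g" by linarith+
  have "\<exists>j. Suc j < ?g \<and> {x', y'} = {vs ! j, vs ! Suc j}"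
  proof (cases rule: labeling_edgeE[OF vs(1) e(2)])
    case 2
    then show ?thesis using vs e(3) by (simp add: insert_commute)
  qed blast
  then obtain j where j: "Suc j < ?g" "{x', y'} = {vs ! j, vs ! Suc j}" by blast
  have minq: "min (d u x') (d u y') = min (d u (vs ! j)) (d u (vs ! Suc j))" for u
    using j(2) by (auto simp: doubleton_eq_iff min.commute)
  have jl: "j < ?g" using j by simp
  have key: "2 * l = j \<or> 2 * l = ?g + j" if l: "l < ?g" "active E S C (vs ! l)" for l
  proof (rule cdist_balanced_edges[OF j(1) l(1)])
    show "min (cdist ?g l 0) (cdist ?g l (?g - 1)) = min (cdist ?g l j) (cdist ?g l (Suc j))"
      using bal[OF l(2)] minq[of "vs ! l"] d_labeling[OF C vs(1) l(1) g0(1)] d_labeling[OF C vs(1) l(1) g0(2)]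
        d_labeling[OF C vs(1) l(1) jl] d_labeling[OF C vs(1) l(1) j(1)] vs(2,3) by simp
  qed
  obtain l1 l2 where l: "l1 < ?g" "l2 < ?g" "2 * l1 = j" "2 * l2 = ?g + j"
    and only: "\<And>l. l < ?g \<Longrightarrow> active E S C (vs ! l) \<Longrightarrow> l = l1 \<or> l = l2"
    by (rule active_pair[OF C vs(1) key]) auto
  have l12: "l1 < l2" "?g \<le> 2 * (l2 - l1)" using l j(1) by auto
  obtain ws where ws: "two_act C ws (?g - l2 + l1)" "length ws = ?g"
    using two_act_rotate[OF C vs(1) l12(1) l(2) only l12(2)] by metis
  moreover have "2 * (?g - l2 + l1) = ?g" using l j(1) by auto
  ultimately show ?thesis using config_A_iff[OF C] by metis
qed

section \<open>Items separated by a cycle\<close>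

lemma d_item_far:
  assumes "C \<in> cycles E" "p \<in> \<Union>C" "x \<in> T C p" "y \<in> T C p" "s \<in> T C u" "u \<in> \<Union>C" "u \<noteq> p"
  shows "min (d s x) (d s y) = d s u + d u p + min (d p x) (d p y)"
  using d_T_far[OF assms(1,6,2,7,5,3)] d_T_far[OF assms(1,6,2,7,5,4)] by simp

lemma d_item_le:
  assumes "s \<in> V" "p \<in> V" "x \<in> V" "y \<in> V"
  shows "min (d s x) (d s y) \<le> d s p + min (d p x) (d p y)"
  using d_triangle[OF assms(1-3)] d_triangle[OF assms(1,2,4)] by auto

text \<open>From outside \<open>T C p\<close> the item is reached through \<open>p\<close>, hence no
  sooner than from \<open>p\<close>. This tells the two outward neighbours found at \<open>p\<close>
  apart.\<close>

lemma toward_item_inside: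
  assumes C: "C \<in> cycles E" and p: "p \<in> \<Union>C" and xy: "x \<in> T C p" "y \<in> T C p" and n: "n \<in> V"
    and toward: "min (d n x) (d n y) < min (d p x) (d p y)"
  shows "n \<in> T C p"
proof (rule ccontr)
  assume "n \<notin> T C p"
  then have "d n x = d n p + d p x" "d n y = d n p + d p y" using d_T_gate[OF C p n] xy by blast+
  then show False using toward by linarith
qed

text \<open>Taking \<open>x = y\<close> or \<open>{x, y} \<in> E\<close> covers vertices and edges at the same time.\<close>

lemma separated_items:
  assumes C: "C \<in> cycles E" and pq: "p \<in> \<Union>C" "q \<in> \<Union>C" "p \<noteq> q"
    and xy: "x \<in> T C p" "y \<in> T C p" and xy': "x' \<in> T C q" "y' \<in> T C q"
    and eq: "\<And>s. s \<in> S \<Longrightarrow> min (d s x) (d s y) = min (d s x') (d s y')"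
    and a: "a = min (d p x) (d p y)" and b: "b = min (d q x') (d q y')" and ba: "b \<le> a"
  shows "two_outward 1 \<or> (\<not> active E S C p \<and> \<not> active E S C q \<and> a < b + d p q \<and>
    (\<forall>u. active E S C u \<longrightarrow> d u p + a = d u q + b))"
proof -
  have V: "p \<in> V" "q \<in> V" "x \<in> V" "y \<in> V" "x' \<in> V" "y' \<in> V"
    using cycle_in_V[OF C] T_in_V[OF C] pq xy xy' by blast+
  note far = d_item_far[OF C pq(1) xy, folded a] and far' = d_item_far[OF C pq(2) xy', folded b]
  have near: "min (d s x) (d s y) \<le> d s p + a" and near': "min (d s x') (d s y') \<le> d s q + b"
    if "s \<in> S" for s
    using d_item_le[of s p x y] d_item_le[of s q x' y'] that S_sub V a b by auto
  have D: "0 < d p q" using d_eq_0_iff[OF V(1,2)] pq(3) by auto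
  \<comment> \<open>A landmark in \<open>T C p\<close> is at distance exactly
    \<open>d s p + d p q + b\<close> from the second item and at most \<open>d s p + a\<close> from
    the first.\<close>
  have act_p: "b + d p q \<le> a" if act: "active E S C p"
  proof -
    obtain s where s: "s \<in> T C p" "s \<in> S" using act by (auto simp: active_def)
    show ?thesis using far'[OF s(1) pq(1,3)] near[OF s(2)] eq[OF s(2)] by simp
  qed
  have inact_q: "\<not> active E S C q"
  proof
    assume "active E S C q"
    then obtain s where s: "s \<in> T C q" "s \<in> S" by (auto simp: active_def)
    have "a + d q p \<le> b" using far[OF s(1) pq(2)] pq(3) near'[OF s(2)] eq[OF s(2)] by simp
    then show False using D ba by (simp add: gdist_commute)
  qed
  have bal: "d u p + a = d u q + b" if u: "active E S C u" "u \<noteq> p" for u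
  proof -
    obtain s where s: "s \<in> T C u" "s \<in> S" "u \<in> \<Union>C" using u(1) by (auto simp: active_def)
    have "u \<noteq> q" using u(1) inact_q by blast
    then show ?thesis using far[OF s(1,3) u(2)] far'[OF s(1,3)] eq[OF s(2)] by simp
  qed
  show ?thesis
  proof (cases "a < b + d p q")
    case True
    then have "\<not> active E S C p" using act_p by linarith
    then show ?thesis using True inact_q bal by metis
  next
    \<comment> \<open>The triangle inequality forces \<open>a = b + d p q\<close>. Then both items
      are at distance \<open>d s p + a\<close> from every landmark, and the first steps from
      \<open>p\<close> towards them are outward, one inside \<open>T C p\<close> and one
      outside.\<close>
    case False
    obtain u v where "u \<noteq> v" "active E S C u" "active E S C v" using two_active[OF C] .
    then obtain u where u: "active E S C u" "u \<noteq> p" by metis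
    have "u \<in> V" using u(1) cycle_in_V[OF C] unfolding active_def by blast
    then have "d u q \<le> d u p + d p q" using d_triangle V by blast
    then have a_eq: "a = b + d p q" using bal[OF u] False by linarith
    have eq_x: "min (d s x) (d s y) = d s p + a" if s: "s \<in> S" for s
    proof -
      obtain u where u: "active E S C u" "u \<in> \<Union>C" "s \<in> T C u" using active_cover[OF C s] .
      show ?thesis
      proof (cases "u = p")
        case True
        then show ?thesis using far'[OF u(3,2)] pq(3) eq[OF s] a_eq by simp
      next
        case False
        then show ?thesis using far[OF u(3,2)] d_to_cycle[OF C u(2) pq(1) u(3)] by simp
      qed
    qed
    have eq_x': "min (d s x') (d s y') = d s p + a" if "s \<in> S" for s using eq_x eq that by simp
    have pT: "p \<in> T C p" by simp
    have c': "a = min (d p x') (d p y')" using far'[OF pT pq(1,3)] a_eq by simp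
    have a0: "0 < a" using a_eq D by simp
    obtain n1 where n1: "outward 1 p n1" "min (d n1 x) (d n1 y) + 1 = a"
      by (rule toward_outward[OF V(1,3,4) a eq_x, of 1]) (use a0 in auto)
    obtain n2 where n2: "outward 1 p n2" "min (d n2 x') (d n2 y') + 1 = a"
      by (rule toward_outward[OF V(1,5,6) c' eq_x', of 1]) (use a0 in auto)
    have nV: "n1 \<in> V" "n2 \<in> V" using n1(1) n2(1) edge_in_V by (auto simp: outward_def)
    have "n1 \<in> T C p" by (rule toward_item_inside[OF C pq(1) xy nV(1)]) (use n1(2) a in linarith)
    moreover have "n2 \<notin> T C p"
    proof
      assume n: "n2 \<in> T C p"
      show False using far'[OF n pq(1,3)] n2(2) a_eq by simp
    qed
    ultimately have "n1 \<noteq> n2" by auto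
    then show ?thesis using n1(1) n2(1) by (auto simp: two_outward_def)
  qed
qed

text \<open>Without landmarks every neighbour is outward, so all degrees are at most 1 and the
  connected graph has one or two vertices, hence is a path.\<close>

lemma S_nonempty:
  assumes nopath: "\<not> path_graph V E" and no: "\<not> two_outward 1"
  shows "S \<noteq> {}"
proof
  assume S: "S = {}"
  have "outward 1 m n" if "{m, n} \<in> E" for m n using that S unfolding outward_def by blast
  then have one: "n1 = n2" if "{m, n1} \<in> E" "{m, n2} \<in> E" for m n1 n2
    using no that unfolding two_outward_def by blast
  obtain v where v: "v \<in> V" using cactus by (auto simp: cactus_def connected_graph_def)
  have conn: "w \<in> A" if "v \<in> A" "\<And>x y. x \<in> A \<Longrightarrow> {x, y} \<in> E \<Longrightarrow> y \<in> A" "w \<in> V" for A w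
    using component_closed[OF connected[OF v that(3)] that(1,2)] .
  show False
  proof (cases "\<exists>w. {v, w} \<in> E")
    case False
    have V: "w = v" if "w \<in> V" for w using conn[of "{v}" w] False that by auto
    have "E = {}"
    proof (rule equals0I)
      fix e assume e: "e \<in> E"
      then obtain x y where "e = {x, y}" using edgeE by metis
      then show False using e V edge_in_V[of x y] False by metis
    qed
    moreover have "V = {v}" using V v by blast
    ultimately have "path_graph V E" unfolding path_graph_def by (intro exI[of _ "[v]"]) simp
    then show False using nopath by simp
  next
    case True
    then obtain w where w: "{v, w} \<in> E" by blast
    have wv: "{w, v} \<in> E" using w by (simp add: insert_commute)
    have V: "u = v \<or> u = w" if "u \<in> V" for u
      using conn[of "{v, w}" u] one[OF w] one[OF wv] that by blast
    have "E = {{v, w}}"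
    proof (intro equalityI subsetI)
      fix e assume e: "e \<in> E"
      then obtain x y where "e = {x, y}" "x \<noteq> y" using edgeE by metis
      then have "e = {v, w}" using e V edge_in_V[of x y] by (metis insert_commute)
      then show "e \<in> {{v, w}}" by simp
    qed (use w in simp)
    moreover have "V = {v, w}" using V v edge_in_V[OF w] by blast
    moreover have "v \<noteq> w" using edge_neq[OF w] .
    ultimately have "path_graph V E" unfolding path_graph_def by (intro exI[of _ "[v, w]"]) auto
    then show False using nopath by simp
  qed
qed

section \<open>Geodesics and pairs that no cycle separates\<close>

lemma geodesic:
  assumes "x \<in> V" "x' \<in> V"
  obtains f where "f 0 = x" "f (d x x') = x'"
    "\<And>i. i < d x x' \<Longrightarrow> {f i, f (Suc i)} \<in> E"
    "\<And>i j. i \<le> j \<Longrightarrow> j \<le> d x x' \<Longrightarrow> d (f i) (f j) = j - i"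
    "\<And>i. i \<le> d x x' \<Longrightarrow> f i \<in> V"
proof -
  let ?L = "d x x'"
  obtain f where f: "f 0 = x" "f ?L = x'" "\<And>i. i < ?L \<Longrightarrow> {f i, f (Suc i)} \<in> E"
    using d_attained[OF assms] by (auto simp: relpow_fun_conv adj_def)
  have V: "f i \<in> V" if "i \<le> ?L" for i
  proof (cases "i = ?L")
    case False
    then show ?thesis using f(3)[of i] that edge_in_V by simp
  qed (use f assms in simp)
  have le: "d (f i) (f j) \<le> j - i" if "i \<le> j" "j \<le> ?L" for i j
    using that
  proof (induction j)
    case (Suc j)
    then show ?case
      using d_edge_le[OF f(3)[of j], of "f i"] V[of i] by (cases "i = Suc j") auto
  qed simp
  have "d (f i) (f j) = j - i" if ij: "i \<le> j" "j \<le> ?L" for i j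
  proof -
    have "d x x' \<le> d (f 0) (f i) + d (f i) (f ?L)"
      using d_triangle[of "f 0" "f i" "f ?L"] V f(1,2) ij assms by simp
    also have "d (f i) (f ?L) \<le> d (f i) (f j) + d (f j) (f ?L)"
      using d_triangle[of "f i" "f j" "f ?L"] V ij by simp
    finally have "?L \<le> d (f 0) (f i) + (d (f i) (f j) + d (f j) (f ?L))" by simp
    then show ?thesis using le[of 0 i] le[of j ?L] le[OF ij] ij by linarith
  qed
  then show ?thesis using that f V by blast
qed

text \<open>If \<open>x\<close> and \<open>x'\<close> hung at the same vertex \<open>p\<close>, the
  geodesic would run through \<open>p\<close> to the edge and back through \<open>p\<close>, longer
  than the way that turns at \<open>p\<close>.\<close>

lemma geodesic_cycle_edge:
  assumes C: "C \<in> cycles E" and V: "x \<in> V" "x' \<in> V" and uv: "{u, v} \<in> C"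
    and geo: "d x u + 1 + d v x' = d x x'"
  obtains p q where "p \<in> \<Union>C" "q \<in> \<Union>C" "p \<noteq> q" "x \<in> T C p" "x' \<in> T C q"
proof -
  obtain p where p: "p \<in> \<Union>C" "x \<in> T C p" using T_cover[OF C V(1)] .
  obtain q where q: "q \<in> \<Union>C" "x' \<in> T C q" using T_cover[OF C V(2)] .
  have u: "u \<in> \<Union>C" "v \<in> \<Union>C" and e: "{u, v} \<in> E" using uv C by (auto simp: cycles_def)
  have uV: "u \<in> V" "v \<in> V" using edge_in_V[OF e] by auto
  have pV: "p \<in> V" using cycle_in_V[OF C p(1)] .
  have "p \<noteq> q"
  proof
    assume pq: "p = q"
    have "d x u = d x p + d p u" using d_to_cycle[OF C p(1) u(1) p(2)] .
    moreover have "d x' v = d x' p + d p v" using d_to_cycle[OF C q(1) u(2) q(2)] pq by simp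
    moreover have "d x x' \<le> d x p + d p x'" using d_triangle V pV by blast
    ultimately show False using geo by (simp add: gdist_commute)
  qed
  then show ?thesis using that p q by blast
qed

text \<open>The bridge separates \<open>x\<close> from \<open>x'\<close>. A landmark on the side of
  \<open>v\<close> reaches \<open>x\<close> only across the bridge, so equal distances force the
  part of the geodesic beyond \<open>v\<close> to be the longer one; landmarks are always on the
  side of the longer part.\<close>

lemma bridge_geodesic_sides:
  assumes e: "{u, v} \<in> E" "\<And>C. C \<in> cycles E \<Longrightarrow> {u, v} \<notin> C"
    and V: "x \<in> V" "x' \<in> V" and s: "s \<in> S"
    and geo: "d x u + 1 + d v x' = d x x'" and eq: "d s x = d s x'"
  shows "(d s v = d s u + 1 \<and> d v x' + 1 \<le> d x u) \<or> (d s u = d s v + 1 \<and> d x u + 1 \<le> d v x')"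
proof -
  let ?B = "component (E - {{u, v}}) v"
  have uV: "u \<in> V" "v \<in> V" using edge_in_V[OF e(1)] by auto
  have sV: "s \<in> V" using s S_sub by blast
  have vB: "v \<in> ?B" "u \<notin> ?B" using bridge_separates[OF e] by simp_all
  have x: "x \<notin> ?B"
  proof
    assume "x \<in> ?B"
    then have "d u x = d u u + 1 + d v x" using d_bridge[OF e uV(1) vB(2)] by blast
    moreover have "d x x' \<le> d x v + d v x'" using d_triangle V uV by blast
    ultimately show False using geo by (simp add: gdist_commute)
  qed
  have x': "x' \<in> ?B"
  proof (rule ccontr)
    assume "x' \<notin> ?B"
    then have "d x' v = d x' u + 1 + d v v" using d_bridge[OF e V(2) _ vB(1)] by blast
    moreover have "d x x' \<le> d x u + d u x'" using d_triangle V uV by blast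
    ultimately show False using geo by (simp add: gdist_commute)
  qed
  show ?thesis
  proof (cases "s \<in> ?B")
    case True
    have "d x s = d x u + 1 + d v s" using d_bridge[OF e V(1) x True] .
    moreover have "d u s = d u u + 1 + d v s" using d_bridge[OF e uV(1) vB(2) True] .
    moreover have "d s x' \<le> d s v + d v x'" using d_triangle sV uV V by blast
    ultimately show ?thesis using eq by (simp add: gdist_commute)
  next
    case False
    have "d s x' = d s u + 1 + d v x'" using d_bridge[OF e sV False x'] .
    moreover have "d s v = d s u + 1 + d v v" using d_bridge[OF e sV False vB(1)] .
    moreover have "d s x \<le> d s u + d u x" using d_triangle sV uV V by blast
    ultimately show ?thesis using eq by (simp add: gdist_commute)
  qed
qed

text \<open>If no cycle separates the pair, every edge of a geodesic is a bridge. By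
  \<open>bridge_geodesic_sides\<close> the distance from each landmark falls up to the middle and
  rises after it, so both steps away from the midpoint are outward.\<close>

lemma undistinguished_vertices:
  assumes V: "x \<in> V" "x' \<in> V" "x \<noteq> x'" and eq: "\<And>s. s \<in> S \<Longrightarrow> d s x = d s x'"
    and nopath: "\<not> path_graph V E"
  shows "two_outward 1 \<or>
    (\<exists>C\<in>cycles E. \<exists>p q. p \<in> \<Union>C \<and> q \<in> \<Union>C \<and> p \<noteq> q \<and> x \<in> T C p \<and> x' \<in> T C q)"
proof (rule disjCI)
  assume nosep: "\<not> (\<exists>C\<in>cycles E. \<exists>p q. p \<in> \<Union>C \<and> q \<in> \<Union>C \<and> p \<noteq> q \<and> x \<in> T C p \<and> x' \<in> T C q)"
  show "two_outward 1"
  proof (rule ccontr)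
    assume no: "\<not> two_outward 1"
    obtain s0 where s0: "s0 \<in> S" using S_nonempty[OF nopath no] by blast
    let ?L = "d x x'"
    obtain f where f: "f 0 = x" "f ?L = x'" and edge: "\<And>i. i < ?L \<Longrightarrow> {f i, f (Suc i)} \<in> E"
      and dist: "\<And>i j. i \<le> j \<Longrightarrow> j \<le> ?L \<Longrightarrow> d (f i) (f j) = j - i"
      using geodesic[OF V(1,2)] by metis
    have sides: "(d s (f (Suc i)) = d s (f i) + 1 \<and> ?L \<le> 2 * i) \<or>
        (d s (f i) = d s (f (Suc i)) + 1 \<and> 2 * i + 2 \<le> ?L)"
      if i: "i < ?L" and s: "s \<in> S" for i s
    proof -
      have du: "d x (f i) = i" "d (f (Suc i)) x' = ?L - Suc i"
        using dist[of 0 i] dist[of "Suc i" ?L] f i by simp_all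
      then have geo: "d x (f i) + 1 + d (f (Suc i)) x' = ?L" using i by simp
      have "{f i, f (Suc i)} \<notin> C" if C: "C \<in> cycles E" for C
      proof
        assume "{f i, f (Suc i)} \<in> C"
        then show False using geodesic_cycle_edge[OF C V(1,2) _ geo] nosep C by metis
      qed
      then show ?thesis
        using bridge_geodesic_sides[OF edge[OF i] _ V(1,2) s geo eq[OF s]] du i by auto
    qed
    have L: "0 < ?L" using d_eq_0_iff[OF V(1,2)] V(3) by auto
    show False
    proof (cases "even ?L")
      case False
      then obtain h where h: "?L = 2 * h + 1" by (rule oddE)
      \<comment> \<open>The middle edge \<open>i = h\<close> satisfies neither
        \<open>?L \<le> 2 * i\<close> nor \<open>2 * i + 2 \<le> ?L\<close>; the contradiction needs
        one landmark, hence \<open>S_nonempty\<close>.\<close>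
      then show False using sides[of h, OF _ s0] by simp
    next
      case True
      then obtain h where h: "?L = 2 * h" by (rule evenE)
      then have h0: "0 < h" using L by simp
      then obtain h' where h': "h = Suc h'" using gr0_implies_Suc by blast
      have "d s (f (Suc h)) = d s (f h) + 1" if "s \<in> S" for s
        using sides[of h, OF _ that] h h0 by simp
      then have "outward 1 (f h) (f (Suc h))" using edge[of h] h h0 by (simp add: outward_def)
      moreover have "d s (f h') = d s (f h) + 1" if "s \<in> S" for s
        using sides[of h', OF _ that] h h' by simp
      then have "outward 1 (f h) (f h')" using edge[of h'] h h' by (simp add: outward_def insert_commute)
      moreover have "d (f h') (f (Suc h)) = 2" using dist[of h' "Suc h"] h h' by simp
      then have "f h' \<noteq> f (Suc h)" by auto
      ultimately show False using no unfolding two_outward_def by blast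
    qed
  qed
qed

text \<open>With heights \<open>a \<ge> b\<close>, \<open>balanced_vertices\<close> gives
  \<open>g/2 = k + a - b\<close>. Equal heights are configuration A. Otherwise \<open>x\<close> sits
  at height \<open>a > 0\<close> on the thread at \<open>p\<close>, whose length is at least
  \<open>a\<close> and so at least \<open>g/2 - k\<close>.\<close>

lemma separated_vertices:
  assumes C: "C \<in> cycles E" and pq: "p \<in> \<Union>C" "q \<in> \<Union>C" "p \<noteq> q"
    and x: "x \<in> T C p" "x' \<in> T C q" and eq: "\<And>s. s \<in> S \<Longrightarrow> d s x = d s x'"
    and le: "d q x' \<le> d p x"
  shows "two_outward 1 \<or> config_A E S C \<or> config_C E S C"
proof (rule disjCI)
  assume no: "\<not> (config_A E S C \<or> config_C E S C)"
  show "two_outward 1"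
  proof (rule ccontr)
    assume "\<not> two_outward 1"
    moreover have "min (d p x) (d p x) = d p x" "min (d q x') (d q x') = d q x'" by simp_all
    ultimately have bal: "\<not> active E S C p" "d p x < d q x' + d p q"
      "\<And>u. active E S C u \<Longrightarrow> d u p + d p x = d u q + d q x'"
      using separated_items[OF C pq x(1,1) x(2,2), of "d p x" "d q x'"] eq le by auto
    obtain ws k i where ws: "two_act C ws k" "i \<le> k" "2 * (k + d p x - d q x') = length ws" "ws ! i = p"
      using balanced_vertices[OF C pq(1,2) le bal(2,3)] by metis
    show False
    proof (cases "d p x = d q x'")
      case True
      then have "config_A E S C" using ws(1,3) config_A_iff[OF C] by auto
      then show False using no by simp
    next
      case False
      then have "x \<noteq> p" using le by auto
      then obtain us i' where us: "free_thread E S p us" "d p x = length us - i'"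
        using inactive_vertex[OF C pq(1) bal(1) x(1)] by metis
      have "even (length ws)" using ws(3) by presburger
      moreover have "length ws div 2 \<le> length us + k" using ws(3) us(2) by linarith
      ultimately have "config_C E S C" using ws us(1) config_C_iff[OF C] by blast
      then show False using no by simp
    qed
  qed
qed

lemma vertex_generator_iff:
  assumes nopath: "\<not> path_graph V E"
  shows "vertex_metric_generator V E S \<longleftrightarrow>
    \<not> two_outward 1 \<and> (\<forall>C\<in>cycles E. \<not> config_A E S C \<and> \<not> config_C E S C)"
proof
  assume "vertex_metric_generator V E S"
  then show "\<not> two_outward 1 \<and> (\<forall>C\<in>cycles E. \<not> config_A E S C \<and> \<not> config_C E S C)"
    using two_outward_vertices config_A_imp(1) config_C_imp by blast
next
  assume no: "\<not> two_outward 1 \<and> (\<forall>C\<in>cycles E. \<not> config_A E S C \<and> \<not> config_C E S C)"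
  show "vertex_metric_generator V E S"
  proof (rule ccontr)
    assume "\<not> vertex_metric_generator V E S"
    then obtain x x' where x: "x \<in> V" "x' \<in> V" "x \<noteq> x'" and eq: "\<And>s. s \<in> S \<Longrightarrow> d s x = d s x'"
      unfolding vertex_metric_generator_def by metis
    obtain C p q where C: "C \<in> cycles E" and pq: "p \<in> \<Union>C" "q \<in> \<Union>C" "p \<noteq> q"
      and xT: "x \<in> T C p" "x' \<in> T C q"
      using undistinguished_vertices[OF x eq nopath] no by blast
    show False
    proof (cases "d q x' \<le> d p x")
      case True
      then show False using separated_vertices[OF C pq xT eq] no C by blast
    next
      case False
      then have "d p x \<le> d q x'" by simp
      then show False
        using separated_vertices[OF C pq(2,1) pq(3)[symmetric] xT(2,1) eq[symmetric]] no C by blast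
    qed
  qed
qed

text \<open>As for vertices, but an edge of lower height \<open>a\<close> needs a thread longer than
  \<open>a\<close>. The second edge hangs at \<open>q\<close>, which has index
  \<open>g/2 + k - i\<close>, and provides the other thread of configuration E.\<close>

lemma separated_edges:
  assumes C: "C \<in> cycles E" and pq: "p \<in> \<Union>C" "q \<in> \<Union>C" "p \<noteq> q"
    and x: "{x, y} \<in> E" "x \<in> T C p" "y \<in> T C p" and x': "{x', y'} \<in> E" "x' \<in> T C q" "y' \<in> T C q"
    and eq: "\<And>s. s \<in> S \<Longrightarrow> min (d s x) (d s y) = min (d s x') (d s y')"
    and le: "min (d q x') (d q y') \<le> min (d p x) (d p y)"
  shows "two_outward 1 \<or> config_A E S C \<or> config_E E S C"
proof (rule disjCI)
  assume no: "\<not> (config_A E S C \<or> config_E E S C)"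
  define a where "a = min (d p x) (d p y)"
  define b where "b = min (d q x') (d q y')"
  have ba: "b \<le> a" using le by (simp add: a_def b_def)
  show "two_outward 1"
  proof (rule ccontr)
    assume "\<not> two_outward 1"
    then have bal: "\<not> active E S C p" "\<not> active E S C q" "a < b + d p q"
      "\<And>u. active E S C u \<Longrightarrow> d u p + a = d u q + b"
      using separated_items[OF C pq x(2,3) x'(2,3) eq a_def b_def ba] by blast+
    obtain ws k i where ws: "two_act C ws k" "i \<le> k" "2 * (k + a - b) = length ws" "ws ! i = p"
      "length ws div 2 + k - i < length ws" "ws ! (length ws div 2 + k - i) = q"
      using balanced_vertices[OF C pq(1,2) ba bal(3,4)] by metis
    show False
    proof (cases "a = b")
      case True
      then have "config_A E S C" using ws(1,3) config_A_iff[OF C] by auto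
      then show False using no by simp
    next
      case False
      obtain us where us: "free_thread E S p us" "a < length us"
        using inactive_edge[OF C pq(1) bal(1) x] unfolding a_def by metis
      obtain us' where us': "free_thread E S q us'" using inactive_edge[OF C pq(2) bal(2) x'] by metis
      have "length ws div 2 + 1 \<le> length us + k" using ws(3) us(2) by linarith
      moreover have "free_thread E S (ws ! ((length ws div 2 + k - i) mod length ws)) us'"
        using us' ws(5,6) by simp
      ultimately have "config_E E S C" using ws us(1) config_E_iff[OF C] by blast
      then show False using no by simp
    qed
  qed
qed

text \<open>If \<open>a < D\<close>, then \<open>p\<close> is inactive and the length
  \<open>2 * (k + a) + 1\<close> is odd, so one thread suffices for configuration E. Otherwise
  \<open>a = D\<close>, and the steps from \<open>p\<close> towards both edges are outward; as
  \<open>p\<close> may be an end of both, \<open>a = 0\<close> occurs and \<epsilon> = 0 is the most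
  that can be claimed.\<close>

lemma separated_edge_cycle_edge:
  assumes C: "C \<in> cycles E" and p: "p \<in> \<Union>C"
    and x: "{x, y} \<in> E" "x \<in> T C p" "y \<in> T C p" and q: "{q, q'} \<in> C"
    and eq: "\<And>s. s \<in> S \<Longrightarrow> min (d s x) (d s y) = min (d s q) (d s q')"
  shows "two_outward 0 \<or> config_E E S C"
proof -
  define a where "a = min (d p x) (d p y)"
  define D where "D = min (d p q) (d p q')"
  have qC: "q \<in> \<Union>C" "q' \<in> \<Union>C" and qE: "{q, q'} \<in> E" using q C by (auto simp: cycles_def)
  have V: "p \<in> V" "x \<in> V" "y \<in> V" "q \<in> V" "q' \<in> V"
    using cycle_in_V[OF C p] edge_in_V[OF x(1)] edge_in_V[OF qE] by auto
  note far = d_item_far[OF C p x(2,3), folded a_def]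
  have far': "min (d s q) (d s q') = d s u + min (d u q) (d u q')" if "s \<in> T C u" "u \<in> \<Union>C" for s u
    using d_to_cycle[OF C that(2) qC(1) that(1)] d_to_cycle[OF C that(2) qC(2) that(1)] by simp
  have bal: "d u p + a = min (d u q) (d u q')" if u: "active E S C u" "u \<noteq> p" for u
  proof -
    obtain s where s: "s \<in> T C u" "u \<in> \<Union>C" "s \<in> S" using u(1) by (auto simp: active_def)
    then show ?thesis using far[OF s(1,2) u(2)] far'[OF s(1,2)] eq[OF s(3)] by simp
  qed
  show ?thesis
  proof (cases "a < D")
    case True
    have inact: "\<not> active E S C p"
    proof
      assume "active E S C p"
      then obtain s where s: "s \<in> T C p" "s \<in> S" by (auto simp: active_def)
      have "s \<in> V" using s S_sub by blast
      then have "min (d s x) (d s y) \<le> d s p + a" using d_item_le V unfolding a_def by blast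
      moreover have "min (d s q) (d s q') = d s p + D" using far'[OF s(1) p] by (simp add: D_def)
      ultimately show False using eq[OF s(2)] True by simp
    qed
    obtain us where us: "free_thread E S p us" "a < length us"
      using inactive_edge[OF C p inact x] unfolding a_def by metis
    have bal': "d u p + a = min (d u q) (d u q')" if "active E S C u" for u
      using bal[OF that] that inact by blast
    obtain ws k i where ws: "two_act C ws k" "i \<le> k" "2 * (k + a) + 1 = length ws" "ws ! i = p"
      using balanced_vertex_edge[OF C p q True[unfolded D_def] bal'] by metis
    have "odd (length ws)" using ws(3) by presburger
    moreover have "length ws div 2 = k + a" using ws(3) by presburger
    then have "length ws div 2 + 1 \<le> length us + k" using us(2) by linarith
    ultimately have "config_E E S C" using ws us(1) config_E_iff[OF C] by blast
    then show ?thesis by simp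
  next
    case False
    obtain u v where "u \<noteq> v" "active E S C u" "active E S C v" using two_active[OF C] .
    then obtain u where u: "active E S C u" "u \<noteq> p" by metis
    have "u \<in> V" using u(1) cycle_in_V[OF C] unfolding active_def by blast
    then have "d u q \<le> d u p + d p q" "d u q' \<le> d u p + d p q'" using d_triangle V by blast+
    then have "d u p + a \<le> d u p + D" unfolding bal[OF u] D_def by (auto simp: min_def)
    then have aD: "a = D" using False by simp
    have eq_x: "min (d s x) (d s y) = d s p + a" if s: "s \<in> S" for s
    proof -
      obtain u where u: "active E S C u" "u \<in> \<Union>C" "s \<in> T C u" using active_cover[OF C s] .
      show ?thesis
      proof (cases "u = p")
        case True
        then show ?thesis using far'[OF u(3,2)] eq[OF s] aD by (simp add: D_def)
      next
        case False
        then show ?thesis using far[OF u(3,2)] d_to_cycle[OF C u(2) p u(3)] by simp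
      qed
    qed
    have eq_q: "min (d s q) (d s q') = d s p + a" if "s \<in> S" for s using eq_x eq that by simp
    have aq: "a = min (d p q) (d p q')" using aD by (simp add: D_def)
    obtain n1 where n1: "outward 0 p n1" "min (d n1 x) (d n1 y) + 1 = a \<or> a = 0 \<and> n1 \<in> {x, y} \<and> n1 \<noteq> p"
      by (rule toward_outward[OF V(1,2,3) a_def eq_x, of 0]) (use x in auto)
    obtain n2 where n2: "outward 0 p n2" "min (d n2 q) (d n2 q') + 1 = a \<or> a = 0 \<and> n2 \<in> {q, q'} \<and> n2 \<noteq> p"
      by (rule toward_outward[OF V(1,4,5) aq eq_q, of 0]) (use qE in auto)
    have nV: "n1 \<in> V" "n2 \<in> V" using n1(1) n2(1) edge_in_V by (auto simp: outward_def)
    have "n1 \<in> T C p" using n1(2)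
    proof
      assume "min (d n1 x) (d n1 y) + 1 = a"
      then have "min (d n1 x) (d n1 y) < min (d p x) (d p y)" unfolding a_def by linarith
      then show ?thesis by (rule toward_item_inside[OF C p x(2,3) nV(1)])
    qed (use x in auto)
    moreover have "n2 \<notin> T C p"
    proof
      assume n: "n2 \<in> T C p"
      show False
      proof (cases "min (d n2 q) (d n2 q') + 1 = a")
        case True
        then show False using far'[OF n p] aq by simp
      next
        case False
        then have "n2 \<in> \<Union>C" "n2 \<noteq> p" using n2(2) qC by auto
        then show False using component_cycle_vertex[OF C p _ n] by simp
      qed
    qed
    ultimately have "n1 \<noteq> n2" by auto
    then show ?thesis using n1(1) n2(1) by (auto simp: two_outward_def)
  qed
qed

text \<open>The second edge lies on the side of \<open>x\<close>: \<open>x'\<close> because it is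
  not nearer to \<open>y\<close>, and \<open>y'\<close> because the only edge across is
  \<open>{x, y}\<close>. A landmark on the side of \<open>y\<close> would be strictly nearer to the
  first edge, so there is none.\<close>

lemma bridge_edge_side:
  assumes e: "{x, y} \<in> E" "\<And>C. C \<in> cycles E \<Longrightarrow> {x, y} \<notin> C"
    and e': "{x', y'} \<in> E" "{x, y} \<noteq> {x', y'}"
    and close: "d x x' \<le> d y x'" and s: "s \<in> S"
    and eq: "min (d s x) (d s y) = min (d s x') (d s y')"
  shows "d s y = d s x + 1"
proof -
  let ?B = "component (E - {{x, y}}) y"
  have V: "x \<in> V" "y \<in> V" "x' \<in> V" "y' \<in> V" using edge_in_V e(1) e'(1) by blast+
  have sV: "s \<in> V" using s S_sub by blast
  have xB: "x \<notin> ?B" "y \<in> ?B" using bridge_separates[OF e] by simp_all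
  have x': "x' \<notin> ?B"
  proof
    assume "x' \<in> ?B"
    then have "d x x' = d x x + 1 + d y x'" using d_bridge[OF e V(1) xB(1)] by blast
    then show False using close by simp
  qed
  have y': "y' \<notin> ?B"
  proof
    assume "y' \<in> ?B"
    then show False using bridge_entry[OF e e'(1) x'] e'(2) by simp
  qed
  have sB: "s \<notin> ?B"
  proof
    assume sB: "s \<in> ?B"
    have "d x' s = d x' x + 1 + d y s" using d_bridge[OF e V(3) x' sB] .
    moreover have "d y' s = d y' x + 1 + d y s" using d_bridge[OF e V(4) y' sB] .
    moreover have "min (d s x) (d s y) \<le> d s y" by simp
    ultimately show False using eq by (simp add: gdist_commute)
  qed
  show ?thesis using d_bridge[OF e sV sB xB(2)] by simp
qed

text \<open>For ends \<open>x\<close> and \<open>x'\<close> that face each other,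
  \<open>bridge_edge_side\<close> turns equal edge distances into \<open>d s x = d s x'\<close>, so
  the result on vertices applies to them. A cycle that separates \<open>x\<close> from
  \<open>x'\<close> separates the two bridges as well.\<close>

lemma bridge_edges:
  assumes e: "{x, y} \<in> E" "\<And>C. C \<in> cycles E \<Longrightarrow> {x, y} \<notin> C"
    and e': "{x', y'} \<in> E" "\<And>C. C \<in> cycles E \<Longrightarrow> {x', y'} \<notin> C"
    and ne: "{x, y} \<noteq> {x', y'}"
    and close: "d x x' \<le> d y x'" "d x x' \<le> d x y'"
    and eq: "\<And>s. s \<in> S \<Longrightarrow> min (d s x) (d s y) = min (d s x') (d s y')"
    and nopath: "\<not> path_graph V E"
  shows "two_outward 1 \<or> (\<exists>C\<in>cycles E. config_A E S C \<or> config_E E S C)"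
proof -
  have V: "x \<in> V" "x' \<in> V" using edge_in_V e(1) e'(1) by blast+
  have far: "d s y = d s x + 1" if "s \<in> S" for s
    using bridge_edge_side[OF e e'(1) ne close(1) that eq[OF that]] .
  have close': "d x' x \<le> d y' x" using close(2) by (simp add: gdist_commute)
  have far': "d s y' = d s x' + 1" if "s \<in> S" for s
    using bridge_edge_side[OF e' e(1) ne[symmetric] close' that eq[OF that, symmetric]] .
  have eq_x: "d s x = d s x'" if "s \<in> S" for s using eq far far' that by simp
  show ?thesis
  proof (cases "x = x'")
    case True
    then have "y \<noteq> y'" using ne by auto
    moreover have "outward 1 x y" "outward 1 x y'"
      using e(1) e'(1) far far' True by (simp_all add: outward_def)
    ultimately show ?thesis unfolding two_outward_def by blast
  next
    case False
    have "two_outward 1 \<or>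
        (\<exists>C\<in>cycles E. \<exists>p q. p \<in> \<Union>C \<and> q \<in> \<Union>C \<and> p \<noteq> q \<and> x \<in> T C p \<and> x' \<in> T C q)"
      by (rule undistinguished_vertices[OF V False eq_x nopath])
    then show ?thesis
    proof
      assume "\<exists>C\<in>cycles E. \<exists>p q. p \<in> \<Union>C \<and> q \<in> \<Union>C \<and> p \<noteq> q \<and> x \<in> T C p \<and> x' \<in> T C q"
      then obtain C p q where C: "C \<in> cycles E" and pq: "p \<in> \<Union>C" "q \<in> \<Union>C" "p \<noteq> q"
        and xT: "x \<in> T C p" "x' \<in> T C q" by blast
      have yT: "y \<in> T C p" using component_step[OF xT(1), of y] e(1) e(2)[OF C] by simp
      have yT': "y' \<in> T C q" using component_step[OF xT(2), of y'] e'(1) e'(2)[OF C] by simp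
      have "two_outward 1 \<or> config_A E S C \<or> config_E E S C"
      proof (cases "min (d q x') (d q y') \<le> min (d p x) (d p y)")
        case True
        show ?thesis using separated_edges[OF C pq e(1) xT(1) yT e'(1) xT(2) yT' eq True] .
      next
        case False
        then have le: "min (d p x) (d p y) \<le> min (d q x') (d q y')" by linarith
        show ?thesis
          using separated_edges[OF C pq(2,1) pq(3)[symmetric] e'(1) xT(2) yT' e(1) xT(1) yT eq[symmetric] le] .
      qed
      then show ?thesis using C by blast
    qed (rule disjI1)
  qed
qed

lemma undistinguished_edges:
  assumes e: "{x, y} \<in> E" and e': "{x', y'} \<in> E" and ne: "{x, y} \<noteq> {x', y'}"
    and eq: "\<And>s. s \<in> S \<Longrightarrow> min (d s x) (d s y) = min (d s x') (d s y')"
    and nopath: "\<not> path_graph V E"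
  shows "two_outward 0 \<or> (\<exists>C\<in>cycles E. config_A E S C \<or> config_E E S C)"
proof -
  have on_cycle: ?thesis
    if C: "C \<in> cycles E" "{x', y'} \<in> C" and e: "{x, y} \<in> E" and ne: "{x, y} \<noteq> {x', y'}"
      and eq: "\<And>s. s \<in> S \<Longrightarrow> min (d s x) (d s y) = min (d s x') (d s y')"
    for C x y x' y'
  proof (cases "{x, y} \<in> C")
    case True
    have V: "x \<in> \<Union>C" "y \<in> \<Union>C" "x' \<in> \<Union>C" "y' \<in> \<Union>C" using True C(2) by blast+
    have "min (d u x) (d u y) = min (d u x') (d u y')" if u: "active E S C u" for u
    proof -
      obtain s where s: "s \<in> T C u" "s \<in> S" "u \<in> \<Union>C" using u by (auto simp: active_def)
      then show ?thesis
        using eq[OF s(2)] d_to_cycle[OF C(1) s(3) V(1) s(1)] d_to_cycle[OF C(1) s(3) V(2) s(1)]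
          d_to_cycle[OF C(1) s(3) V(3) s(1)] d_to_cycle[OF C(1) s(3) V(4) s(1)] by simp
    qed
    then have "config_A E S C" using balanced_edges[OF C(1) True C(2) ne] by blast
    then show ?thesis using C by blast
  next
    case False
    obtain p where p: "p \<in> \<Union>C" "x \<in> T C p" using T_cover[OF C(1), of x] edge_in_V[OF e] by metis
    then have "y \<in> T C p" using component_step[of x _ p y] e False by simp
    then show ?thesis using separated_edge_cycle_edge[OF C(1) p(1) e p(2) _ C(2) eq] C(1) by blast
  qed
  show ?thesis
  proof (cases "\<exists>C\<in>cycles E. {x', y'} \<in> C \<or> {x, y} \<in> C")
    case True
    then show ?thesis using on_cycle[of _ x' y' x y] on_cycle[of _ x y x' y'] e e' ne eq by metis
  next
    case False
    \<comment> \<open>The ends are renamed so that \<open>a\<close> and \<open>a'\<close> face each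
      other, as \<open>bridge_edges\<close> requires; a closest pair among the four choices of ends
      will do.\<close>
    have main: ?thesis
      if "{a, b} = {x, y}" "{a', b'} = {x', y'}" "d a a' \<le> d b a'" "d a a' \<le> d a b'" for a b a' b'
    proof -
      have "min (d s a) (d s b) = min (d s a') (d s b')" if "s \<in> S" for s
        using eq[OF that] \<open>{a, b} = {x, y}\<close> \<open>{a', b'} = {x', y'}\<close>
        by (auto simp: doubleton_eq_iff min.commute)
      then have "two_outward 1 \<or> (\<exists>C\<in>cycles E. config_A E S C \<or> config_E E S C)"
        using bridge_edges[of a b a' b'] that e e' ne False nopath by metis
      then show ?thesis using two_outward_mono[of 1 0] by auto
    qed
    have yx: "{y, x} = {x, y}" "{y', x'} = {x', y'}" by auto
    consider "d x x' \<le> d y x'" "d x x' \<le> d x y'" | "d y x' \<le> d x x'" "d y x' \<le> d y y'"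
      | "d x y' \<le> d y y'" "d x y' \<le> d x x'" | "d y y' \<le> d x y'" "d y y' \<le> d y x'"
      by linarith
    then show ?thesis
    proof cases
      case 1
      then show ?thesis by (rule main[OF refl refl])
    next
      case 2
      then show ?thesis by (rule main[OF yx(1) refl])
    next
      case 3
      then show ?thesis by (rule main[OF refl yx(2)])
    next
      case 4
      then show ?thesis by (rule main[OF yx(1) yx(2)])
    qed
  qed
qed

lemma edge_generator_iff:
  assumes nopath: "\<not> path_graph V E"
  shows "edge_metric_generator E S \<longleftrightarrow>
    \<not> two_outward 0 \<and> (\<forall>C\<in>cycles E. \<not> config_A E S C \<and> \<not> config_E E S C)"
proof
  assume "edge_metric_generator E S"
  then show "\<not> two_outward 0 \<and> (\<forall>C\<in>cycles E. \<not> config_A E S C \<and> \<not> config_E E S C)"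
    using two_outward_edges config_A_imp(2) config_E_imp by blast
next
  assume no: "\<not> two_outward 0 \<and> (\<forall>C\<in>cycles E. \<not> config_A E S C \<and> \<not> config_E E S C)"
  show "edge_metric_generator E S"
  proof (rule ccontr)
    assume "\<not> edge_metric_generator E S"
    then obtain e f where ef: "e \<in> E" "f \<in> E" "e \<noteq> f" "\<And>s. s \<in> S \<Longrightarrow> edge_dist E s e = edge_dist E s f"
      unfolding edge_metric_generator_def by metis
    obtain x y where e: "e = {x, y}" using edgeE[OF ef(1)] .
    obtain x' y' where f: "f = {x', y'}" using edgeE[OF ef(2)] .
    have "two_outward 0 \<or> (\<exists>C\<in>cycles E. config_A E S C \<or> config_E E S C)"
      using undistinguished_edges[of x y x' y'] ef nopath unfolding e f edge_dist_pair by blast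
    then show False using no by blast
  qed
qed

end

theorem theorem13:
  fixes V :: "'a set" and E :: "'a set set" and S :: "'a set"
  assumes "cactus V E"
    and "\<not> path_graph V E"
    and "S \<subseteq> V"
    and "biactive E S"
    and "branch_resolving V E S"
  shows "(vertex_metric_generator V E S \<longleftrightarrow>
            (\<forall>C\<in>cycles E. \<not> config_A E S C \<and> \<not> config_B E S C \<and> \<not> config_C E S C) \<and>
            \<not> (\<exists>C\<in>cycles E. \<exists>D\<in>cycles E. vertex_critically_incident E S C D)) \<and>
         (edge_metric_generator E S \<longleftrightarrow>
            (\<forall>C\<in>cycles E. \<not> config_A E S C \<and> \<not> config_D E S C \<and> \<not> config_E E S C) \<and>
            \<not> (\<exists>C\<in>cycles E. \<exists>D\<in>cycles E. edge_critically_incident E S C D))"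
proof -
  interpret cactus_landmarks V E S
    using assms by unfold_locales
  have inc: "vertex_critically_incident E S C D \<longleftrightarrow> critically_incident 1 C D"
    "edge_critically_incident E S C D \<longleftrightarrow> critically_incident 0 C D" for C D
    by (simp_all add: vertex_critically_incident_def edge_critically_incident_def
        critically_incident_def vertex_critical_eq edge_critical_eq)
  show ?thesis
    unfolding vertex_generator_iff[OF assms(2)] edge_generator_iff[OF assms(2)]
      two_outward_iff[OF order_refl assms(2)] two_outward_iff[OF zero_le_one assms(2)]
      config_B_thread_config config_D_thread_config inc
    by blast
qed

end
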